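(* Let $d\ge 2$ and let $1\le p_1,p_2\le\infty$. Then $$L(p_1,p_2)\lesssim 1\quad\text{if and only if}\quad \frac{1}{p_1}+\frac{d}{p_2}\le d\ \text{ and }\ \frac{d}{p_1}+\frac{1}{p_2}\le d.$$
   Context: Conventions: $q$ ranges over powers of odd primes, $\mathbb F_q$ is the field with $q$ elements; when $d=2$ only those $q$ are considered for which $3$ is a nonzero square in $\mathbb F_q$. For $x\in\mathbb F_q^d$ put $\|x\|=x_1^2+\cdots+x_d^2$. For $t\in\mathbb F_q^*$, $S_t=\{x\in\mathbb F_q^d:\|x\|=t\}$, and $S_t(x)$ also denotes its indicator function. For $f:\mathbb F_q^d\to\mathbb R$: $\|f\|_p=(q^{-d}\sum_{x}|f(x)|^p)^{1/p}$ for $1\le p<\infty$ and $\|f\|_\infty=\max_x|f(x)|$. Exponents are extended real numbers, with $1/\infty=0$. The $K_2$-operator on $\mathbb F_q^d$ is $$L(f_1,f_2)=\frac{1}{q^d|S_t|}\sum_{x^1,x^2\in\mathbb F_q^d}S_t(x^1-x^2)f_1(x^1)f_2(x^2).$$ $L(p_1,p_2)$ is the smallest constant such that $L(f_1,f_2)\le L(p_1,p_2)\|f_1\|_{p_1}\|f_2\|_{p_2}$ for all non-negative real-valued $f_1,f_2$ on $\mathbb F_q^d$. $L(p_1,p_2)\lesssim 1$ means that there is a constant $C\ge1$, independent of $q$ and of $t\in\mathbb F_q^*$, with $L(p_1,p_2)\le C$ for all such $q$ and $t$. *)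

theory Defs
  imports
    Complex_Main
    "HOL-Library.Extended_Real"
    "HOL-Library.FuncSet"
    "HOL-Library.Indicator_Function"
    "HOL-Computational_Algebra.Primes"
    "HOL-Algebra.Ring"
    "HOL-Algebra.Coset"
begin

section \<open>The space of vectors over a finite field\<close>

text \<open>
  Vectors of length \<open>d\<close> are extensional functions on \<open>{..<d}\<close>, so that each vector is
  represented exactly once.
\<close>

definition vecs :: "('a, 'm) ring_scheme \<Rightarrow> nat \<Rightarrow> (nat \<Rightarrow> 'a) set" where
  "vecs F d = {..<d} \<rightarrow>\<^sub>E carrier F"

definition vminus :: "('a, 'm) ring_scheme \<Rightarrow> nat \<Rightarrow> (nat \<Rightarrow> 'a) \<Rightarrow> (nat \<Rightarrow> 'a) \<Rightarrow> (nat \<Rightarrow> 'a)" where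
  "vminus F d x y = (\<lambda>i\<in>{..<d}. x i \<ominus>\<^bsub>F\<^esub> y i)"

definition sqnorm :: "('a, 'm) ring_scheme \<Rightarrow> nat \<Rightarrow> (nat \<Rightarrow> 'a) \<Rightarrow> 'a" where
  "sqnorm F d x = (\<Oplus>\<^bsub>F\<^esub>i\<in>{..<d}. x i [^]\<^bsub>F\<^esub> (2::nat))"

definition sphere :: "('a, 'm) ring_scheme \<Rightarrow> nat \<Rightarrow> 'a \<Rightarrow> (nat \<Rightarrow> 'a) set" where
  "sphere F d t = {x \<in> vecs F d. sqnorm F d x = t}"

text \<open>
  The fields under consideration: the order is a power of an odd prime and, if \<open>d = 2\<close>, the
  element 3 is a nonzero square. Finiteness of the carrier is implied, since \<open>card\<close> is 0 on
  infinite sets.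
\<close>

definition admissible_field :: "nat \<Rightarrow> ('a, 'm) ring_scheme \<Rightarrow> bool" where
  "admissible_field d F \<longleftrightarrow>
     field F \<and>
     (\<exists>p k. prime (p::nat) \<and> odd p \<and> 0 < k \<and> order F = p ^ k) \<and>
     (d = 2 \<longrightarrow>
        (let three = \<one>\<^bsub>F\<^esub> \<oplus>\<^bsub>F\<^esub> \<one>\<^bsub>F\<^esub> \<oplus>\<^bsub>F\<^esub> \<one>\<^bsub>F\<^esub>
         in three \<noteq> \<zero>\<^bsub>F\<^esub> \<and> (\<exists>y\<in>carrier F. y [^]\<^bsub>F\<^esub> (2::nat) = three)))"


section \<open>Normalised norms and the operator\<close>

text \<open>Used only for exponents \<open>1 \<le> p \<le> \<infinity>\<close>.\<close>

definition Lp_norm ::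
  "('a, 'm) ring_scheme \<Rightarrow> nat \<Rightarrow> ereal \<Rightarrow> ((nat \<Rightarrow> 'a) \<Rightarrow> real) \<Rightarrow> real" where
  "Lp_norm F d p f =
     (if p = \<infinity> then Max ((\<lambda>x. \<bar>f x\<bar>) ` vecs F d)
      else ((\<Sum>x\<in>vecs F d. \<bar>f x\<bar> powr real_of_ereal p) / real (order F) ^ d)
             powr (1 / real_of_ereal p))"

definition K2_op ::
  "('a, 'm) ring_scheme \<Rightarrow> nat \<Rightarrow> 'a \<Rightarrow> ((nat \<Rightarrow> 'a) \<Rightarrow> real) \<Rightarrow> ((nat \<Rightarrow> 'a) \<Rightarrow> real) \<Rightarrow> real" where
  "K2_op F d t f1 f2 =
     1 / (real (order F) ^ d * real (card (sphere F d t))) *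
     (\<Sum>x1\<in>vecs F d. \<Sum>x2\<in>vecs F d.
        indicat_real (sphere F d t) (vminus F d x1 x2) * f1 x1 * f2 x2)"

definition K2_bound :: "('a, 'm) ring_scheme \<Rightarrow> nat \<Rightarrow> 'a \<Rightarrow> ereal \<Rightarrow> ereal \<Rightarrow> real \<Rightarrow> bool" where
  "K2_bound F d t p1 p2 c \<longleftrightarrow>
     (\<forall>f1 f2. (\<forall>x\<in>vecs F d. 0 \<le> f1 x) \<and> (\<forall>x\<in>vecs F d. 0 \<le> f2 x) \<longrightarrow>
        K2_op F d t f1 f2 \<le> c * Lp_norm F d p1 f1 * Lp_norm F d p2 f2)"

text \<open>
  For exponents in \<open>[1, \<infinity>]\<close> the least constant exists, see \<open>K2_bound_K2_const\<close> and
  \<open>K2_const_le\<close> below.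
\<close>

definition K2_const :: "('a, 'm) ring_scheme \<Rightarrow> nat \<Rightarrow> 'a \<Rightarrow> ereal \<Rightarrow> ereal \<Rightarrow> real" where
  "K2_const F d t p1 p2 = (LEAST c. K2_bound F d t p1 p2 c)"

text \<open>
  The constant \<open>C\<close> has to be uniform in the field, so the field is quantified inside the
  formula as a ring record. Carriers consisting of natural numbers suffice: every finite field
  is isomorphic to one of these.
\<close>

definition K2_uniformly_bounded :: "nat \<Rightarrow> ereal \<Rightarrow> ereal \<Rightarrow> bool" where
  "K2_uniformly_bounded d p1 p2 \<longleftrightarrow>
     (\<exists>C\<ge>1. \<forall>F :: nat ring. admissible_field d F \<longrightarrow>
        (\<forall>t\<in>carrier F - {\<zero>\<^bsub>F\<^esub>}. K2_const F d t p1 p2 \<le> C))"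


section \<open>Existence of the optimal constant\<close>

lemma finite_vecs: "finite (carrier F) \<Longrightarrow> finite (vecs F d)"
  by (simp add: vecs_def finite_PiE)

lemma card_vecs: "card (vecs F d) = order F ^ d"
  by (simp add: vecs_def card_PiE order_def)

lemma Lp_norm_nonneg:
  assumes "finite (carrier F)" "vecs F d \<noteq> {}"
  shows "0 \<le> Lp_norm F d p f"
proof (cases "p = \<infinity>")
  case True
  obtain x where x: "x \<in> vecs F d" using assms by blast
  have "\<bar>f x\<bar> \<le> Max ((\<lambda>x. \<bar>f x\<bar>) ` vecs F d)"
    by (rule Max_ge) (use x assms finite_vecs in auto)
  then show ?thesis using True by (simp add: Lp_norm_def)
qed (simp add: Lp_norm_def)

lemma le_Lp_norm:
  assumes fin: "finite (carrier F)" and x: "x \<in> vecs F d" and f: "0 \<le> f x" and p: "1 \<le> p"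
  shows "f x \<le> real (order F) ^ d * Lp_norm F d p f"
proof -
  let ?N = "real (order F) ^ d"
  have "card (vecs F d) > 0" using finite_vecs[OF fin] x by (auto simp: card_gt_0_iff)
  then have "order F ^ d \<ge> 1" unfolding card_vecs by linarith
  then have N: "1 \<le> ?N" by (metis of_nat_1 of_nat_le_iff of_nat_power)
  show ?thesis
  proof (cases "p = \<infinity>")
    case True
    have "\<bar>f x\<bar> \<le> Max ((\<lambda>x. \<bar>f x\<bar>) ` vecs F d)"
      by (rule Max_ge) (use x fin finite_vecs in auto)
    then have 1: "f x \<le> Lp_norm F d p f" using True by (simp add: Lp_norm_def)
    have "1 * Lp_norm F d p f \<le> ?N * Lp_norm F d p f"
      by (rule mult_right_mono) (use N 1 f in auto)
    then show ?thesis using 1 by simp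
  next
    case False
    then obtain r where r: "p = ereal r" "1 \<le> r" using p by (cases p) auto
    let ?S = "\<Sum>x\<in>vecs F d. \<bar>f x\<bar> powr r"
    have S0: "0 \<le> ?S" by (simp add: sum_nonneg)
    have "f x powr r \<le> ?S"
      using member_le_sum[OF x, of "\<lambda>x. \<bar>f x\<bar> powr r"] finite_vecs[OF fin] f by simp
    then have "(f x powr r) powr (1/r) \<le> ?S powr (1/r)"
      using r by (intro powr_mono2) auto
    moreover have "(f x powr r) powr (1/r) = f x" using f r by (simp add: powr_powr)
    ultimately have "f x \<le> ?S powr (1/r)" by simp
    also have "\<dots> = ?N powr (1/r) * (?S / ?N) powr (1/r)"
    proof -
      have "?N * (?S / ?N) = ?S" using N by (metis less_irrefl less_le_trans nonzero_mult_div_cancel_left times_divide_eq_right zero_less_one)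
      then show ?thesis using N S0 by (subst powr_mult[symmetric]) auto
    qed
    also have "\<dots> \<le> ?N powr 1 * (?S / ?N) powr (1/r)"
      using N r by (intro mult_right_mono powr_mono) auto
    also have "\<dots> = ?N * Lp_norm F d p f" using N r by (simp add: Lp_norm_def)
    finally show ?thesis .
  qed
qed

lemma K2_bound_exists:
  fixes F :: "('a, 'm) ring_scheme"
  assumes fin: "finite (carrier F)" and ne: "vecs F d \<noteq> {}" and p: "1 \<le> p1" "1 \<le> p2"
  shows "\<exists>c. K2_bound F d t p1 p2 c"
proof -
  let ?N = "real (order F) ^ d"
  let ?k = "1 / (?N * real (card (sphere F d t)))"
  let ?c = "?k * (\<Sum>x1\<in>vecs F d. \<Sum>x2\<in>vecs F d. ?N * ?N)"
  have "K2_bound F d t p1 p2 ?c"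
    unfolding K2_bound_def
  proof (intro allI impI, elim conjE)
    fix f1 f2 :: "(nat \<Rightarrow> 'a) \<Rightarrow> real" assume f: "\<forall>x\<in>vecs F d. 0 \<le> f1 x" "\<forall>x\<in>vecs F d. 0 \<le> f2 x"
    let ?A = "Lp_norm F d p1 f1" and ?B = "Lp_norm F d p2 f2"
    have "indicat_real (sphere F d t) (vminus F d x1 x2) * f1 x1 * f2 x2 \<le> (?N * ?A) * (?N * ?B)"
      if "x1 \<in> vecs F d" "x2 \<in> vecs F d" for x1 x2
    proof -
      have "f1 x1 * f2 x2 \<le> (?N * ?A) * (?N * ?B)"
        using that f by (intro mult_mono le_Lp_norm fin p mult_nonneg_nonneg Lp_norm_nonneg ne) auto
      moreover have "0 \<le> f1 x1 * f2 x2" using that f by simp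
      ultimately show ?thesis by (auto simp: indicator_def)
    qed
    then have "(\<Sum>x1\<in>vecs F d. \<Sum>x2\<in>vecs F d.
        indicat_real (sphere F d t) (vminus F d x1 x2) * f1 x1 * f2 x2)
      \<le> (\<Sum>x1\<in>vecs F d. \<Sum>x2\<in>vecs F d. (?N * ?A) * (?N * ?B))"
      by (intro sum_mono) auto
    then have "K2_op F d t f1 f2 \<le> ?k * (\<Sum>x1\<in>vecs F d. \<Sum>x2\<in>vecs F d. (?N * ?A) * (?N * ?B))"
      unfolding K2_op_def by (rule mult_left_mono) simp
    also have "\<dots> = ?c * ?A * ?B" by simp
    finally show "K2_op F d t f1 f2 \<le> ?c * ?A * ?B" .
  qed
  then show ?thesis ..
qed

lemma Lp_norm_one:
  assumes "finite (carrier F)" "vecs F d \<noteq> {}" "1 \<le> p"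
  shows "Lp_norm F d p (\<lambda>_. 1) = 1"
proof -
  have "order F ^ d \<noteq> 0" using assms finite_vecs card_vecs by (metis card_eq_0_iff)
  moreover have "(\<lambda>x. \<bar>1::real\<bar>) ` vecs F d = {1}" using assms by auto
  ultimately show ?thesis using card_vecs[of F d] by (auto simp add: Lp_norm_def simp del: image_constant_conv)
qed

lemma K2_bound_nonneg:
  assumes fin: "finite (carrier F)" and ne: "vecs F d \<noteq> {}" and p: "1 \<le> p1" "1 \<le> p2"
    and K: "K2_bound F d t p1 p2 c"
  shows "0 \<le> c"
proof -
  have "K2_op F d t (\<lambda>_. 1) (\<lambda>_. 1) \<le> c"
    using K Lp_norm_one[OF fin ne] p unfolding K2_bound_def
    by (metis mult.right_neutral zero_le_one)
  moreover have "0 \<le> K2_op F d t (\<lambda>_. 1) (\<lambda>_. 1)"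
    unfolding K2_op_def by (intro mult_nonneg_nonneg sum_nonneg) auto
  ultimately show ?thesis by simp
qed

lemma
  fixes F :: "('a, 'm) ring_scheme"
  assumes fin: "finite (carrier F)" and ne: "vecs F d \<noteq> {}" and p: "1 \<le> p1" "1 \<le> p2"
  shows K2_bound_K2_const: "K2_bound F d t p1 p2 (K2_const F d t p1 p2)"
    and K2_const_le: "K2_bound F d t p1 p2 c \<Longrightarrow> K2_const F d t p1 p2 \<le> c"
proof -
  define B where "B = {c. K2_bound F d t p1 p2 c}"
  have B: "B \<noteq> {}" "bdd_below B"
    using K2_bound_exists[OF assms] K2_bound_nonneg[OF assms] by (auto simp: B_def intro!: bdd_belowI)
  have inf: "K2_bound F d t p1 p2 (Inf B)"
    unfolding K2_bound_def
  proof (intro allI impI)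
    fix f1 f2 :: "(nat \<Rightarrow> 'a) \<Rightarrow> real" assume f: "(\<forall>x\<in>vecs F d. 0 \<le> f1 x) \<and> (\<forall>x\<in>vecs F d. 0 \<le> f2 x)"
    let ?A = "Lp_norm F d p1 f1 * Lp_norm F d p2 f2"
    have le: "K2_op F d t f1 f2 \<le> c * ?A" if "c \<in> B" for c
      using that f by (auto simp: B_def K2_bound_def mult.assoc)
    have "0 \<le> ?A" by (intro mult_nonneg_nonneg Lp_norm_nonneg fin ne)
    then consider "?A = 0" | "0 < ?A" by linarith
    then have "K2_op F d t f1 f2 \<le> Inf B * ?A"
    proof cases
      case 1
      then show ?thesis using le B by (metis ex_in_conv mult_zero_right)
    next
      case 2
      then have "K2_op F d t f1 f2 / ?A \<le> Inf B"
        by (intro cInf_greatest B) (simp add: le pos_divide_le_eq)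
      then show ?thesis using 2 by (simp add: pos_divide_le_eq)
    qed
    then show "K2_op F d t f1 f2 \<le> Inf B * Lp_norm F d p1 f1 * Lp_norm F d p2 f2"
      by (simp add: mult.assoc)
  qed
  have low: "Inf B \<le> c" if "K2_bound F d t p1 p2 c" for c
    using that B by (auto simp: B_def intro: cInf_lower)
  have eq: "K2_const F d t p1 p2 = Inf B"
    unfolding K2_const_def by (rule Least_equality) (use inf low in auto)
  show "K2_bound F d t p1 p2 (K2_const F d t p1 p2)" using inf eq by simp
  show "K2_bound F d t p1 p2 c \<Longrightarrow> K2_const F d t p1 p2 \<le> c" using low eq by simp
qed

end

theory Submission
  imports Defs "HOL-Analysis.Analysis" "HOL-Decision_Procs.Algebra_Aux"
begin

text \<open>The Fourier transform of a sphere is a Salie sum for odd \<open>d\<close>, which is evaluated explicitly,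
  and a Kloosterman sum \<open>K\<close> for even \<open>d\<close>. At the critical vertex \<open>p\<^sub>1 = p\<^sub>2 = (d + 1) / d\<close> the bound
  comes from interpolating, level set by level set, between the supremum and the L2 operator norm
  of the kernel \<open>S\<^sub>t - 1 / q\<close>. For even \<open>d \<ge> 4\<close> Weil's bound for \<open>K\<close> is avoided: the frequencies
  are cut according to the size \<open>2 ^ j * sqrt q\<close> of \<open>K\<close>, and the fourth moment
  \<open>\<Sum> \<bar>K\<bar> ^ 4 \<lesssim> q ^ 3\<close> makes the \<open>j\<close>-th piece of the kernel so much smaller off the diagonal that the
  interpolated bounds are summable in \<open>j\<close>. For \<open>d = 2\<close> it suffices that two distinct circles of equal
  radius meet in at most two points. The rest of the region follows by Hoelder's inequality from the
  vertex and the trivial bound with exponents \<open>\<infinity>\<close> and \<open>1\<close>, and by monotonicity of the normalised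
  norms. Necessity is seen by testing with the indicators of a sphere and of its centre over prime
  fields in which 3 is a square.\<close>

section \<open>Additive characters of finite fields\<close>

hide_const (open) Elementary_Metric_Spaces.sphere Polynomial.order

text \<open>The numerology at the vertex is forced by scaling. In counting norms the target is
  q^((d-1)/(d+1)), which constant functions already attain, and a kernel with supremum B and L2
  operator norm \<Lambda> interpolates to B^((d-1)/(d+1)) * \<Lambda>^(2/(d+1)); so B of order 1 and
  \<Lambda> of order q^((d-1)/2) are exactly enough. For a piece of the multiplier the supremum of
  the kernel is obtained by Cauchy-Schwarz over the values ||\<xi>||, an argument that breaks down
  at z = 0. Hence the diagonal is cut out, harmlessly, since 0 does not lie on S_t. The j-th
  Kloosterman piece has B of order 2^-j and \<Lambda> of order 2^j * q^((d-1)/2), so its bound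
  varies like 2^(-j(d-3)/(d+1)): it decays for d \<ge> 4 and grows for d = 2, which is why the plane
  is treated by incidences. There the l2 estimate carries an additional l1 term, too large for
  thinly spread functions; both functions are therefore truncated at the height of a normalised
  constant. In the interpolation, the blocks below the threshold form geometric series because p <
  2, and above it the l^p masses are summed outright, so that no logarithm is lost.\<close>

lemma cis_cong_mod:
  fixes a b :: int and p :: nat
  assumes "0 < p" "int p dvd a - b"
  shows "cis (2 * pi * of_int a / of_nat p) = cis (2 * pi * of_int b / of_nat p)"
proof -
  obtain k where k: "a = b + int p * k" using assms by (metis add.commute diff_add_cancel dvdE)
  have "2 * pi * of_int a / of_nat p = 2 * pi * of_int b / of_nat p + 2 * pi * of_int k"
    using assms(1) by (simp add: k field_simps)
  then show ?thesis by (simp add: cis_mult[symmetric] cis_multiple_2pi)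
qed

text \<open>Invertibility of 2 is what completing the square requires; it also gives sense to the
  phases 1 / (4 u) below.\<close>

locale odd_finite_field = field F for F (structure) +
  assumes finite_carrier: "finite (carrier F)" and two_nonzero: "\<one> \<oplus> \<one> \<noteq> \<zero>"

locale field_character = odd_finite_field F for F (structure) +
  fixes \<psi> :: "'a \<Rightarrow> complex"
  assumes \<psi>_add: "\<lbrakk>a \<in> carrier F; b \<in> carrier F\<rbrakk> \<Longrightarrow> \<psi> (a \<oplus> b) = \<psi> a * \<psi> b"
    and norm_\<psi>: "a \<in> carrier F \<Longrightarrow> cmod (\<psi> a) = 1"
    and \<psi>_nontrivial: "\<exists>a\<in>carrier F. \<psi> a \<noteq> 1"

text \<open>A maximal additive subgroup H avoiding 1 takes the place of the kernel of a trace form.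
  By maximality every x is congruent modulo H to an integer multiple of 1, and that integer is
  unique modulo p. Sending x to the corresponding p-th root of unity is therefore a well-defined
  character, and it is nontrivial at 1.\<close>

lemma (in field) exists_nontrivial_character:
  assumes fin: "finite (carrier R)" and p: "prime p" "\<guillemotleft>int p\<guillemotright> = \<zero>"
  shows "\<exists>\<psi> :: 'a \<Rightarrow> complex.
    (\<forall>a\<in>carrier R. \<forall>b\<in>carrier R. \<psi> (a \<oplus> b) = \<psi> a * \<psi> b) \<and>
    (\<forall>a\<in>carrier R. cmod (\<psi> a) = 1) \<and> (\<exists>a\<in>carrier R. \<psi> a \<noteq> 1)"
proof -
  have p1: "p > 1" using p prime_gt_1_nat by blast
  define sub where "sub H \<longleftrightarrow> H \<subseteq> carrier R \<and> \<zero> \<in> H \<and> (\<forall>a\<in>H. \<forall>b\<in>H. a \<ominus> b \<in> H)" for H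
  have zero: "\<guillemotleft>n\<guillemotright> = \<zero>" if n: "int p dvd n" for n
  proof -
    obtain k where "n = int p * k" using n unfolding dvd_def by blast
    then have "\<guillemotleft>n\<guillemotright> = \<guillemotleft>int p\<guillemotright> \<otimes> \<guillemotleft>k\<guillemotright>" using of_int_mult by blast
    then show ?thesis unfolding p(2) by simp
  qed
  define \<H> where "\<H> = {H. sub H \<and> \<one> \<notin> H}"
  have "finite \<H>" by (rule finite_subset[of _ "Pow (carrier R)"]) (auto simp: \<H>_def sub_def fin)
  moreover have "{\<zero>} \<in> \<H>" by (auto simp: \<H>_def sub_def minus_eq)
  ultimately obtain H where H: "H \<in> \<H>" "\<And>K. K \<in> \<H> \<Longrightarrow> H \<subseteq> K \<Longrightarrow> H = K"
    using finite_has_maximal[of \<H>] by (metis empty_iff)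
  have Hc: "a \<in> carrier R" if "a \<in> H" for a using H(1) that by (auto simp: \<H>_def sub_def)
  have Hm: "a \<ominus> b \<in> H" if "a \<in> H" "b \<in> H" for a b
    using H(1) that by (auto simp: \<H>_def sub_def)
  have H0: "\<zero> \<in> H" and H1: "\<one> \<notin> H" using H(1) by (auto simp: \<H>_def sub_def)
  have Hneg: "\<ominus> a \<in> H" if "a \<in> H" for a using Hm[OF H0 that] Hc[OF that] by (simp add: minus_eq)
  have Hadd: "a \<oplus> b \<in> H" if "a \<in> H" "b \<in> H" for a b
    using Hm[OF that(1) Hneg[OF that(2)]] Hc[OF that(2)] by (simp add: minus_eq)
  have Hmul: "\<guillemotleft>n\<guillemotright> \<otimes> a \<in> H" if a: "a \<in> H" for n a
  proof (induction n rule: int_induct[of _ 0])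
    case (step1 i)
    have "\<guillemotleft>i + 1\<guillemotright> \<otimes> a = \<guillemotleft>i\<guillemotright> \<otimes> a \<oplus> a" using Hc[OF a] by (simp add: l_distr)
    then show ?case using Hadd step1(2) a by presburger
  next
    case (step2 i)
    have "\<guillemotleft>i - 1\<guillemotright> \<otimes> a = \<guillemotleft>i\<guillemotright> \<otimes> a \<ominus> a" using Hc[OF a] of_int_diff[of i 1] 
      by (simp add: l_distr minus_eq l_minus del: of_int_diff)
    then show ?case using Hm step2(2) a by presburger
  qed (use H0 Hc[OF a] in simp)
  have inv: "\<exists>n'. \<guillemotleft>n' * n\<guillemotright> = \<one>" if n: "\<not> int p dvd n" for n
  proof -
    have "coprime (int p) n" using p(1) n by (intro prime_imp_coprime) simp_all
    moreover obtain k n' where "k * int p + n' * n = gcd (int p) n"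
      using bezout_int by blast
    ultimately have n': "n' * n = 1 - k * int p" by simp
    have "\<guillemotleft>k * int p\<guillemotright> = \<zero>" by (intro zero) simp
    then have "\<guillemotleft>n' * n\<guillemotright> = \<one>" unfolding n' of_int_diff by (simp only:) (simp add: minus_eq)
    then show ?thesis by blast
  qed
  have dvd: "int p dvd n" if "\<guillemotleft>n\<guillemotright> \<in> H" for n
    
  proof (rule ccontr)
    assume "\<not> int p dvd n"
    then obtain n' where "\<guillemotleft>n' * n\<guillemotright> = \<one>" using inv by blast
    then show False using Hmul[OF that, of n'] H1 unfolding of_int_mult by simp
  qed
  have ex: "\<exists>k. x \<ominus> \<guillemotleft>k\<guillemotright> \<in> H" if x: "x \<in> carrier R" for x
  proof (cases "x \<in> H")
    case True
    then show ?thesis using x by (intro exI[of _ 0]) (simp add: minus_eq)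
  next
    case False
    \<comment> \<open>H' is generated by H and x. Being strictly larger than H, it contains 1 = h +
      n x; since 1 \<notin> H, n is invertible modulo p, and dividing by n shows that x is an
      integer modulo H.\<close>
    define H' where "H' = {h \<oplus> \<guillemotleft>n\<guillemotright> \<otimes> x | h n. h \<in> H}"
    have "sub H'"
      unfolding sub_def
    proof (intro conjI ballI)
      show "H' \<subseteq> carrier R" using x Hc by (auto simp: H'_def)
      show "\<zero> \<in> H'" unfolding H'_def using H0 x by (intro CollectI exI[of _ \<zero>] exI[of _ 0]) simp
      fix a b assume "a \<in> H'" "b \<in> H'"
      then obtain h n k m where *: "h \<in> H" "k \<in> H" "a = h \<oplus> \<guillemotleft>n\<guillemotright> \<otimes> x" "b = k \<oplus> \<guillemotleft>m\<guillemotright> \<otimes> x"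
        by (auto simp: H'_def)
      note c = Hc[OF *(1)] Hc[OF *(2)] x of_int_closed[of n] of_int_closed[of m]
      have "a \<ominus> b = (h \<ominus> k) \<oplus> \<guillemotleft>n - m\<guillemotright> \<otimes> x" 
        unfolding *(3,4) of_int_diff using c by algebra
      then show "a \<ominus> b \<in> H'" unfolding H'_def using Hm[OF *(1,2)] by blast
    qed
    moreover have "H \<subseteq> H'"
    proof
      fix h assume "h \<in> H"
      then show "h \<in> H'" unfolding H'_def using x Hc by (intro CollectI exI[of _ h] exI[of _ 0]) simp
    qed
    moreover have "x \<in> H'" unfolding H'_def
      using H0 x by (intro CollectI exI[of _ \<zero>] exI[of _ 1]) simp
    ultimately have "\<not> (sub H' \<and> \<one> \<notin> H')" using H(2)[of H'] False unfolding \<H>_def mem_Collect_eq by metis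
    with \<open>sub H'\<close> have "\<one> \<in> H'" by simp
    then obtain h n where h: "h \<in> H" "\<one> = h \<oplus> \<guillemotleft>n\<guillemotright> \<otimes> x" by (auto simp: H'_def)
    have "\<not> int p dvd n" using zero[of n] h H1 x Hc by auto
    then obtain n' where n': "\<guillemotleft>n'\<guillemotright> \<otimes> \<guillemotleft>n\<guillemotright> = \<one>" using inv[of n] of_int_mult by force
    have "\<guillemotleft>n'\<guillemotright> = \<guillemotleft>n'\<guillemotright> \<otimes> (h \<oplus> \<guillemotleft>n\<guillemotright> \<otimes> x)" unfolding h(2)[symmetric] by simp
    also have "\<dots> = \<guillemotleft>n'\<guillemotright> \<otimes> h \<oplus> (\<guillemotleft>n'\<guillemotright> \<otimes> \<guillemotleft>n\<guillemotright>) \<otimes> x" using x Hc[OF h(1)] by (simp add: r_distr m_assoc)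
    finally have "x \<ominus> \<guillemotleft>n'\<guillemotright> = x \<ominus> (\<guillemotleft>n'\<guillemotright> \<otimes> h \<oplus> x)" using n' x by simp
    also have "\<dots> = \<ominus> (\<guillemotleft>n'\<guillemotright> \<otimes> h)" using x Hc[OF h(1)] of_int_closed[of n'] by algebra
    finally show ?thesis using Hneg[OF Hmul[OF h(1), of n']] by (intro exI[of _ n']) simp
  qed
  define \<kappa> where "\<kappa> x = (SOME k. x \<ominus> \<guillemotleft>k\<guillemotright> \<in> H)" for x
  have \<kappa>: "x \<ominus> \<guillemotleft>\<kappa> x\<guillemotright> \<in> H" if "x \<in> carrier R" for x
    unfolding \<kappa>_def using ex[OF that] by (rule someI_ex)
  define \<psi> where "\<psi> x = cis (2 * pi * of_int (\<kappa> x) / of_nat p)" for x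
  have \<psi>: "\<psi> x = cis (2 * pi * of_int k / of_nat p)" if x: "x \<in> carrier R" "x \<ominus> \<guillemotleft>k\<guillemotright> \<in> H" for x k
  proof -
    have "(x \<ominus> \<guillemotleft>k\<guillemotright>) \<ominus> (x \<ominus> \<guillemotleft>\<kappa> x\<guillemotright>) \<in> H" using Hm \<kappa> x by blast
    moreover have "(x \<ominus> \<guillemotleft>k\<guillemotright>) \<ominus> (x \<ominus> \<guillemotleft>\<kappa> x\<guillemotright>) = \<guillemotleft>\<kappa> x - k\<guillemotright>"
      unfolding of_int_diff using x(1) of_int_closed[of k] of_int_closed[of "\<kappa> x"] by algebra
    ultimately have "int p dvd \<kappa> x - k" by (intro dvd) simp
    then show ?thesis unfolding \<psi>_def using p1 by (intro cis_cong_mod) auto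
  qed
  have "\<psi> (a \<oplus> b) = \<psi> a * \<psi> b" if ab: "a \<in> carrier R" "b \<in> carrier R" for a b
  proof -
    have "(a \<ominus> \<guillemotleft>\<kappa> a\<guillemotright>) \<oplus> (b \<ominus> \<guillemotleft>\<kappa> b\<guillemotright>) \<in> H" using Hadd \<kappa> ab by blast
    moreover have "(a \<ominus> \<guillemotleft>\<kappa> a\<guillemotright>) \<oplus> (b \<ominus> \<guillemotleft>\<kappa> b\<guillemotright>) = (a \<oplus> b) \<ominus> \<guillemotleft>\<kappa> a + \<kappa> b\<guillemotright>"
      unfolding of_int_add using ab of_int_closed[of "\<kappa> a"] of_int_closed[of "\<kappa> b"] by algebra
    ultimately have "\<psi> (a \<oplus> b) = cis (2 * pi * of_int (\<kappa> a + \<kappa> b) / of_nat p)"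
      using ab by (intro \<psi>) auto
    then show ?thesis by (simp add: \<psi>_def cis_mult add_divide_distrib distrib_left)
  qed
  moreover have "\<psi> \<one> \<noteq> 1"
  proof
    assume *: "\<psi> \<one> = 1"
    have "\<psi> \<one> = cis (2 * pi * of_int 1 / of_nat p)" using H0 by (intro \<psi>) (auto simp: minus_eq r_neg)
    then have "cis (2 * pi / p) = cis 0" using * by simp
    then have "cos (2 * pi / p) = 1" by (metis cis.simps(1) cos_zero)
    then obtain n :: int where "2 * pi / p = of_int n * 2 * pi" by (auto simp: cos_one_2pi_int)
    then have "1 = real p * of_int n" using p1 by (simp add: field_simps)
    then have "1 = int p * n" by (metis Int.of_int_1 of_int_eq_iff Int.of_int_mult of_int_of_nat_eq)
    then show False using p1 by (simp add: zmult_eq_1_iff eq_commute[of 1])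
  qed
  ultimately show ?thesis by (intro exI[of _ \<psi>]) (auto simp: \<psi>_def)
qed

section \<open>Gauss sums\<close>

context odd_finite_field
begin

abbreviation q :: real where "q \<equiv> real (order F)"

lemma order_gt_1: "order F > 1"
proof -
  have "card {\<zero>, \<one>} \<le> card (carrier F)" using finite_carrier by (intro card_mono) auto
  then show ?thesis by (simp add: Coset.order_def)
qed

lemma of_int_4_nonzero: "\<guillemotleft>4\<guillemotright> \<noteq> \<zero>" and of_int_2_nonzero: "\<guillemotleft>2\<guillemotright> \<noteq> \<zero>"
proof -
  show 2: "\<guillemotleft>2\<guillemotright> \<noteq> \<zero>" using two_nonzero by (simp add: of_int_2)
  have "\<guillemotleft>4\<guillemotright> = \<guillemotleft>2\<guillemotright> \<otimes> \<guillemotleft>2\<guillemotright>" using of_int_mult[of 2 2] by simp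
  then show "\<guillemotleft>4\<guillemotright> \<noteq> \<zero>" using 2 by (simp add: integral_iff)
qed

lemma order_ge_3: "order F \<ge> 3"
proof -
  have "\<one> \<oplus> \<one> \<noteq> \<one>"
    using add.r_cancel_one[of \<one> \<one>] one_not_zero by simp
  then have "card {\<zero>, \<one>, \<one> \<oplus> \<one>} = 3" using two_nonzero by (simp add: eq_commute)
  moreover have "card {\<zero>, \<one>, \<one> \<oplus> \<one>} \<le> card (carrier F)"
    using finite_carrier by (intro card_mono) auto
  ultimately show ?thesis by (simp add: Coset.order_def)
qed

lemma sum_shift:
  assumes "c \<in> carrier F"
  shows "(\<Sum>x\<in>carrier F. f (x \<oplus> c)) = (\<Sum>x\<in>carrier F. f x)"
  by (rule sum.reindex_bij_witness[of _ "\<lambda>x. x \<ominus> c" "\<lambda>x. x \<oplus> c"])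
     (use assms in \<open>auto simp: minus_eq a_assoc r_neg l_neg\<close>)

lemma sum_scale:
  assumes r: "r \<in> carrier F" "r \<noteq> \<zero>"
  shows "(\<Sum>x\<in>carrier F - {\<zero>}. f (r \<otimes> x)) = (\<Sum>x\<in>carrier F - {\<zero>}. f x)"
    "(\<Sum>x\<in>carrier F. f (r \<otimes> x)) = (\<Sum>x\<in>carrier F. f x)"
proof -
  have [simp]: "inv r \<noteq> \<zero>" using r by (metis field.r_inv field_axioms r_null one_not_zero)
  have "inv r \<otimes> (r \<otimes> x) = x" "r \<otimes> (inv r \<otimes> x) = x" if "x \<in> carrier F" for x
    using r that by (simp_all add: m_assoc[symmetric])
  note * = this
  show "(\<Sum>x\<in>carrier F - {\<zero>}. f (r \<otimes> x)) = (\<Sum>x\<in>carrier F - {\<zero>}. f x)"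
    by (rule sum.reindex_bij_witness[of _ "\<lambda>x. inv r \<otimes> x" "\<lambda>x. r \<otimes> x"])
       (use r * in \<open>auto simp: integral_iff\<close>)
  show "(\<Sum>x\<in>carrier F. f (r \<otimes> x)) = (\<Sum>x\<in>carrier F. f x)"
    by (rule sum.reindex_bij_witness[of _ "\<lambda>x. inv r \<otimes> x" "\<lambda>x. r \<otimes> x"])
       (use r * in auto)
qed

lemma sum_inverse:
  "(\<Sum>x\<in>carrier F - {\<zero>}. f (inv x)) = (\<Sum>x\<in>carrier F - {\<zero>}. f x)"
proof -
  have nz: "inv r \<noteq> \<zero>" if "r \<in> carrier F" "r \<noteq> \<zero>" for r
    using that by (metis field.r_inv field_axioms r_null one_not_zero)
  have "inv (inv x) = x" if "x \<in> carrier F" "x \<noteq> \<zero>" for x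
    using that by (intro Units_inv_inv) (simp add: field_Units)
  then show ?thesis
    by (intro sum.reindex_bij_witness[of _ "\<lambda>x. inv x" "\<lambda>x. inv x"]) (auto simp: nz)
qed

lemma sum_remove_zero:
  "(\<Sum>x\<in>carrier F. f x) = f \<zero> + (\<Sum>x\<in>carrier F - {\<zero>}. f x)"
  using finite_carrier by (simp add: sum.remove[of _ \<zero>])

end

context field_character
begin

lemma \<psi>_zero [simp]: "\<psi> \<zero> = 1"
  using \<psi>_add[of \<zero> \<zero>] norm_\<psi>[of \<zero>] by auto

lemma \<psi>_minus: assumes "a \<in> carrier F" shows "\<psi> (\<ominus> a) = cnj (\<psi> a)"
proof -
  have "\<psi> (\<ominus> a) * \<psi> a = 1" using \<psi>_add[of "\<ominus> a" a] assms by (simp add: l_neg)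
  moreover have "cnj (\<psi> a) * \<psi> a = 1"
    using norm_\<psi>[OF assms] complex_norm_square[of "\<psi> a"] by (simp add: mult.commute)
  moreover have "\<psi> a \<noteq> 0" using norm_\<psi>[OF assms] by auto
  ultimately show ?thesis by (metis mult_right_cancel)
qed

lemma \<psi>_diff: "\<lbrakk>a \<in> carrier F; b \<in> carrier F\<rbrakk> \<Longrightarrow> \<psi> (a \<ominus> b) = \<psi> a * cnj (\<psi> b)"
  by (simp add: minus_eq \<psi>_add \<psi>_minus)

lemma sum_\<psi>:
  assumes b: "b \<in> carrier F"
  shows "(\<Sum>a\<in>carrier F. \<psi> (a \<otimes> b)) = (if b = \<zero> then of_nat (order F) else 0)"
proof (cases "b = \<zero>")
  case True
  have "(\<Sum>a\<in>carrier F. \<psi> (a \<otimes> \<zero>)) = (\<Sum>a\<in>carrier F. 1)" by (intro sum.cong) auto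
  then show ?thesis using True by (simp add: Coset.order_def)
next
  case False
  obtain c where c: "c \<in> carrier F" "\<psi> c \<noteq> 1" using \<psi>_nontrivial by blast
  let ?S = "\<Sum>a\<in>carrier F. \<psi> a"
  have "?S = (\<Sum>a\<in>carrier F. \<psi> (a \<oplus> c))" using sum_shift[OF c(1), of \<psi>] by simp
  also have "\<dots> = (\<Sum>a\<in>carrier F. \<psi> a) * \<psi> c"
    unfolding sum_distrib_right by (intro sum.cong) (use c \<psi>_add in auto)
  finally have "?S * (\<psi> c - 1) = 0" by (simp add: algebra_simps)
  then have "?S = 0" using c by simp
  moreover have "(\<Sum>a\<in>carrier F. \<psi> (a \<otimes> b)) = (\<Sum>a\<in>carrier F. \<psi> (b \<otimes> a))"
    by (intro sum.cong) (use b in \<open>auto simp: m_comm\<close>)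
  ultimately show ?thesis using sum_scale(2)[OF b False, of \<psi>] False by simp
qed

definition gauss :: "'a \<Rightarrow> complex" where
  "gauss u = (\<Sum>x\<in>carrier F. \<psi> (u \<otimes> (x \<otimes> x)))"

text \<open>Completing the square with h = w / (2 u): the shift by h is absorbed by the sum, and the
  leftover constant is -u h^2 = -w^2 / (4 u).\<close>

lemma gauss_complete:
  assumes u: "u \<in> carrier F" "u \<noteq> \<zero>" and w: "w \<in> carrier F"
  shows "(\<Sum>x\<in>carrier F. \<psi> (u \<otimes> (x \<otimes> x) \<oplus> x \<otimes> w)) = gauss u * cnj (\<psi> (w \<otimes> w \<otimes> inv (\<guillemotleft>4\<guillemotright> \<otimes> u)))"
proof -
  define h where "h = w \<otimes> inv (\<guillemotleft>2\<guillemotright> \<otimes> u)"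
  have nz: "\<guillemotleft>2\<guillemotright> \<otimes> u \<noteq> \<zero>" "\<guillemotleft>4\<guillemotright> \<otimes> u \<noteq> \<zero>"
    using u of_int_2_nonzero of_int_4_nonzero by (simp_all add: integral_iff)
  have h: "h \<in> carrier F" using w u nz by (simp add: h_def)
  have w_eq: "w = \<guillemotleft>2\<guillemotright> \<otimes> u \<otimes> h" 
  proof -
    have "\<guillemotleft>2\<guillemotright> \<otimes> u \<otimes> h = w \<otimes> ((\<guillemotleft>2\<guillemotright> \<otimes> u) \<otimes> inv (\<guillemotleft>2\<guillemotright> \<otimes> u))" 
      unfolding h_def using w u nz by (simp add: m_ac)
    then show ?thesis using w u nz by simp
  qed
  have four: "\<guillemotleft>4\<guillemotright> = \<guillemotleft>2\<guillemotright> \<otimes> \<guillemotleft>2\<guillemotright>" using of_int_mult[of 2 2] by simp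
  have w2: "w = u \<otimes> h \<oplus> u \<otimes> h" unfolding w_eq using u h by (simp add: mult2 m_assoc)
  have "w \<otimes> w \<otimes> inv (\<guillemotleft>4\<guillemotright> \<otimes> u) = u \<otimes> (h \<otimes> h) \<otimes> (\<guillemotleft>4\<guillemotright> \<otimes> u) \<otimes> inv (\<guillemotleft>4\<guillemotright> \<otimes> u)"
  proof -
    have "w \<otimes> w = u \<otimes> (h \<otimes> h) \<otimes> (\<guillemotleft>4\<guillemotright> \<otimes> u)"
      unfolding w_eq four using h u of_int_closed[of 2] by (simp add: m_ac)
    then show ?thesis by simp
  qed
  then have eq: "w \<otimes> w \<otimes> inv (\<guillemotleft>4\<guillemotright> \<otimes> u) = u \<otimes> (h \<otimes> h)"
    using h u nz by (simp add: m_assoc)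
  have "(\<Sum>x\<in>carrier F. \<psi> (u \<otimes> (x \<otimes> x) \<oplus> x \<otimes> w)) =
    (\<Sum>x\<in>carrier F. \<psi> (u \<otimes> ((x \<oplus> h) \<otimes> (x \<oplus> h))) * cnj (\<psi> (u \<otimes> (h \<otimes> h))))"
  proof (intro sum.cong refl)
    fix x assume x: "x \<in> carrier F"
    have "u \<otimes> (x \<otimes> x) \<oplus> x \<otimes> w = u \<otimes> ((x \<oplus> h) \<otimes> (x \<oplus> h)) \<ominus> u \<otimes> (h \<otimes> h)"
      unfolding w2 using x h u(1) by algebra
    then show "\<psi> (u \<otimes> (x \<otimes> x) \<oplus> x \<otimes> w) = \<psi> (u \<otimes> ((x \<oplus> h) \<otimes> (x \<oplus> h))) * cnj (\<psi> (u \<otimes> (h \<otimes> h)))"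
      using x h u by (simp add: \<psi>_diff)
  qed
  also have "\<dots> = gauss u * cnj (\<psi> (u \<otimes> (h \<otimes> h)))"
    unfolding gauss_def sum_distrib_right[symmetric]
    using sum_shift[OF h, of "\<lambda>x. \<psi> (u \<otimes> (x \<otimes> x))"] by simp
  finally show ?thesis unfolding eq .
qed

text \<open>Replacing x by x + y in the double sum cancels the square of y. The sum over y is then a
  linear character sum, and only x = 0 survives.\<close>

lemma norm_gauss:
  assumes u: "u \<in> carrier F" "u \<noteq> \<zero>"
  shows "(cmod (gauss u))\<^sup>2 = q"
proof -
  have "gauss u * cnj (gauss u) = (\<Sum>y\<in>carrier F. \<Sum>x\<in>carrier F. \<psi> (u \<otimes> (x \<otimes> x)) * cnj (\<psi> (u \<otimes> (y \<otimes> y))))"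
    unfolding gauss_def cnj_sum sum_product by (rule sum.swap)
  also have "\<dots> = (\<Sum>y\<in>carrier F. \<Sum>x\<in>carrier F. \<psi> (u \<otimes> ((x \<oplus> y) \<otimes> (x \<oplus> y))) * cnj (\<psi> (u \<otimes> (y \<otimes> y))))"
    by (intro sum.cong refl sum_shift[symmetric])
  also have "\<dots> = (\<Sum>y\<in>carrier F. \<Sum>x\<in>carrier F. \<psi> (u \<otimes> (x \<otimes> x)) * \<psi> (y \<otimes> (\<guillemotleft>2\<guillemotright> \<otimes> u \<otimes> x)))"
  proof (intro sum.cong refl)
    fix x y assume x: "x \<in> carrier F" and y: "y \<in> carrier F"
    have "\<guillemotleft>2\<guillemotright> \<otimes> u \<otimes> x = u \<otimes> x \<oplus> u \<otimes> x" using u x by (simp add: mult2 m_assoc)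
    moreover have "u \<otimes> (x \<otimes> x) \<oplus> y \<otimes> (u \<otimes> x \<oplus> u \<otimes> x) = u \<otimes> ((x \<oplus> y) \<otimes> (x \<oplus> y)) \<ominus> u \<otimes> (y \<otimes> y)"
      using x y u(1) by algebra
    ultimately have "u \<otimes> (x \<otimes> x) \<oplus> y \<otimes> (\<guillemotleft>2\<guillemotright> \<otimes> u \<otimes> x) = u \<otimes> ((x \<oplus> y) \<otimes> (x \<oplus> y)) \<ominus> u \<otimes> (y \<otimes> y)" by simp
    then have "\<psi> (u \<otimes> (x \<otimes> x) \<oplus> y \<otimes> (\<guillemotleft>2\<guillemotright> \<otimes> u \<otimes> x)) = \<psi> (u \<otimes> ((x \<oplus> y) \<otimes> (x \<oplus> y)) \<ominus> u \<otimes> (y \<otimes> y))" by simp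
    then show "\<psi> (u \<otimes> ((x \<oplus> y) \<otimes> (x \<oplus> y))) * cnj (\<psi> (u \<otimes> (y \<otimes> y))) = \<psi> (u \<otimes> (x \<otimes> x)) * \<psi> (y \<otimes> (\<guillemotleft>2\<guillemotright> \<otimes> u \<otimes> x))"
      using x y u by (simp add: \<psi>_diff \<psi>_add)
  qed
  also have "\<dots> = (\<Sum>x\<in>carrier F. \<psi> (u \<otimes> (x \<otimes> x)) * (\<Sum>y\<in>carrier F. \<psi> (y \<otimes> (\<guillemotleft>2\<guillemotright> \<otimes> u \<otimes> x))))"
    unfolding sum_distrib_left by (rule sum.swap)
  also have "\<dots> = (\<Sum>x\<in>carrier F. if x = \<zero> then of_nat (order F) else 0)"
  proof (intro sum.cong refl)
    fix x assume x: "x \<in> carrier F"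
    have "\<guillemotleft>2\<guillemotright> \<otimes> u \<otimes> x = \<zero> \<longleftrightarrow> x = \<zero>" using u x of_int_2_nonzero by (simp add: integral_iff)
    then show "\<psi> (u \<otimes> (x \<otimes> x)) * (\<Sum>y\<in>carrier F. \<psi> (y \<otimes> (\<guillemotleft>2\<guillemotright> \<otimes> u \<otimes> x))) = (if x = \<zero> then of_nat (order F) else 0)"
      using u x sum_\<psi>[of "\<guillemotleft>2\<guillemotright> \<otimes> u \<otimes> x"] by simp
  qed
  also have "\<dots> = of_nat (order F)" using finite_carrier by simp
  finally have "of_real ((cmod (gauss u))\<^sup>2) = (of_real q :: complex)"
    by (simp only: complex_norm_square) simp
  then show ?thesis by (simp only: of_real_eq_iff)
qed

text \<open>Squaring hits every nonzero square exactly twice, so the nonzero squares make up half of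
  the nonzero elements, and multiplication by the nonsquare r carries them onto the other half.
  Hence x^2 and r x^2 together run through every element twice, zero included.\<close>

lemma sum_squares:
  fixes h :: "'a \<Rightarrow> complex"
  assumes r: "r \<in> carrier F" "r \<noteq> \<zero>" and nsq: "\<And>s. s \<in> carrier F \<Longrightarrow> r \<noteq> s \<otimes> s"
  shows "(\<Sum>x\<in>carrier F. h (x \<otimes> x)) + (\<Sum>x\<in>carrier F. h (r \<otimes> (x \<otimes> x))) = 2 * (\<Sum>y\<in>carrier F. h y)"
proof -
  define U where "U = carrier F - {\<zero>}"
  define Q where "Q = (\<lambda>x. x \<otimes> x) ` U"
  have fin: "finite U" "finite Q" using finite_carrier by (simp_all add: U_def Q_def)
  have QU: "Q \<subseteq> U" by (auto simp: Q_def U_def integral_iff)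
  have fib: "card {x \<in> U. x \<otimes> x = y} = 2" if "y \<in> Q" for y
  proof -
    obtain x where x: "x \<in> carrier F" "x \<noteq> \<zero>" "y = x \<otimes> x" using \<open>y \<in> Q\<close> by (auto simp: Q_def U_def)
    have "\<ominus> x \<noteq> \<zero>" using x using minus_minus[of x] minus_zero by force
    then have "{z \<in> U. z \<otimes> z = y} = {x, \<ominus> x}"
      using x by (auto simp: U_def square_eq_iff l_minus r_minus)
    moreover have "x \<noteq> \<ominus> x"
    proof
      assume "x = \<ominus> x"
      then have "\<guillemotleft>2\<guillemotright> \<otimes> x = \<zero>" using x mult2[of x] r_neg[of x] by simp
      then show False using x of_int_2_nonzero by (simp add: integral_iff)
    qed
    ultimately show ?thesis by simp
  qed
  have sq: "(\<Sum>x\<in>U. f (x \<otimes> x)) = 2 * (\<Sum>y\<in>Q. f y)" for f :: "'a \<Rightarrow> complex"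
  proof -
    have "(\<Sum>x\<in>U. f (x \<otimes> x)) = (\<Sum>y\<in>Q. \<Sum>x\<in>{x\<in>U. x \<otimes> x = y}. f (x \<otimes> x))"
      unfolding Q_def using fin by (intro sum.image_gen) auto
    also have "\<dots> = (\<Sum>y\<in>Q. 2 * f y)" by (intro sum.cong) (auto simp: fib)
    finally show ?thesis by (simp add: sum_distrib_left)
  qed
  have inj: "inj_on (\<lambda>y. r \<otimes> y) Q"
  proof (rule inj_onI)
    fix x y assume "x \<in> Q" "y \<in> Q" "r \<otimes> x = r \<otimes> y"
    then show "x = y" using r QU m_lcancel[of r x y] by (auto simp: U_def)
  qed
  have "Q \<inter> (\<lambda>y. r \<otimes> y) ` Q = {}"
  proof (rule ccontr)
    assume "Q \<inter> (\<lambda>y. r \<otimes> y) ` Q \<noteq> {}"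
    then obtain x y where xy: "x \<in> U" "y \<in> U" "x \<otimes> x = r \<otimes> (y \<otimes> y)" by (auto simp: Q_def)
    define i where "i = inv y"
    define s where "s = x \<otimes> i"
    have c: "x \<in> carrier F" "y \<in> carrier F" "i \<in> carrier F" "y \<otimes> i = \<one>"
      using xy by (auto simp: U_def i_def)
    have "s \<otimes> s = (x \<otimes> x) \<otimes> (i \<otimes> i)" unfolding s_def using c(1,3) by (simp add: m_ac)
    also have "\<dots> = r \<otimes> ((y \<otimes> i) \<otimes> (y \<otimes> i))" unfolding xy(3) using r c(2,3) by (simp add: m_ac)
    finally show False using nsq[of s] c r by (simp add: s_def)
  qed
  moreover have "card U = 2 * card Q"
    using sq[of "\<lambda>_. 1"] 
  proof -
    have "of_nat (card U) = (of_nat (2 * card Q) :: complex)" using sq[of "\<lambda>_. 1"] by simp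
    then show ?thesis by (simp only: of_nat_eq_iff)
  qed
  ultimately have "Q \<union> (\<lambda>y. r \<otimes> y) ` Q = U"
    using fin QU r by (intro card_subset_eq) (auto simp: U_def card_Un_disjoint card_image[OF inj] integral_iff)
  then have "(\<Sum>y\<in>U. h y) = (\<Sum>y\<in>Q. h y) + (\<Sum>y\<in>(\<lambda>y. r \<otimes> y) ` Q. h y)"
    using fin \<open>Q \<inter> (\<lambda>y. r \<otimes> y) ` Q = {}\<close> by (metis finite_imageI sum.union_disjoint)
  also have "\<dots> = (\<Sum>y\<in>Q. h y) + (\<Sum>y\<in>Q. h (r \<otimes> y))" by (simp add: sum.reindex[OF inj])
  finally have "2 * (\<Sum>y\<in>U. h y) = (\<Sum>x\<in>U. h (x \<otimes> x)) + (\<Sum>x\<in>U. h (r \<otimes> (x \<otimes> x)))"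
    using sq[of h] sq[of "\<lambda>y. h (r \<otimes> y)"] by (simp add: algebra_simps)
  then show ?thesis using r by (simp add: sum_remove_zero U_def)
qed

text \<open>The sign is the quadratic character of r, obtained without introducing that character.
  The order of quantifiers matters: one sign serves all u, so it can be pulled out of sums over
  u.\<close>

lemma gauss_scale:
  assumes r: "r \<in> carrier F" "r \<noteq> \<zero>"
  shows "\<exists>\<epsilon>\<in>{1, -1}. \<forall>u\<in>carrier F - {\<zero>}. gauss (r \<otimes> u) = \<epsilon> * gauss u"
proof (cases "\<exists>s\<in>carrier F. r = s \<otimes> s")
  case True
  then obtain s where s: "s \<in> carrier F" "r = s \<otimes> s" by blast
  have "s \<noteq> \<zero>" using s r by auto
  have "gauss (r \<otimes> u) = gauss u" if u: "u \<in> carrier F" for u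
  proof -
    have "gauss (r \<otimes> u) = (\<Sum>x\<in>carrier F. \<psi> (u \<otimes> ((s \<otimes> x) \<otimes> (s \<otimes> x))))"
      unfolding gauss_def s by (intro sum.cong refl arg_cong[where f = \<psi>]) (use s u in \<open>auto simp: m_ac\<close>)
    also have "\<dots> = gauss u" unfolding gauss_def
      by (rule sum_scale(2)[OF s(1) \<open>s \<noteq> \<zero>\<close>, of "\<lambda>x. \<psi> (u \<otimes> (x \<otimes> x))"])
    finally show ?thesis .
  qed
  then show ?thesis by auto
next
  case False
  have "gauss (r \<otimes> u) = - gauss u" if u: "u \<in> carrier F" "u \<noteq> \<zero>" for u
  proof -
    have "gauss u + gauss (r \<otimes> u) = (\<Sum>x\<in>carrier F. \<psi> (u \<otimes> (x \<otimes> x))) + (\<Sum>x\<in>carrier F. \<psi> (u \<otimes> (r \<otimes> (x \<otimes> x))))"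
      unfolding gauss_def
      by (intro arg_cong2[where f = "(+)"] refl sum.cong arg_cong[where f = \<psi>]) (use r u in \<open>auto simp: m_ac\<close>)
    also have "\<dots> = 2 * (\<Sum>y\<in>carrier F. \<psi> (u \<otimes> y))"
      by (rule sum_squares[OF r]) (use False in auto)
    also have "(\<Sum>y\<in>carrier F. \<psi> (u \<otimes> y)) = (\<Sum>y\<in>carrier F. \<psi> (y \<otimes> u))"
      by (intro sum.cong) (use u in \<open>auto simp: m_comm\<close>)
    finally show ?thesis using sum_\<psi>[of u] u by (simp add: add_eq_0_iff)
  qed
  then show ?thesis by auto
qed

text \<open>Even powers of Gauss sums do not depend on u, while an odd power retains one Gauss sum.
  This parity separates Kloosterman sums from Salie sums.\<close>

lemma gauss_square:
  assumes u: "u \<in> carrier F" "u \<noteq> \<zero>"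
  shows "(gauss u)\<^sup>2 = (gauss \<one>)\<^sup>2"
  proof -
  obtain \<epsilon> where "\<epsilon> \<in> {1, -1}" "gauss (u \<otimes> \<one>) = \<epsilon> * gauss \<one>"
    using gauss_scale[OF u] by (meson DiffI one_closed one_not_zero singletonD)
  then show ?thesis using u by auto
qed

end

section \<open>Fourier expansion of spheres\<close>

text \<open>Stated for an arbitrary family with orthogonal rows because it is applied twice: to the
  characters of the vector space, and to the characters of the field when the coefficients
  \<open>R\<close> of a multiplier kernel are estimated.\<close>

lemma parseval:
  fixes e :: "'x \<Rightarrow> 'y \<Rightarrow> complex" and a :: "'x \<Rightarrow> complex"
  assumes fin: "finite X"
    and orth: "\<And>x x'. x \<in> X \<Longrightarrow> x' \<in> X \<Longrightarrow> (\<Sum>y\<in>Y. e x y * cnj (e x' y)) = (if x = x' then of_real N else 0)"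
  shows "(\<Sum>y\<in>Y. (cmod (\<Sum>x\<in>X. a x * e x y))\<^sup>2) = N * (\<Sum>x\<in>X. (cmod (a x))\<^sup>2)"
proof -
  have "of_real (\<Sum>y\<in>Y. (cmod (\<Sum>x\<in>X. a x * e x y))\<^sup>2) =
    (\<Sum>y\<in>Y. \<Sum>x\<in>X. \<Sum>x'\<in>X. (a x * e x y) * cnj (a x' * e x' y))"
    unfolding of_real_sum complex_norm_square cnj_sum sum_product ..
  also have "\<dots> = (\<Sum>x\<in>X. \<Sum>x'\<in>X. \<Sum>y\<in>Y. (a x * e x y) * cnj (a x' * e x' y))"
    by (subst sum.swap, intro sum.cong refl, rule sum.swap)
  also have "\<dots> = (\<Sum>x\<in>X. \<Sum>x'\<in>X. a x * cnj (a x') * (\<Sum>y\<in>Y. e x y * cnj (e x' y)))"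
    by (simp add: sum_distrib_left mult_ac)
  also have "\<dots> = (\<Sum>x\<in>X. \<Sum>x'\<in>X. if x' = x then a x * cnj (a x') * of_real N else 0)"
    by (intro sum.cong refl) (simp add: orth)
  also have "\<dots> = (\<Sum>x\<in>X. a x * cnj (a x) * of_real N)"
    using fin by (intro sum.cong refl) (simp add: sum.delta)
  also have "\<dots> = of_real (N * (\<Sum>x\<in>X. (cmod (a x))\<^sup>2))"
    unfolding of_real_mult of_real_sum complex_norm_square by (simp add: sum_distrib_left mult_ac)
  finally show ?thesis by (simp only: of_real_eq_iff)
qed

lemma cmod_sum_mult_le:
  fixes a b :: "'x \<Rightarrow> complex"
  shows "cmod (\<Sum>x\<in>X. a x * b x) \<le> sqrt (\<Sum>x\<in>X. (cmod (a x))\<^sup>2) * sqrt (\<Sum>x\<in>X. (cmod (b x))\<^sup>2)"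
proof -
  have "cmod (\<Sum>x\<in>X. a x * b x) \<le> (\<Sum>x\<in>X. \<bar>cmod (a x)\<bar> * \<bar>cmod (b x)\<bar>)"
    by (rule order_trans[OF norm_sum]) (simp add: norm_mult)
  also have "\<dots> \<le> L2_set (\<lambda>x. cmod (a x)) X * L2_set (\<lambda>x. cmod (b x)) X"
    by (rule L2_set_mult_ineq)
  finally show ?thesis by (simp add: L2_set_def)
qed

context odd_finite_field
begin

definition vzero :: "nat \<Rightarrow> nat \<Rightarrow> 'a" where "vzero d = (\<lambda>i\<in>{..<d}. \<zero>)"

lemma vecs_mem: "x \<in> vecs F d \<Longrightarrow> i < d \<Longrightarrow> x i \<in> carrier F"
  by (auto simp: vecs_def)

lemma vzero_in_vecs: "vzero d \<in> vecs F d"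
  by (simp add: vzero_def vecs_def)

lemma vminus_in_vecs: "x \<in> vecs F d \<Longrightarrow> y \<in> vecs F d \<Longrightarrow> vminus F d x y \<in> vecs F d"
  by (auto simp: vminus_def vecs_def)

lemma vminus_eq_vzero_iff:
  assumes "x \<in> vecs F d" "y \<in> vecs F d"
  shows "vminus F d x y = vzero d \<longleftrightarrow> x = y"
proof
  assume eq: "vminus F d x y = vzero d"
  show "x = y"
  proof (rule PiE_ext[OF assms[unfolded vecs_def]])
    fix i assume "i \<in> {..<d}"
    then show "x i = y i"
      using fun_cong[OF eq, of i] assms[THEN vecs_mem, of i] by (simp add: vminus_def vzero_def eq_diff0)
  qed
next
  assume "x = y"
  then show "vminus F d x y = vzero d"
    using vecs_mem[OF assms(1)] by (auto simp: vminus_def vzero_def restrict_def minus_eq r_neg)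
qed

lemma sqnorm_closed [simp]: "x \<in> vecs F d \<Longrightarrow> sqnorm F d x \<in> carrier F"
  unfolding sqnorm_def by (intro finsum_closed) (auto simp: vecs_mem)

lemma finite_vectors [simp]: "finite (vecs F d)"
  by (rule finite_vecs[OF finite_carrier])

lemma sum_prod_vecs:
  fixes f :: "nat \<Rightarrow> 'a \<Rightarrow> complex"
  shows "(\<Sum>\<xi>\<in>vecs F d. \<Prod>i<d. f i (\<xi> i)) = (\<Prod>i<d. \<Sum>a\<in>carrier F. f i a)"
  unfolding vecs_def using finite_carrier by (subst prod_sum_PiE) auto

end

context field_character
begin

lemma \<psi>_mult_finsum:
  assumes "u \<in> carrier F" "finite A" "f \<in> A \<rightarrow> carrier F"
  shows "\<psi> (u \<otimes> (\<Oplus>i\<in>A. f i)) = (\<Prod>i\<in>A. \<psi> (u \<otimes> f i))"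
  using assms(2,3,1)
proof (induction A rule: finite_induct)
  case (insert i A)
  then have "f i \<in> carrier F" "f \<in> A \<rightarrow> carrier F" by auto
  with insert show ?case by (simp add: finsum_insert r_distr \<psi>_add)
qed simp

lemma \<psi>_sqnorm:
  assumes "u \<in> carrier F" "x \<in> vecs F d"
  shows "\<psi> (u \<otimes> sqnorm F d x) = (\<Prod>i<d. \<psi> (u \<otimes> (x i \<otimes> x i)))"
  unfolding sqnorm_def using assms
  by (subst \<psi>_mult_finsum) (auto simp: numeral_2_eq_2 vecs_mem)

definition Psi :: "nat \<Rightarrow> (nat \<Rightarrow> 'a) \<Rightarrow> (nat \<Rightarrow> 'a) \<Rightarrow> complex" where
  "Psi d \<xi> z = (\<Prod>i<d. \<psi> (\<xi> i \<otimes> z i))"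

lemma Psi_vminus:
  assumes "\<xi> \<in> vecs F d" "x \<in> vecs F d" "y \<in> vecs F d"
  shows "Psi d \<xi> (vminus F d x y) = Psi d \<xi> x * cnj (Psi d \<xi> y)"
proof -
  have "\<psi> (\<xi> i \<otimes> (x i \<ominus> y i)) = \<psi> (\<xi> i \<otimes> x i) * cnj (\<psi> (\<xi> i \<otimes> y i))" if "i < d" for i
    using that assms[THEN vecs_mem, of i] by (simp add: \<psi>_diff[symmetric] minus_eq r_distr r_minus)
  then show ?thesis by (simp add: Psi_def vminus_def prod.distrib)
qed

lemma sum_Psi:
  assumes z: "z \<in> vecs F d"
  shows "(\<Sum>\<xi>\<in>vecs F d. Psi d \<xi> z) = (if z = vzero d then of_real (q ^ d) else 0)"
proof -
  have "(\<Sum>\<xi>\<in>vecs F d. Psi d \<xi> z) = (\<Prod>i<d. \<Sum>a\<in>carrier F. \<psi> (a \<otimes> z i))"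
    unfolding Psi_def by (rule sum_prod_vecs)
  also have "\<dots> = (\<Prod>i<d. if z i = \<zero> then of_nat (order F) else 0)"
    by (intro prod.cong refl sum_\<psi>) (use z vecs_mem in auto)
  also have "\<dots> = (if \<forall>i<d. z i = \<zero> then of_real (q ^ d) else 0)"
  proof (cases "\<forall>i<d. z i = \<zero>")
    case False
    then show ?thesis by auto
  qed simp
  also have "(\<forall>i<d. z i = \<zero>) \<longleftrightarrow> z = vzero d"
  proof
    assume "\<forall>i<d. z i = \<zero>"
    then show "z = vzero d"
      by (intro PiE_ext[OF z[unfolded vecs_def] vzero_in_vecs[unfolded vecs_def]]) (simp add: vzero_def)
  qed (simp add: vzero_def)
  finally show ?thesis .
qed

lemma Psi_orthogonal:
  assumes "x \<in> vecs F d" "y \<in> vecs F d"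
  shows "(\<Sum>\<xi>\<in>vecs F d. Psi d \<xi> x * cnj (Psi d \<xi> y)) = (if x = y then of_real (q ^ d) else 0)"
proof -
  have "(\<Sum>\<xi>\<in>vecs F d. Psi d \<xi> x * cnj (Psi d \<xi> y)) = (\<Sum>\<xi>\<in>vecs F d. Psi d \<xi> (vminus F d x y))"
    using assms by (intro sum.cong) (auto simp: Psi_vminus)
  then show ?thesis
    using sum_Psi[OF vminus_in_vecs[OF assms]] vminus_eq_vzero_iff[OF assms] by simp
qed

text \<open>The Fourier transform of a quadratic phase. It factors over the coordinates, and each
  factor is a completed Gauss sum.\<close>

lemma gauss_vec:
  assumes u: "u \<in> carrier F" "u \<noteq> \<zero>" and z: "z \<in> vecs F d"
  shows "(\<Sum>\<xi>\<in>vecs F d. \<psi> (u \<otimes> sqnorm F d \<xi>) * Psi d \<xi> z) =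
    gauss u ^ d * cnj (\<psi> (inv (\<guillemotleft>4\<guillemotright> \<otimes> u) \<otimes> sqnorm F d z))"
proof -
  have nz: "inv (\<guillemotleft>4\<guillemotright> \<otimes> u) \<in> carrier F"
    using u of_int_4_nonzero by (simp add: integral_iff)
  have "(\<Sum>\<xi>\<in>vecs F d. \<psi> (u \<otimes> sqnorm F d \<xi>) * Psi d \<xi> z) =
    (\<Sum>\<xi>\<in>vecs F d. \<Prod>i<d. \<psi> (u \<otimes> (\<xi> i \<otimes> \<xi> i) \<oplus> \<xi> i \<otimes> z i))"
  proof (intro sum.cong refl)
    fix \<xi> assume \<xi>: "\<xi> \<in> vecs F d"
    have "\<psi> (u \<otimes> sqnorm F d \<xi>) * Psi d \<xi> z = (\<Prod>i<d. \<psi> (u \<otimes> (\<xi> i \<otimes> \<xi> i)) * \<psi> (\<xi> i \<otimes> z i))"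
      using u \<xi> by (simp add: \<psi>_sqnorm Psi_def prod.distrib)
    also have "\<dots> = (\<Prod>i<d. \<psi> (u \<otimes> (\<xi> i \<otimes> \<xi> i) \<oplus> \<xi> i \<otimes> z i))"
      using u \<xi> z vecs_mem by (intro prod.cong refl \<psi>_add[symmetric]) auto
    finally show "\<psi> (u \<otimes> sqnorm F d \<xi>) * Psi d \<xi> z = (\<Prod>i<d. \<psi> (u \<otimes> (\<xi> i \<otimes> \<xi> i) \<oplus> \<xi> i \<otimes> z i))" .
  qed
  also have "\<dots> = (\<Prod>i<d. \<Sum>a\<in>carrier F. \<psi> (u \<otimes> (a \<otimes> a) \<oplus> a \<otimes> z i))"
    by (rule sum_prod_vecs)
  also have "\<dots> = (\<Prod>i<d. gauss u * cnj (\<psi> (inv (\<guillemotleft>4\<guillemotright> \<otimes> u) \<otimes> (z i \<otimes> z i))))"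
  proof (intro prod.cong refl)
    fix i assume "i \<in> {..<d}"
    then have zi: "z i \<in> carrier F" using z vecs_mem by auto
    show "(\<Sum>a\<in>carrier F. \<psi> (u \<otimes> (a \<otimes> a) \<oplus> a \<otimes> z i)) = gauss u * cnj (\<psi> (inv (\<guillemotleft>4\<guillemotright> \<otimes> u) \<otimes> (z i \<otimes> z i)))"
      using gauss_complete[OF u zi] zi nz by (simp add: m_comm)
  qed
  also have "\<dots> = gauss u ^ d * cnj (\<psi> (inv (\<guillemotleft>4\<guillemotright> \<otimes> u) \<otimes> sqnorm F d z))"
    using nz z by (simp add: \<psi>_sqnorm prod.distrib)
  finally show ?thesis .
qed

section \<open>Radial Fourier multipliers and their convolution kernels\<close>

definition multiplier_kernel :: "nat \<Rightarrow> ('a \<Rightarrow> complex) \<Rightarrow> (nat \<Rightarrow> 'a) \<Rightarrow> complex" where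
  "multiplier_kernel d m z = (\<Sum>\<xi>\<in>vecs F d. m (sqnorm F d \<xi>) * Psi d \<xi> z) / of_real (q ^ d)"

text \<open>On the Fourier side the form is a pairing of the transforms of f and g weighted by m, so
  by Plancherel its L2 norm is governed by the supremum of the multiplier.\<close>

lemma multiplier_kernel_L2:
  fixes f g :: "(nat \<Rightarrow> 'a) \<Rightarrow> real"
  assumes m: "\<And>c. c \<in> carrier F \<Longrightarrow> cmod (m c) \<le> \<Lambda>"
  shows "cmod (\<Sum>x\<in>vecs F d. \<Sum>y\<in>vecs F d. of_real (f x * g y) * multiplier_kernel d m (vminus F d x y))
    \<le> \<Lambda> * (sqrt (\<Sum>x\<in>vecs F d. (f x)\<^sup>2) * sqrt (\<Sum>y\<in>vecs F d. (g y)\<^sup>2))"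
proof -
  let ?V = "vecs F d"
  define tf where "tf h \<xi> = (\<Sum>x\<in>?V. of_real (h x) * Psi d \<xi> x)" for h :: "(nat \<Rightarrow> 'a) \<Rightarrow> real" and \<xi>
  have L0: "0 \<le> \<Lambda>" using m[of \<zero>] by (meson norm_ge_zero order_trans zero_closed)
  have q0: "q ^ d > 0" using order_gt_1 by simp
  have pl: "(\<Sum>\<xi>\<in>?V. (cmod (tf h \<xi>))\<^sup>2) = q ^ d * (\<Sum>x\<in>?V. (h x)\<^sup>2)" for h
    unfolding tf_def using parseval[where X = ?V and Y = ?V and e = "\<lambda>x \<xi>. Psi d \<xi> x" and N = "q ^ d" and a = "\<lambda>x. of_real (h x)"]
    by (simp add: Psi_orthogonal)
  have "(\<Sum>x\<in>?V. \<Sum>y\<in>?V. of_real (f x * g y) * multiplier_kernel d m (vminus F d x y)) =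
    (\<Sum>x\<in>?V. \<Sum>y\<in>?V. \<Sum>\<xi>\<in>?V. m (sqnorm F d \<xi>) * (of_real (f x) * Psi d \<xi> x) * cnj (of_real (g y) * Psi d \<xi> y)) / of_real (q ^ d)"
    unfolding multiplier_kernel_def sum_divide_distrib sum_distrib_left
    by (intro sum.cong refl) (simp add: Psi_vminus)
  also have "(\<Sum>x\<in>?V. \<Sum>y\<in>?V. \<Sum>\<xi>\<in>?V. m (sqnorm F d \<xi>) * (of_real (f x) * Psi d \<xi> x) * cnj (of_real (g y) * Psi d \<xi> y)) =
    (\<Sum>\<xi>\<in>?V. \<Sum>x\<in>?V. \<Sum>y\<in>?V. m (sqnorm F d \<xi>) * (of_real (f x) * Psi d \<xi> x) * cnj (of_real (g y) * Psi d \<xi> y))"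
    by (subst sum.swap[of _ ?V], rule sum.cong[OF refl], rule sum.swap[of _ ?V]) 
  also have "\<dots> = (\<Sum>\<xi>\<in>?V. m (sqnorm F d \<xi>) * tf f \<xi> * cnj (tf g \<xi>))"
    unfolding tf_def cnj_sum by (simp add: sum_distrib_left sum_distrib_right mult_ac)
  finally have eq: "cmod (\<Sum>x\<in>?V. \<Sum>y\<in>?V. of_real (f x * g y) * multiplier_kernel d m (vminus F d x y))
    = cmod (\<Sum>\<xi>\<in>?V. m (sqnorm F d \<xi>) * tf f \<xi> * cnj (tf g \<xi>)) / q ^ d"
    using q0 by (simp add: norm_divide norm_power)
  have "(\<Sum>\<xi>\<in>?V. (cmod (m (sqnorm F d \<xi>) * tf f \<xi>))\<^sup>2) \<le> (\<Sum>\<xi>\<in>?V. \<Lambda>\<^sup>2 * (cmod (tf f \<xi>))\<^sup>2)"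
    using m by (intro sum_mono) (auto simp: norm_mult power_mult_distrib intro!: mult_right_mono power_mono)
  also have "\<dots> = \<Lambda>\<^sup>2 * (q ^ d * (\<Sum>x\<in>?V. (f x)\<^sup>2))" by (simp add: sum_distrib_left[symmetric] pl)
  finally have A: "(\<Sum>\<xi>\<in>?V. (cmod (m (sqnorm F d \<xi>) * tf f \<xi>))\<^sup>2) \<le> \<Lambda>\<^sup>2 * (q ^ d * (\<Sum>x\<in>?V. (f x)\<^sup>2))" .
  have "cmod (\<Sum>\<xi>\<in>?V. (m (sqnorm F d \<xi>) * tf f \<xi>) * cnj (tf g \<xi>)) \<le>
     sqrt (\<Sum>\<xi>\<in>?V. (cmod (m (sqnorm F d \<xi>) * tf f \<xi>))\<^sup>2) * sqrt (\<Sum>\<xi>\<in>?V. (cmod (cnj (tf g \<xi>)))\<^sup>2)"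
    by (rule cmod_sum_mult_le)
  also have "\<dots> \<le> sqrt (\<Lambda>\<^sup>2 * (q ^ d * (\<Sum>x\<in>?V. (f x)\<^sup>2))) * sqrt (q ^ d * (\<Sum>x\<in>?V. (g x)\<^sup>2))"
    using A by (intro mult_mono) (simp_all add: pl sum_nonneg)
  also have "\<dots> = \<Lambda> * (sqrt (\<Sum>x\<in>?V. (f x)\<^sup>2) * sqrt (\<Sum>x\<in>?V. (g x)\<^sup>2)) * q ^ d"
  proof -
    have "sqrt (q ^ d) * sqrt (q ^ d) = q ^ d" using q0 by simp
    then show ?thesis using L0 by (simp add: real_sqrt_mult mult_ac)
  qed
  finally show ?thesis unfolding eq using q0 by (simp add: pos_divide_le_eq)
qed

text \<open>A pointwise bound that sees only the l2 norm of m over the field. Expanding m in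
  additive characters turns the sum over \<xi> into Gauss sums, so the kernel becomes a pairing of m
  with coefficients \<open>R\<close>. Their l2 norm is at most q * q^(d/2) by Parseval, and
  Cauchy-Schwarz concludes. At z = 0 the trivial character would contribute a term of size
  q^d.\<close>

lemma sum_multiplier_sqnorm:
  assumes z: "z \<in> vecs F d" "z \<noteq> vzero d"
  shows "cmod (multiplier_kernel d m z) \<le> sqrt (\<Sum>c\<in>carrier F. (cmod (m c))\<^sup>2) / sqrt (q ^ d)"
proof -
  let ?V = "vecs F d" and ?U = "carrier F - {\<zero>}"
  define w where "w s = gauss s ^ d * cnj (\<psi> (inv (\<guillemotleft>4\<guillemotright> \<otimes> s) \<otimes> sqnorm F d z))" for s
  define R where "R c = (\<Sum>s\<in>?U. w s * cnj (\<psi> (s \<otimes> c)))" for c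
  have q0: "q > 0" using order_gt_1 by simp
  have delta: "m b = (\<Sum>c\<in>carrier F. m c * (\<Sum>s\<in>carrier F. \<psi> (s \<otimes> (b \<ominus> c)))) / of_real q"
    if b: "b \<in> carrier F" for b
  proof -
    have "(\<Sum>c\<in>carrier F. m c * (\<Sum>s\<in>carrier F. \<psi> (s \<otimes> (b \<ominus> c)))) =
      (\<Sum>c\<in>carrier F. if c = b then m c * of_real q else 0)"
    proof (intro sum.cong refl)
      fix c assume c: "c \<in> carrier F"
      then have "b \<ominus> c = \<zero> \<longleftrightarrow> c = b" using b by (auto simp: eq_diff0)
      then show "m c * (\<Sum>s\<in>carrier F. \<psi> (s \<otimes> (b \<ominus> c))) = (if c = b then m c * of_real q else 0)"
        using sum_\<psi>[of "b \<ominus> c"] b c by simp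
    qed
    then show ?thesis using b finite_carrier q0 by simp
  qed
  have "(\<Sum>\<xi>\<in>?V. m (sqnorm F d \<xi>) * Psi d \<xi> z) =
    (\<Sum>\<xi>\<in>?V. \<Sum>c\<in>carrier F. \<Sum>s\<in>carrier F. m c * cnj (\<psi> (s \<otimes> c)) * (\<psi> (s \<otimes> sqnorm F d \<xi>) * Psi d \<xi> z)) / of_real q"
    unfolding sum_divide_distrib[of _ ?V]
  proof (rule sum.cong[OF refl])
    fix \<xi> assume \<xi>: "\<xi> \<in> ?V"
    have "\<psi> (s \<otimes> (sqnorm F d \<xi> \<ominus> c)) = \<psi> (s \<otimes> sqnorm F d \<xi>) * cnj (\<psi> (s \<otimes> c))"
      if "s \<in> carrier F" "c \<in> carrier F" for s c
      using that \<xi> by (simp add: \<psi>_diff[symmetric] minus_eq r_distr r_minus)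
    then show "m (sqnorm F d \<xi>) * Psi d \<xi> z = (\<Sum>c\<in>carrier F. \<Sum>s\<in>carrier F. m c * cnj (\<psi> (s \<otimes> c)) * (\<psi> (s \<otimes> sqnorm F d \<xi>) * Psi d \<xi> z)) / of_real q"
      unfolding delta[OF sqnorm_closed[OF \<xi>]] by (simp add: sum_distrib_left sum_distrib_right sum_divide_distrib mult_ac)
  qed
  also have "(\<Sum>\<xi>\<in>?V. \<Sum>c\<in>carrier F. \<Sum>s\<in>carrier F. m c * cnj (\<psi> (s \<otimes> c)) * (\<psi> (s \<otimes> sqnorm F d \<xi>) * Psi d \<xi> z)) =
    (\<Sum>c\<in>carrier F. \<Sum>s\<in>carrier F. \<Sum>\<xi>\<in>?V. m c * cnj (\<psi> (s \<otimes> c)) * (\<psi> (s \<otimes> sqnorm F d \<xi>) * Psi d \<xi> z))"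
    by (rule trans[OF sum.swap], rule sum.cong[OF refl], rule sum.swap)
  also have "\<dots> = (\<Sum>c\<in>carrier F. m c * R c)"
  proof (intro sum.cong refl)
    fix c assume c: "c \<in> carrier F"
    have "(\<Sum>s\<in>carrier F. \<Sum>\<xi>\<in>?V. m c * cnj (\<psi> (s \<otimes> c)) * (\<psi> (s \<otimes> sqnorm F d \<xi>) * Psi d \<xi> z)) =
      (\<Sum>s\<in>carrier F. m c * cnj (\<psi> (s \<otimes> c)) * (\<Sum>\<xi>\<in>?V. \<psi> (s \<otimes> sqnorm F d \<xi>) * Psi d \<xi> z))"
      by (simp add: sum_distrib_left)
    \<comment> \<open>The term s = 0 is a complete sum of a nontrivial character of the vector
      space, because z is nonzero.\<close>
    also have "\<dots> = (\<Sum>s\<in>?U. m c * cnj (\<psi> (s \<otimes> c)) * (\<Sum>\<xi>\<in>?V. \<psi> (s \<otimes> sqnorm F d \<xi>) * Psi d \<xi> z))"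
      using sum_Psi[OF z(1)] z(2) by (simp add: sum_remove_zero)
    also have "\<dots> = m c * R c"
      unfolding R_def w_def sum_distrib_left[of "m c"] using z(1)
      by (intro sum.cong refl) (simp add: gauss_vec)
    finally show "(\<Sum>s\<in>carrier F. \<Sum>\<xi>\<in>?V. m c * cnj (\<psi> (s \<otimes> c)) * (\<psi> (s \<otimes> sqnorm F d \<xi>) * Psi d \<xi> z)) = m c * R c" .
  qed
  finally have eq: "multiplier_kernel d m z = (\<Sum>c\<in>carrier F. m c * R c) / of_real (q * q ^ d)"
    unfolding multiplier_kernel_def by simp
  have w: "(cmod (w s))\<^sup>2 = q ^ d" if "s \<in> ?U" for s
  proof -
    have "inv (\<guillemotleft>4\<guillemotright> \<otimes> s) \<in> carrier F" using that of_int_4_nonzero by (simp add: integral_iff)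
    then show ?thesis
      using that z norm_gauss[of s] unfolding w_def
      by (simp add: norm_mult norm_power norm_\<psi> flip: power_mult) (simp add: power_mult mult.commute[of d 2])
  qed
  have "(\<Sum>c\<in>carrier F. (cmod (R c))\<^sup>2) = q * (\<Sum>s\<in>?U. (cmod (w s))\<^sup>2)"
    unfolding R_def
  proof (rule parseval)
    show "finite ?U" using finite_carrier by simp
    fix s s' assume s: "s \<in> ?U" "s' \<in> ?U"
    have "(\<Sum>c\<in>carrier F. cnj (\<psi> (s \<otimes> c)) * cnj (cnj (\<psi> (s' \<otimes> c)))) = (\<Sum>c\<in>carrier F. \<psi> (c \<otimes> (s' \<ominus> s)))"
      using s by (intro sum.cong refl) (simp add: \<psi>_diff[symmetric] minus_eq l_distr r_distr l_minus r_minus m_comm a_comm mult.commute)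
    moreover have "s' \<ominus> s = \<zero> \<longleftrightarrow> s = s'" using s by (auto simp: eq_diff0)
    ultimately show "(\<Sum>c\<in>carrier F. cnj (\<psi> (s \<otimes> c)) * cnj (cnj (\<psi> (s' \<otimes> c)))) = (if s = s' then of_real q else 0)"
      using s sum_\<psi>[of "s' \<ominus> s"] by simp
  qed
  also have "\<dots> \<le> q * (q * q ^ d)"
  proof -
    have "real (card ?U) \<le> q" using finite_carrier by (simp add: Coset.order_def card_Diff_singleton)
    then show ?thesis using w q0 by (simp add: mult_right_mono)
  qed
  finally have "(\<Sum>c\<in>carrier F. (cmod (R c))\<^sup>2) \<le> (q * sqrt (q ^ d))\<^sup>2"
    using q0 by (simp add: power_mult_distrib monoid_mult_class.power2_eq_square mult_ac)
  then have R: "sqrt (\<Sum>c\<in>carrier F. (cmod (R c))\<^sup>2) \<le> q * sqrt (q ^ d)"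
    using q0 by (intro real_le_lsqrt) auto
  have "cmod (\<Sum>c\<in>carrier F. m c * R c) \<le> sqrt (\<Sum>c\<in>carrier F. (cmod (m c))\<^sup>2) * (q * sqrt (q ^ d))"
    by (rule order_trans[OF cmod_sum_mult_le]) (intro mult_left_mono R, simp add: sum_nonneg)
  then have "cmod (multiplier_kernel d m z) \<le> (sqrt (\<Sum>c\<in>carrier F. (cmod (m c))\<^sup>2) * (q * sqrt (q ^ d))) / (q * q ^ d)"
    unfolding eq norm_divide using q0 by (simp only: norm_of_real abs_of_pos zero_less_power mult_pos_pos divide_right_mono less_imp_le)
  also have "\<dots> = sqrt (\<Sum>c\<in>carrier F. (cmod (m c))\<^sup>2) / sqrt (q ^ d)"
  proof -
    have "sqrt (q ^ d) * sqrt (q ^ d) = q ^ d" using q0 by simp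
    then show ?thesis using q0 by (simp add: field_simps)
  qed
  finally show ?thesis .
qed

text \<open>The Fourier transform of the indicator of the sphere minus 1 / q. If ||z|| = t is
  detected by the characters \<psi>(s (t - ||z||)), the frequency s = 0 gives the constant 1 / q.
  For s = 1 / (4 u) the phase in z is, by \<open>gauss_vec\<close> read backwards, the transform of
  \<psi>(u ||\<xi>||) divided by \<open>gauss u ^ d\<close>.\<close>

definition sphere_mult :: "nat \<Rightarrow> 'a \<Rightarrow> 'a \<Rightarrow> complex" where
  "sphere_mult d t c = of_real (q ^ (d - 1)) *
     (\<Sum>u\<in>carrier F - {\<zero>}. \<psi> (t \<otimes> inv (\<guillemotleft>4\<guillemotright> \<otimes> u) \<oplus> u \<otimes> c) / gauss u ^ d)"

lemma sum_inv_4: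
  fixes f :: "'a \<Rightarrow> complex"
  shows "(\<Sum>u\<in>carrier F - {\<zero>}. f (inv (\<guillemotleft>4\<guillemotright> \<otimes> u))) = (\<Sum>u\<in>carrier F - {\<zero>}. f u)"
  using sum_scale(1)[OF of_int_closed of_int_4_nonzero, of "\<lambda>u. f (inv u)"] sum_inverse[of f] by simp

lemma sphere_expansion:
  assumes d: "0 < d" and t: "t \<in> carrier F" and z: "z \<in> vecs F d"
  shows "of_real (indicat_real (sphere F d t) z) = 1 / of_real q + multiplier_kernel d (sphere_mult d t) z"
proof -
  let ?V = "vecs F d" and ?U = "carrier F - {\<zero>}"
  have q0: "q > 0" using order_gt_1 by simp
  have i4: "inv (\<guillemotleft>4\<guillemotright> \<otimes> u) \<in> carrier F" if "u \<in> ?U" for u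
    using that of_int_4_nonzero by (simp add: integral_iff)
  have g: "gauss u \<noteq> 0" if "u \<in> ?U" for u using that norm_gauss[of u] q0 by auto
  have "(\<Sum>\<xi>\<in>?V. sphere_mult d t (sqnorm F d \<xi>) * Psi d \<xi> z) =
    of_real (q ^ (d - 1)) * (\<Sum>\<xi>\<in>?V. \<Sum>u\<in>?U. \<psi> (t \<otimes> inv (\<guillemotleft>4\<guillemotright> \<otimes> u)) / gauss u ^ d * (\<psi> (u \<otimes> sqnorm F d \<xi>) * Psi d \<xi> z))"
    unfolding sphere_mult_def sum_distrib_left sum_distrib_right
    by (intro sum.cong refl) (use i4 t in \<open>simp add: \<psi>_add\<close>)
  also have "\<dots> = of_real (q ^ (d - 1)) * (\<Sum>u\<in>?U. \<psi> (t \<otimes> inv (\<guillemotleft>4\<guillemotright> \<otimes> u)) / gauss u ^ d * (\<Sum>\<xi>\<in>?V. \<psi> (u \<otimes> sqnorm F d \<xi>) * Psi d \<xi> z))"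
    unfolding sum_distrib_left by (subst sum.swap) simp
  also have "\<dots> = of_real (q ^ (d - 1)) * (\<Sum>u\<in>?U. \<psi> (inv (\<guillemotleft>4\<guillemotright> \<otimes> u) \<otimes> (t \<ominus> sqnorm F d z)))"
  proof (intro arg_cong2[where f = "(*)"] sum.cong refl)
    fix u assume u: "u \<in> ?U"
    have "inv (\<guillemotleft>4\<guillemotright> \<otimes> u) \<otimes> (t \<ominus> sqnorm F d z) = t \<otimes> inv (\<guillemotleft>4\<guillemotright> \<otimes> u) \<ominus> inv (\<guillemotleft>4\<guillemotright> \<otimes> u) \<otimes> sqnorm F d z"
      using i4[OF u] t z by (simp add: minus_eq r_distr r_minus m_comm[of t])
    then show "\<psi> (t \<otimes> inv (\<guillemotleft>4\<guillemotright> \<otimes> u)) / gauss u ^ d * (\<Sum>\<xi>\<in>?V. \<psi> (u \<otimes> sqnorm F d \<xi>) * Psi d \<xi> z)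
        = \<psi> (inv (\<guillemotleft>4\<guillemotright> \<otimes> u) \<otimes> (t \<ominus> sqnorm F d z))"
      using u g[OF u] i4[OF u] t z gauss_vec[of u z d] by (simp add: \<psi>_diff)
  qed
  also have "(\<Sum>u\<in>?U. \<psi> (inv (\<guillemotleft>4\<guillemotright> \<otimes> u) \<otimes> (t \<ominus> sqnorm F d z))) = (\<Sum>u\<in>?U. \<psi> (u \<otimes> (t \<ominus> sqnorm F d z)))"
    by (rule sum_inv_4[of "\<lambda>v. \<psi> (v \<otimes> (t \<ominus> sqnorm F d z))"])
  also have "\<dots> = (\<Sum>u\<in>carrier F. \<psi> (u \<otimes> (t \<ominus> sqnorm F d z))) - 1"
    using t z by (simp add: sum_remove_zero)
  also have "\<dots> = of_real (q * indicat_real (sphere F d t) z) - 1"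
  proof -
    have "t \<ominus> sqnorm F d z = \<zero> \<longleftrightarrow> sqnorm F d z = t" using t z by (auto simp: eq_diff0)
    then show ?thesis using sum_\<psi>[of "t \<ominus> sqnorm F d z"] t z by (simp add: Defs.sphere_def indicator_def)
  qed
  finally have "multiplier_kernel d (sphere_mult d t) z =
      of_real (q ^ (d - 1)) * (of_real (q * indicat_real (sphere F d t) z) - 1) / of_real (q ^ d)"
    unfolding multiplier_kernel_def by simp
  also have "\<dots> = of_real (indicat_real (sphere F d t) z) - 1 / of_real q"
    using q0 d by (cases d) (simp_all add: field_simps)
  finally show ?thesis by simp
qed

end

section \<open>Kloosterman sums\<close>

lemma (in domain) card_square_roots_le:
  assumes y: "y \<in> carrier R"
  shows "card {x \<in> carrier R. x \<otimes> x = y} \<le> 2"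
proof (cases "{x \<in> carrier R. x \<otimes> x = y} = {}")
  case False
  then obtain x where x: "x \<in> carrier R" "x \<otimes> x = y" by blast
  have "{z \<in> carrier R. z \<otimes> z = y} \<subseteq> {x, \<ominus> x}"
    using x square_eq_iff by auto
  then have "card {z \<in> carrier R. z \<otimes> z = y} \<le> card {x, \<ominus> x}" by (intro card_mono) auto
  also have "\<dots> \<le> 2" using card_length[of "[x, \<ominus> x]"] by simp
  finally show ?thesis .
next
  case True
  then show ?thesis by (simp only: card.empty)
qed

lemma sum_swap3: "(\<Sum>a\<in>A. \<Sum>b\<in>B. \<Sum>c\<in>C. f a b c) = (\<Sum>b\<in>B. \<Sum>c\<in>C. \<Sum>a\<in>A. f a b c)"
  by (rule trans[OF sum.swap], rule sum.cong[OF refl], rule sum.swap)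

lemma sum_if_const:
  fixes c :: "'b :: comm_semiring_1"
  shows "finite A \<Longrightarrow> (\<Sum>x\<in>A. if Q x then c else 0) = c * of_nat (card {x \<in> A. Q x})"
  by (simp add: sum.inter_filter[symmetric] mult.commute)

context field_character
begin

definition kloosterman :: "'a \<Rightarrow> 'a \<Rightarrow> complex" where
  "kloosterman t c = (\<Sum>u\<in>carrier F - {\<zero>}. \<psi> (t \<otimes> inv (\<guillemotleft>4\<guillemotright> \<otimes> u) \<oplus> u \<otimes> c))"

lemma inv_4_closed: "u \<in> carrier F \<Longrightarrow> u \<noteq> \<zero> \<Longrightarrow> inv (\<guillemotleft>4\<guillemotright> \<otimes> u) \<in> carrier F"
  using of_int_4_nonzero by (simp add: integral_iff)

lemma norm_gauss_eq: "u \<in> carrier F \<Longrightarrow> u \<noteq> \<zero> \<Longrightarrow> cmod (gauss u) = sqrt q"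
  using norm_gauss[of u] by (metis norm_ge_zero real_sqrt_unique)

lemma q_gt_0: "q > 0"
  using order_gt_1 by simp

text \<open>In even dimension the Gauss factor is constant in u and comes out of the sum with
  modulus q^(d/2); against q^(d-1) this leaves q^((d-2)/2).\<close>

lemma norm_sphere_mult_even:
  assumes d: "even d" "0 < d"
  shows "cmod (sphere_mult d t c) = sqrt q ^ (d - 2) * cmod (kloosterman t c)"
proof -
  let ?U = "carrier F - {\<zero>}"
  obtain k where k: "d = 2 * k" "k > 0" using d by auto
  have g: "gauss u ^ d = gauss \<one> ^ d" if "u \<in> ?U" for u
    using gauss_square[of u] that unfolding k by (simp add: power_mult)
  have "sphere_mult d t c = of_real (q ^ (d - 1)) * (kloosterman t c / gauss \<one> ^ d)"
    unfolding sphere_mult_def kloosterman_def sum_divide_distrib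
    by (intro arg_cong2[where f = "(*)"] arg_cong2[where f = "(/)"] refl sum.cong g)
  then have "cmod (sphere_mult d t c) = q ^ (d - 1) / sqrt q ^ d * cmod (kloosterman t c)"
    using norm_gauss_eq[of \<one>] by (simp add: norm_mult norm_divide norm_power)
  also have "q ^ (d - 1) / sqrt q ^ d = sqrt q ^ (d - 2)"
  proof -
    have "q ^ (d - 1) = sqrt q ^ (d - 2) * sqrt q ^ d"
    proof -
      have "q ^ (d - 1) = (sqrt q ^ 2) ^ (d - 1)" using q_gt_0 by simp
      also have "\<dots> = sqrt q ^ (d - 2 + d)" unfolding power_mult[symmetric] using k by (intro arg_cong2[where f = "(^)"]) auto
      finally show ?thesis by (simp add: power_add)
    qed
    then show ?thesis using q_gt_0 by simp
  qed
  finally show ?thesis .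
qed

lemma kloosterman_zero:
  assumes t: "t \<in> carrier F" "t \<noteq> \<zero>"
  shows "cmod (kloosterman t \<zero>) = 1"
proof -
  let ?U = "carrier F - {\<zero>}"
  have "kloosterman t \<zero> = (\<Sum>u\<in>?U. \<psi> (inv (\<guillemotleft>4\<guillemotright> \<otimes> u) \<otimes> t))"
    unfolding kloosterman_def using t inv_4_closed by (intro sum.cong) (auto simp: m_comm)
  also have "\<dots> = (\<Sum>u\<in>?U. \<psi> (u \<otimes> t))" by (rule sum_inv_4)
  also have "\<dots> = -1" using sum_\<psi>[of t] t by (simp add: sum_remove_zero add_eq_0_iff)
  finally show ?thesis by simp
qed

text \<open>For odd d one Gauss sum stays inside the sum over u. After scaling u by -t it merges
  with the phase t / (4 u) into a sum over x of \<psi>(u x^2 + x). Summing over u is then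
  orthogonality and leaves only the x with x^2 = t c, of which there are at most two.\<close>

lemma norm_sphere_mult_odd:
  assumes d: "odd d" and t: "t \<in> carrier F" "t \<noteq> \<zero>" and c: "c \<in> carrier F"
  shows "cmod (sphere_mult d t c) \<le> 2 * sqrt q ^ (d - 1)"
proof -
  let ?U = "carrier F - {\<zero>}"
  obtain k where k: "d = 2 * k + 1" using d by (metis oddE)
  define S where "S = (\<Sum>u\<in>?U. gauss u * \<psi> (t \<otimes> inv (\<guillemotleft>4\<guillemotright> \<otimes> u) \<oplus> u \<otimes> c))"
  have g0: "gauss u \<noteq> 0" if "u \<in> ?U" for u using norm_gauss_eq[of u] that q_gt_0 by auto
  have I: "1 / gauss u ^ d = gauss u / (gauss \<one> ^ 2) ^ (k + 1)" if "u \<in> ?U" for u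
  proof -
    have "(gauss \<one> ^ 2) ^ (k + 1) = (gauss u ^ 2) ^ (k + 1)"
      using gauss_square[of u] that by simp
    also have "\<dots> = gauss u ^ (2 * (k + 1))" by (simp only: power_mult)
    also have "\<dots> = gauss u ^ d * gauss u" by (simp add: k)
    finally have "(gauss \<one> ^ 2) ^ (k + 1) = gauss u ^ d * gauss u" .
    then show ?thesis using g0[OF that] by (simp add: field_simps)
  qed
  have "sphere_mult d t c = of_real (q ^ (d - 1)) * (S / (gauss \<one> ^ 2) ^ (k + 1))"
    unfolding sphere_mult_def S_def sum_divide_distrib
  proof (intro arg_cong2[where f = "(*)"] refl sum.cong)
    fix u assume "u \<in> ?U"
    have "z / gauss u ^ d = gauss u * z / (gauss \<one> ^ 2) ^ (k + 1)" for z
    proof -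
      have "z / gauss u ^ d = z * (1 / gauss u ^ d)" by simp
      also have "\<dots> = z * (gauss u / (gauss \<one> ^ 2) ^ (k + 1))" using I[OF \<open>u \<in> ?U\<close>] by (rule arg_cong)
      finally show ?thesis by (simp add: mult.commute)
    qed
    then show "\<psi> (t \<otimes> inv (\<guillemotleft>4\<guillemotright> \<otimes> u) \<oplus> u \<otimes> c) / gauss u ^ d =
      gauss u * \<psi> (t \<otimes> inv (\<guillemotleft>4\<guillemotright> \<otimes> u) \<oplus> u \<otimes> c) / (gauss \<one> ^ 2) ^ (k + 1)" .
  qed
  then have "cmod (sphere_mult d t c) = q ^ (2 * k) / q ^ (k + 1) * cmod S"
    using norm_gauss[of \<one>] by (simp add: norm_mult norm_divide norm_power k)
  also have "q ^ (2 * k) / q ^ (k + 1) = q ^ k / q"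
    using q_gt_0 by (simp add: mult_2 power_add)
  finally have M: "cmod (sphere_mult d t c) = q ^ k / q * cmod S" .
  have "cmod S \<le> 2 * q"
  proof -
    \<comment> \<open>With this scaling the phase t / (4 r u) becomes -1 / (4 u), exactly the one
      produced by completing the square in u x^2 + x.\<close>
    define r where "r = \<ominus> t"
    have r: "r \<in> carrier F" "r \<noteq> \<zero>" using t minus_minus[of t] by (auto simp: r_def)
    obtain \<epsilon> where \<epsilon>: "\<epsilon> \<in> {1, -1}" "\<And>u. u \<in> ?U \<Longrightarrow> gauss (r \<otimes> u) = \<epsilon> * gauss u"
      using gauss_scale[OF r] by blast
    have "S = (\<Sum>u\<in>?U. gauss (r \<otimes> u) * \<psi> (t \<otimes> inv (\<guillemotleft>4\<guillemotright> \<otimes> (r \<otimes> u)) \<oplus> (r \<otimes> u) \<otimes> c))"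
      unfolding S_def by (rule sum_scale(1)[OF r, symmetric])
    also have "\<dots> = (\<Sum>u\<in>?U. \<epsilon> * (\<Sum>x\<in>carrier F. \<psi> x * \<psi> (u \<otimes> (x \<otimes> x \<oplus> r \<otimes> c))))"
    proof (intro sum.cong refl)
      fix u assume u: "u \<in> ?U"
      define i where "i = inv (\<guillemotleft>4\<guillemotright> \<otimes> (r \<otimes> u))"
      define j where "j = inv (\<guillemotleft>4\<guillemotright> \<otimes> u)"
      have ru: "r \<otimes> u \<in> carrier F" "r \<otimes> u \<noteq> \<zero>" using u r by (auto simp: integral_iff)
      have ij: "i \<in> carrier F" "j \<in> carrier F" using inv_4_closed ru u by (auto simp: i_def j_def)
      have 1: "\<guillemotleft>4\<guillemotright> \<otimes> (r \<otimes> u) \<otimes> i = \<one>" "\<guillemotleft>4\<guillemotright> \<otimes> u \<otimes> j = \<one>"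
        using ru u of_int_4_nonzero by (auto simp: i_def j_def integral_iff)
      have "t \<otimes> i = t \<otimes> i \<otimes> (\<guillemotleft>4\<guillemotright> \<otimes> u \<otimes> j)" using ij t 1 by simp
      also have "\<dots> = \<ominus> j \<otimes> (\<guillemotleft>4\<guillemotright> \<otimes> (\<ominus> t \<otimes> u) \<otimes> i)" using ij t u by (simp add: l_minus r_minus m_ac)
      finally have ti: "t \<otimes> i = \<ominus> j" using 1(1) ij unfolding r_def by simp
      have "\<psi> (t \<otimes> i \<oplus> (r \<otimes> u) \<otimes> c) = cnj (\<psi> j) * \<psi> (u \<otimes> (r \<otimes> c))"
        using ij ti u r c by (simp add: \<psi>_add \<psi>_minus m_ac)
      then have "gauss (r \<otimes> u) * \<psi> (t \<otimes> i \<oplus> (r \<otimes> u) \<otimes> c) = \<epsilon> * ((gauss u * cnj (\<psi> j)) * \<psi> (u \<otimes> (r \<otimes> c)))"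
        using \<epsilon>(2)[OF u] by simp
      also have "gauss u * cnj (\<psi> j) = (\<Sum>x\<in>carrier F. \<psi> (u \<otimes> (x \<otimes> x) \<oplus> x))"
        using gauss_complete[of u \<one>] u ij by (simp add: j_def)
      also have "(\<Sum>x\<in>carrier F. \<psi> (u \<otimes> (x \<otimes> x) \<oplus> x)) * \<psi> (u \<otimes> (r \<otimes> c)) =
          (\<Sum>x\<in>carrier F. \<psi> x * \<psi> (u \<otimes> (x \<otimes> x \<oplus> r \<otimes> c)))"
        unfolding sum_distrib_right by (intro sum.cong refl) (use u r c in \<open>simp add: \<psi>_add r_distr\<close>)
      finally show "gauss (r \<otimes> u) * \<psi> (t \<otimes> inv (\<guillemotleft>4\<guillemotright> \<otimes> (r \<otimes> u)) \<oplus> (r \<otimes> u) \<otimes> c) =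
          \<epsilon> * (\<Sum>x\<in>carrier F. \<psi> x * \<psi> (u \<otimes> (x \<otimes> x \<oplus> r \<otimes> c)))" unfolding i_def .
    qed
    also have "\<dots> = \<epsilon> * (\<Sum>x\<in>carrier F. \<psi> x * (\<Sum>u\<in>?U. \<psi> (u \<otimes> (x \<otimes> x \<oplus> r \<otimes> c))))"
      unfolding sum_distrib_left[symmetric] by (subst sum.swap) (simp add: sum_distrib_left)
    also have "(\<Sum>x\<in>carrier F. \<psi> x * (\<Sum>u\<in>?U. \<psi> (u \<otimes> (x \<otimes> x \<oplus> r \<otimes> c)))) =
        (\<Sum>x\<in>carrier F. (if x \<otimes> x = \<ominus> (r \<otimes> c) then of_real q * \<psi> x else 0) - \<psi> x)"
    proof (intro sum.cong refl)
      fix x assume x: "x \<in> carrier F"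
      have 1: "x \<otimes> x \<oplus> r \<otimes> c = \<zero> \<longleftrightarrow> x \<otimes> x = \<ominus> (r \<otimes> c)"
        using x r c by (simp add: eq_neg_iff_add_eq_0)
      have 2: "(\<Sum>u\<in>?U. \<psi> (u \<otimes> (x \<otimes> x \<oplus> r \<otimes> c))) =
          (if x \<otimes> x \<oplus> r \<otimes> c = \<zero> then of_nat (order F) else 0) - 1"
        using x r c sum_\<psi>[of "x \<otimes> x \<oplus> r \<otimes> c"] by (simp add: sum_remove_zero algebra_simps)
      show "\<psi> x * (\<Sum>u\<in>?U. \<psi> (u \<otimes> (x \<otimes> x \<oplus> r \<otimes> c))) =
          (if x \<otimes> x = \<ominus> (r \<otimes> c) then of_real q * \<psi> x else 0) - \<psi> x"
        unfolding 2 1 by (simp add: algebra_simps)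
    qed
    \<comment> \<open>The missing u = 0 contributes -\<psi>(x) for every x, and these terms sum to
      zero.\<close>
    also have "\<dots> = of_real q * (\<Sum>x\<in>{x\<in>carrier F. x \<otimes> x = \<ominus> (r \<otimes> c)}. \<psi> x)"
    proof -
      have "(\<Sum>x\<in>carrier F. \<psi> x) = 0" using sum_\<psi>[of \<one>] by simp
      then show ?thesis
        unfolding sum.inter_filter[OF finite_carrier] sum_distrib_left sum_subtractf
        by (auto intro!: sum.cong)
    qed
    finally have "cmod S = q * cmod (\<Sum>x\<in>{x\<in>carrier F. x \<otimes> x = \<ominus> (r \<otimes> c)}. \<psi> x)"
      using \<epsilon>(1) by (auto simp: norm_mult)
    also have "cmod (\<Sum>x\<in>{x\<in>carrier F. x \<otimes> x = \<ominus> (r \<otimes> c)}. \<psi> x) \<le> of_nat (card {x\<in>carrier F. x \<otimes> x = \<ominus> (r \<otimes> c)}) * 1"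
      by (intro sum_norm_bound) (simp add: norm_\<psi>)
    also have "\<dots> \<le> 2" using card_square_roots_le[of "\<ominus> (r \<otimes> c)"] r c by simp
    finally show ?thesis using q_gt_0 by simp
  qed
  then have "cmod (sphere_mult d t c) \<le> q ^ k / q * (2 * q)"
    unfolding M using q_gt_0 by (intro mult_left_mono) auto
  moreover have "sqrt q ^ (d - 1) = q ^ k" using q_gt_0 by (simp add: k power_mult)
  ultimately show ?thesis using q_gt_0 by simp
qed

text \<open>If u + v \<noteq> 0, the sum and the sum of reciprocals also determine the product, so
  u' and v' are the two roots of one quadratic. If u + v = 0, every pair (u', -u') qualifies; this
  costs up to q solutions, but only on a line of pairs (u, v).\<close>

lemma card_inverse_quadruples:
  assumes u: "u \<in> carrier F - {\<zero>}" and v: "v \<in> carrier F - {\<zero>}"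
  shows "card {(u', v'). u' \<in> carrier F - {\<zero>} \<and> v' \<in> carrier F - {\<zero>} \<and>
      inv (\<guillemotleft>4\<guillemotright> \<otimes> u') \<oplus> inv (\<guillemotleft>4\<guillemotright> \<otimes> v') = inv (\<guillemotleft>4\<guillemotright> \<otimes> u) \<oplus> inv (\<guillemotleft>4\<guillemotright> \<otimes> v) \<and>
      u' \<oplus> v' = u \<oplus> v} \<le> (if u \<oplus> v = \<zero> then order F else 2)"
    (is "card ?Q \<le> _")
proof (cases "u \<oplus> v = \<zero>")
  case True
  have "?Q \<subseteq> (\<lambda>u. (u, \<ominus> u)) ` carrier F"
  proof
    fix p assume "p \<in> ?Q"
    then obtain u' v' where p: "p = (u', v')" "u' \<in> carrier F" "v' \<in> carrier F" "u' \<oplus> v' = u \<oplus> v" by blast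
    then have "v' = \<ominus> u'" using True by (simp add: eq_neg_iff_add_eq_0 a_comm)
    then show "p \<in> (\<lambda>u. (u, \<ominus> u)) ` carrier F" using p by auto
  qed
  then have "card ?Q \<le> card ((\<lambda>u. (u, \<ominus> u)) ` carrier F)"
    using finite_carrier by (intro card_mono) auto
  also have "\<dots> \<le> card (carrier F)" by (rule card_image_le[OF finite_carrier])
  finally show ?thesis using True by (simp add: Coset.order_def)
next
  case False
  have "?Q \<subseteq> {(u, v), (v, u)}"
  proof
    fix p assume "p \<in> ?Q"
    then obtain x y where p_eq: "p = (x, y)" and xy: "x \<in> carrier F" "y \<in> carrier F" "x \<noteq> \<zero>" "y \<noteq> \<zero>"
      and eq: "inv (\<guillemotleft>4\<guillemotright> \<otimes> x) \<oplus> inv (\<guillemotleft>4\<guillemotright> \<otimes> y) = inv (\<guillemotleft>4\<guillemotright> \<otimes> u) \<oplus> inv (\<guillemotleft>4\<guillemotright> \<otimes> v)"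
      and s: "x \<oplus> y = u \<oplus> v" by blast
    define iu iv ix iy where "iu = inv (\<guillemotleft>4\<guillemotright> \<otimes> u)" and "iv = inv (\<guillemotleft>4\<guillemotright> \<otimes> v)"
      and "ix = inv (\<guillemotleft>4\<guillemotright> \<otimes> x)" and "iy = inv (\<guillemotleft>4\<guillemotright> \<otimes> y)"
    note idef = this
    have c: "iu \<in> carrier F" "iv \<in> carrier F" "ix \<in> carrier F" "iy \<in> carrier F" "u \<in> carrier F" "v \<in> carrier F"
      using inv_4_closed u v xy by (auto simp: idef)
    have 1: "\<guillemotleft>4\<guillemotright> \<otimes> u \<otimes> iu = \<one>" "\<guillemotleft>4\<guillemotright> \<otimes> v \<otimes> iv = \<one>" "\<guillemotleft>4\<guillemotright> \<otimes> x \<otimes> ix = \<one>" "\<guillemotleft>4\<guillemotright> \<otimes> y \<otimes> iy = \<one>"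
      using u v xy of_int_4_nonzero by (auto simp: idef integral_iff)
    have e: "ix \<oplus> iy = iu \<oplus> iv" using eq by (simp add: idef)
    \<comment> \<open>Clearing denominators with the factor 4 u v x y yields (u + v) x y = (x + y) u
      v.\<close>
    have "(\<guillemotleft>4\<guillemotright> \<otimes> v \<otimes> iv) \<otimes> u \<otimes> x \<otimes> y \<oplus> (\<guillemotleft>4\<guillemotright> \<otimes> u \<otimes> iu) \<otimes> v \<otimes> x \<otimes> y = \<guillemotleft>4\<guillemotright> \<otimes> u \<otimes> v \<otimes> x \<otimes> y \<otimes> (iu \<oplus> iv)"
      using c xy by (simp add: l_distr r_distr m_ac a_ac)
    also have "\<dots> = \<guillemotleft>4\<guillemotright> \<otimes> u \<otimes> v \<otimes> x \<otimes> y \<otimes> (ix \<oplus> iy)" by (simp only: e)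
    also have "\<dots> = (\<guillemotleft>4\<guillemotright> \<otimes> y \<otimes> iy) \<otimes> u \<otimes> v \<otimes> x \<oplus> (\<guillemotleft>4\<guillemotright> \<otimes> x \<otimes> ix) \<otimes> u \<otimes> v \<otimes> y"
      using c xy by (simp add: l_distr r_distr m_ac a_ac)
    finally have "u \<otimes> x \<otimes> y \<oplus> v \<otimes> x \<otimes> y = u \<otimes> v \<otimes> x \<oplus> u \<otimes> v \<otimes> y" unfolding 1 using c xy by simp
    moreover have "u \<otimes> x \<otimes> y \<oplus> v \<otimes> x \<otimes> y = (u \<oplus> v) \<otimes> (x \<otimes> y)" using c xy by (simp add: l_distr r_distr m_ac a_ac)
    moreover have "u \<otimes> v \<otimes> x \<oplus> u \<otimes> v \<otimes> y = (x \<oplus> y) \<otimes> (u \<otimes> v)" using c xy by (simp add: l_distr r_distr m_ac a_ac)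
    ultimately have "(u \<oplus> v) \<otimes> (x \<otimes> y) = (u \<oplus> v) \<otimes> (u \<otimes> v)" using s by simp
    then have p: "x \<otimes> y = u \<otimes> v" using m_lcancel[of "u \<oplus> v" "x \<otimes> y" "u \<otimes> v"] False c xy by simp
    have "(x \<ominus> u) \<otimes> (x \<ominus> v) = x \<otimes> x \<ominus> x \<otimes> (u \<oplus> v) \<oplus> u \<otimes> v"
      using xy(1) c(5,6) by algebra
    also have "\<dots> = x \<otimes> x \<ominus> x \<otimes> (x \<oplus> y) \<oplus> x \<otimes> y" by (simp only: s p)
    also have "\<dots> = \<zero>" using xy(1,2) by algebra
    finally have "x = u \<or> x = v" using c xy by (simp add: integral_iff eq_diff0)
    moreover have "y = v" if "x = u" using that s c xy by simp
    moreover have "y = u" if "x = v" using that s c xy by (simp add: a_comm[of u])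
    ultimately show "p \<in> {(u, v), (v, u)}" using p_eq by blast
  qed
  then have "card ?Q \<le> card {(u, v), (v, u)}" by (intro card_mono) auto
  also have "\<dots> \<le> 2" using card_length[of "[(u, v), (v, u)]"] by simp
  finally show ?thesis using False by simp
qed

text \<open>Substitution of t u for u. The sums for different nonzero t are rearrangements of one
  another in c, so their moments over c agree.\<close>

lemma kloosterman_scale:
  assumes t: "t \<in> carrier F" "t \<noteq> \<zero>" and c: "c \<in> carrier F"
  shows "kloosterman t c = kloosterman \<one> (t \<otimes> c)"
proof -
  have "kloosterman t c = (\<Sum>u\<in>carrier F - {\<zero>}. \<psi> (t \<otimes> inv (\<guillemotleft>4\<guillemotright> \<otimes> (t \<otimes> u)) \<oplus> (t \<otimes> u) \<otimes> c))"
    unfolding kloosterman_def by (rule sum_scale(1)[OF t, symmetric])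
  also have "\<dots> = kloosterman \<one> (t \<otimes> c)"
    unfolding kloosterman_def
  proof (intro sum.cong refl arg_cong[where f = \<psi>])
    fix u assume u: "u \<in> carrier F - {\<zero>}"
    define i j where "i = inv (\<guillemotleft>4\<guillemotright> \<otimes> (t \<otimes> u))" and "j = inv (\<guillemotleft>4\<guillemotright> \<otimes> u)"
    have nz: "t \<otimes> u \<noteq> \<zero>" using t u by (simp add: integral_iff)
    have ij: "i \<in> carrier F" "j \<in> carrier F" "\<guillemotleft>4\<guillemotright> \<otimes> (t \<otimes> u) \<otimes> i = \<one>" "\<guillemotleft>4\<guillemotright> \<otimes> u \<otimes> j = \<one>"
      using t u nz inv_4_closed of_int_4_nonzero by (auto simp: i_def j_def integral_iff)
    have "t \<otimes> i = t \<otimes> i \<otimes> (\<guillemotleft>4\<guillemotright> \<otimes> u \<otimes> j)" using ij t by simp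
    also have "\<dots> = j \<otimes> (\<guillemotleft>4\<guillemotright> \<otimes> (t \<otimes> u) \<otimes> i)" using ij(1,2) t u by (simp add: m_ac)
    finally have "t \<otimes> inv (\<guillemotleft>4\<guillemotright> \<otimes> (t \<otimes> u)) = inv (\<guillemotleft>4\<guillemotright> \<otimes> u)"
      using ij(2,3) by (simp add: i_def j_def)
    then show "t \<otimes> inv (\<guillemotleft>4\<guillemotright> \<otimes> (t \<otimes> u)) \<oplus> (t \<otimes> u) \<otimes> c = \<one> \<otimes> inv (\<guillemotleft>4\<guillemotright> \<otimes> u) \<oplus> u \<otimes> (t \<otimes> c)"
      using t u c inv_4_closed by (simp add: m_ac)
  qed
  finally show ?thesis .
qed

text \<open>Summing over t as well as c makes both parts of the phase orthogonal. What remains is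
  q^2 times the number of quadruples with equal sums and equal sums of reciprocals: at most 2 q^2
  generic ones, and q * q with vanishing sum.\<close>

lemma kloosterman_fourth_moment_all:
  "(\<Sum>t\<in>carrier F. \<Sum>c\<in>carrier F. cmod (kloosterman t c) ^ 4) \<le> 3 * q ^ 4"
proof -
  let ?C = "carrier F" and ?U = "carrier F - {\<zero>}"
  let ?P = "?U \<times> ?U"
  define \<alpha> where "\<alpha> p = inv (\<guillemotleft>4\<guillemotright> \<otimes> fst p) \<oplus> inv (\<guillemotleft>4\<guillemotright> \<otimes> snd p)" for p
  define \<beta> where "\<beta> p = fst p \<oplus> snd p" for p :: "'a \<times> 'a"
  have fP: "finite ?P" using finite_carrier by simp
  have ab: "\<alpha> p \<in> ?C" "\<beta> p \<in> ?C" if p: "p \<in> ?P" for p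
  proof -
    obtain u v where uv: "p = (u, v)" "u \<in> ?C" "u \<noteq> \<zero>" "v \<in> ?C" "v \<noteq> \<zero>" using p by blast
    show "\<alpha> p \<in> ?C" "\<beta> p \<in> ?C"
      unfolding \<alpha>_def \<beta>_def uv(1) fst_conv snd_conv by (intro a_closed inv_4_closed uv)+
  qed
  have sq: "kloosterman t c ^ 2 = (\<Sum>p\<in>?P. \<psi> (t \<otimes> \<alpha> p) * \<psi> (c \<otimes> \<beta> p))" if "t \<in> ?C" "c \<in> ?C" for t c
    unfolding monoid_mult_class.power2_eq_square kloosterman_def sum_product sum.cartesian_product \<alpha>_def \<beta>_def
  proof (intro sum.cong refl)
    fix p assume "p \<in> ?P"
    then obtain u v where p: "p = (u, v)" and uv: "u \<in> ?C" "u \<noteq> \<zero>" "v \<in> ?C" "v \<noteq> \<zero>" by blast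
    have i: "inv (\<guillemotleft>4\<guillemotright> \<otimes> u) \<in> ?C" "inv (\<guillemotleft>4\<guillemotright> \<otimes> v) \<in> ?C" using uv inv_4_closed by blast+
    have "c \<otimes> (u \<oplus> v) = u \<otimes> c \<oplus> v \<otimes> c"
      using uv that m_comm[of c u] m_comm[of c v] r_distr[of u v c] by simp
    then show "(case p of (u, v) \<Rightarrow> \<psi> (t \<otimes> inv (\<guillemotleft>4\<guillemotright> \<otimes> u) \<oplus> u \<otimes> c) * \<psi> (t \<otimes> inv (\<guillemotleft>4\<guillemotright> \<otimes> v) \<oplus> v \<otimes> c)) =
      \<psi> (t \<otimes> (inv (\<guillemotleft>4\<guillemotright> \<otimes> fst p) \<oplus> inv (\<guillemotleft>4\<guillemotright> \<otimes> snd p))) * \<psi> (c \<otimes> (fst p \<oplus> snd p))"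
      using i uv that unfolding p by (simp add: \<psi>_add r_distr)
  qed
  have "of_real (\<Sum>t\<in>?C. \<Sum>c\<in>?C. cmod (kloosterman t c) ^ 4) =
      (\<Sum>t\<in>?C. \<Sum>c\<in>?C. kloosterman t c ^ 2 * cnj (kloosterman t c ^ 2))"
  proof -
    have "complex_of_real (cmod z ^ 4) = z ^ 2 * cnj (z ^ 2)" for z
    proof -
      have "cmod z ^ 4 = (cmod (z ^ 2)) ^ 2" by (simp add: norm_mult monoid_mult_class.power2_eq_square power4_eq_xxxx)
      then show ?thesis by (simp only: complex_norm_square[of "z ^ 2"])
    qed
    then show ?thesis by (simp only: of_real_sum)
  qed
  also have "\<dots> = (\<Sum>t\<in>?C. \<Sum>c\<in>?C. \<Sum>p\<in>?P. \<Sum>p'\<in>?P. (\<psi> (t \<otimes> \<alpha> p) * \<psi> (c \<otimes> \<beta> p)) * cnj (\<psi> (t \<otimes> \<alpha> p') * \<psi> (c \<otimes> \<beta> p')))"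
    by (intro sum.cong refl) (simp only: sq cnj_sum sum_product)
  also have "\<dots> = (\<Sum>p\<in>?P. \<Sum>p'\<in>?P. \<Sum>t\<in>?C. \<Sum>c\<in>?C. (\<psi> (t \<otimes> \<alpha> p) * \<psi> (c \<otimes> \<beta> p)) * cnj (\<psi> (t \<otimes> \<alpha> p') * \<psi> (c \<otimes> \<beta> p')))"
    by (rule trans[OF sum.cong[OF refl sum_swap3] sum_swap3])
  also have "\<dots> = (\<Sum>p\<in>?P. \<Sum>p'\<in>?P. if \<alpha> p' = \<alpha> p \<and> \<beta> p' = \<beta> p then of_real (q ^ 2) else 0)"
  proof (intro sum.cong refl)
    fix p p' assume p: "p \<in> ?P" "p' \<in> ?P"
    have "(\<Sum>t\<in>?C. \<Sum>c\<in>?C. (\<psi> (t \<otimes> \<alpha> p) * \<psi> (c \<otimes> \<beta> p)) * cnj (\<psi> (t \<otimes> \<alpha> p') * \<psi> (c \<otimes> \<beta> p'))) =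
      (\<Sum>t\<in>?C. \<Sum>c\<in>?C. \<psi> (t \<otimes> (\<alpha> p \<ominus> \<alpha> p')) * \<psi> (c \<otimes> (\<beta> p \<ominus> \<beta> p')))"
      by (intro sum.cong refl)
         (use ab[OF p(1)] ab[OF p(2)] in \<open>simp add: minus_eq r_distr r_minus \<psi>_add \<psi>_minus\<close>)
    also have "\<dots> = (\<Sum>t\<in>?C. \<psi> (t \<otimes> (\<alpha> p \<ominus> \<alpha> p'))) * (\<Sum>c\<in>?C. \<psi> (c \<otimes> (\<beta> p \<ominus> \<beta> p')))"
      by (simp only: sum_product)
    finally show "(\<Sum>t\<in>?C. \<Sum>c\<in>?C. (\<psi> (t \<otimes> \<alpha> p) * \<psi> (c \<otimes> \<beta> p)) * cnj (\<psi> (t \<otimes> \<alpha> p') * \<psi> (c \<otimes> \<beta> p')))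
        = (if \<alpha> p' = \<alpha> p \<and> \<beta> p' = \<beta> p then of_real (q ^ 2) else 0)"
      using sum_\<psi>[of "\<alpha> p \<ominus> \<alpha> p'"] sum_\<psi>[of "\<beta> p \<ominus> \<beta> p'"] ab[OF p(1)] ab[OF p(2)]
      by (cases "\<alpha> p = \<alpha> p'"; cases "\<beta> p = \<beta> p'") (auto simp: eq_diff0 monoid_mult_class.power2_eq_square)
  qed
  also have "\<dots> = of_real (\<Sum>p\<in>?P. q ^ 2 * card {p' \<in> ?P. \<alpha> p' = \<alpha> p \<and> \<beta> p' = \<beta> p})"
    unfolding sum_if_const[OF fP] by simp
  finally have eq: "(\<Sum>t\<in>?C. \<Sum>c\<in>?C. cmod (kloosterman t c) ^ 4) = (\<Sum>p\<in>?P. q ^ 2 * card {p' \<in> ?P. \<alpha> p' = \<alpha> p \<and> \<beta> p' = \<beta> p})"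
    by (simp only: of_real_eq_iff)
  have "(\<Sum>p\<in>?P. q ^ 2 * card {p' \<in> ?P. \<alpha> p' = \<alpha> p \<and> \<beta> p' = \<beta> p}) \<le> (\<Sum>p\<in>?P. q ^ 2 * (2 + (if \<beta> p = \<zero> then q else 0)))"
  proof (intro sum_mono mult_left_mono)
    fix p assume p: "p \<in> ?P"
    have E: "{p' \<in> ?P. \<alpha> p' = \<alpha> p \<and> \<beta> p' = \<beta> p} = {(u', v'). u' \<in> carrier F - {\<zero>} \<and> v' \<in> carrier F - {\<zero>} \<and>
      inv (\<guillemotleft>4\<guillemotright> \<otimes> u') \<oplus> inv (\<guillemotleft>4\<guillemotright> \<otimes> v') = inv (\<guillemotleft>4\<guillemotright> \<otimes> fst p) \<oplus> inv (\<guillemotleft>4\<guillemotright> \<otimes> snd p) \<and>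
      u' \<oplus> v' = fst p \<oplus> snd p}" by (auto simp: \<alpha>_def \<beta>_def)
    have "card {p' \<in> ?P. \<alpha> p' = \<alpha> p \<and> \<beta> p' = \<beta> p} \<le> (if fst p \<oplus> snd p = \<zero> then order F else 2)"
      unfolding E using p by (intro card_inverse_quadruples) (simp_all add: mem_Times_iff)
    then have "card {p' \<in> ?P. \<alpha> p' = \<alpha> p \<and> \<beta> p' = \<beta> p} \<le> (if \<beta> p = \<zero> then order F else 2)"
      by (simp only: \<beta>_def)
    also have "\<dots> \<le> 2 + (if \<beta> p = \<zero> then order F else 0)" by simp
    finally have "real (card {p' \<in> ?P. \<alpha> p' = \<alpha> p \<and> \<beta> p' = \<beta> p}) \<le> real (2 + (if \<beta> p = \<zero> then order F else 0))"
      by (rule of_nat_mono)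
    then show "real (card {p' \<in> ?P. \<alpha> p' = \<alpha> p \<and> \<beta> p' = \<beta> p}) \<le> 2 + (if \<beta> p = \<zero> then q else 0)"
      by (simp split: if_splits)
  qed simp
  also have "\<dots> = q ^ 2 * (2 * card ?P + q * card {p \<in> ?P. \<beta> p = \<zero>})"
    unfolding sum_distrib_left[symmetric] sum.distrib sum_if_const[OF fP] by simp
  also have "\<dots> \<le> q ^ 2 * (2 * q ^ 2 + q * q)"
  proof -
    have "card ?U \<le> order F" unfolding Coset.order_def using finite_carrier by (intro card_mono) auto
    then have "card ?P \<le> order F * order F" unfolding card_cartesian_product by (intro mult_mono) auto
    then have "real (card ?P) \<le> real (order F * order F)" by (rule of_nat_mono)
    then have 1: "real (card ?P) \<le> q\<^sup>2" by (simp only: monoid_mult_class.power2_eq_square semiring_1_class.of_nat_mult)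
    have "{p \<in> ?P. \<beta> p = \<zero>} \<subseteq> (\<lambda>u. (u, \<ominus> u)) ` ?C"
    proof
      fix p assume "p \<in> {p \<in> ?P. \<beta> p = \<zero>}"
      then obtain u v where "p = (u, v)" "u \<in> ?C" "v \<in> ?C" "u \<oplus> v = \<zero>" by (auto simp: \<beta>_def)
      then have "v = \<ominus> u" by (simp add: eq_neg_iff_add_eq_0 a_comm)
      then show "p \<in> (\<lambda>u. (u, \<ominus> u)) ` ?C" using \<open>p = (u, v)\<close> \<open>u \<in> ?C\<close> by blast
    qed
    then have "card {p \<in> ?P. \<beta> p = \<zero>} \<le> card ((\<lambda>u. (u, \<ominus> u)) ` ?C)"
      using finite_carrier by (intro card_mono) auto
    also have "\<dots> \<le> order F" unfolding Coset.order_def by (rule card_image_le[OF finite_carrier])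
    finally have 2: "real (card {p \<in> ?P. \<beta> p = \<zero>}) \<le> q" by simp
    have "2 * real (card ?P) + q * real (card {p \<in> ?P. \<beta> p = \<zero>}) \<le> 2 * q\<^sup>2 + q * q"
      using 1 2 q_gt_0 by (intro add_mono mult_left_mono) auto
    then show ?thesis by (intro mult_left_mono) simp_all
  qed
  also have "\<dots> = 3 * q ^ 4" by (simp add: monoid_mult_class.power2_eq_square power4_eq_xxxx)
  finally show ?thesis unfolding eq .
qed

text \<open>All q - 1 nonzero t share one fourth moment, which is thus at most 3 q^4 / (q - 1), and
  q - 1 \<ge> q / 2.\<close>

lemma kloosterman_fourth_moment:
  assumes t: "t \<in> carrier F" "t \<noteq> \<zero>"
  shows "(\<Sum>c\<in>carrier F. cmod (kloosterman t c) ^ 4) \<le> 6 * q ^ 3"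
proof -
  let ?C = "carrier F" and ?U = "carrier F - {\<zero>}"
  define S where "S = (\<Sum>c\<in>?C. cmod (kloosterman \<one> c) ^ 4)"
  have S: "(\<Sum>c\<in>?C. cmod (kloosterman s c) ^ 4) = S" if "s \<in> ?U" for s
  proof -
    have "(\<Sum>c\<in>?C. cmod (kloosterman s c) ^ 4) = (\<Sum>c\<in>?C. cmod (kloosterman \<one> (s \<otimes> c)) ^ 4)"
      using that by (intro sum.cong refl) (simp add: kloosterman_scale[of s])
    also have "\<dots> = S" unfolding S_def using that by (intro sum_scale(2)[of s "\<lambda>c. cmod (kloosterman \<one> c) ^ 4"]) auto
    finally show ?thesis .
  qed
  have S0: "S \<ge> 0" unfolding S_def by (intro sum_nonneg) auto
  have "card ?U = order F - 1" using finite_carrier by (simp add: Coset.order_def card_Diff_singleton)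
  then have cU: "real (card ?U) = q - 1" using order_gt_1 by simp
  have "(q - 1) * S = (\<Sum>s\<in>?U. \<Sum>c\<in>?C. cmod (kloosterman s c) ^ 4)" using S cU by simp
  also have "\<dots> \<le> (\<Sum>s\<in>?C. \<Sum>c\<in>?C. cmod (kloosterman s c) ^ 4)"
    by (intro sum_mono2[OF finite_carrier]) (auto intro!: sum_nonneg)
  also have "\<dots> \<le> 3 * q ^ 4" by (rule kloosterman_fourth_moment_all)
  finally have *: "(q - 1) * S \<le> 3 * q ^ 4" .
  have "q / 2 * S \<le> (q - 1) * S" using order_gt_1 S0 by (intro mult_right_mono) auto
  then have "q * S \<le> q * (6 * q ^ 3)" using * by (simp add: power4_eq_xxxx power3_eq_cube)
  then have "S \<le> 6 * q ^ 3" using q_gt_0 by (simp only: mult_le_cancel_left_pos)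
  then show ?thesis using S[of t] t by simp
qed

end

section \<open>Interpolation by dyadic levels\<close>

lemma sum_powr_int_interval:
  fixes r :: real
  assumes "1 < r" "a \<le> n"
  shows "(\<Sum>j\<in>{a..<n}. r powr real_of_int j) = (r powr n - r powr a) / (r - 1)"
  using assms(2)
proof (induction n rule: int_ge_induct)
  case (step n)
  have "{a..<n + 1} = insert n {a..<n}" using step(1) by auto
  then have "(\<Sum>j\<in>{a..<n + 1}. r powr real_of_int j) = r powr n + (r powr n - r powr a) / (r - 1)"
    using step by simp
  also have "\<dots> = (r powr (n + 1) - r powr a) / (r - 1)"
    using assms(1) by (simp add: powr_add field_simps)
  finally show ?case by simp
qed simp

text \<open>The bound is uniform in J: an increasing geometric series is dominated by its top,
  however far down the levels reach.\<close>

lemma sum_powr_int_less: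
  fixes r :: real
  assumes "1 < r" "finite J"
  shows "(\<Sum>j\<in>{j\<in>J. j < n}. r powr real_of_int j) \<le> r powr n / (r - 1)"
proof (cases "{j\<in>J. j < n} = {}")
  case False
  define a where "a = Min {j\<in>J. j < n}"
  have fin: "finite {j\<in>J. j < n}" using assms by simp
  have an: "a \<in> {j\<in>J. j < n}" unfolding a_def using fin False by (rule Min_in)
  have "{j\<in>J. j < n} \<subseteq> {a..<n}" using fin by (auto simp: a_def)
  then have "(\<Sum>j\<in>{j\<in>J. j < n}. r powr real_of_int j) \<le> (\<Sum>j\<in>{a..<n}. r powr real_of_int j)"
    by (intro sum_mono2) auto
  also have "\<dots> \<le> r powr n / (r - 1)"
    using assms(1) an by (subst sum_powr_int_interval) (auto intro!: divide_right_mono)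
  finally show ?thesis .
next
  case True
  then show ?thesis using assms(1) by (simp only: True) simp
qed

lemma sum_mult_product:
  fixes c :: "'b :: comm_semiring_0"
  shows "(\<Sum>x\<in>A. \<Sum>y\<in>B. c * (f x * g y)) = c * ((\<Sum>x\<in>A. f x) * (\<Sum>y\<in>B. g y))"
  unfolding sum_product by (simp add: sum_distrib_left)

lemma sum_restrict_if:
  fixes h :: "'x \<Rightarrow> 'b :: comm_monoid_add"
  assumes "finite V" "A \<subseteq> V"
  shows "(\<Sum>x\<in>V. if x \<in> A then h x else 0) = (\<Sum>x\<in>A. h x)"
  using sum.inter_restrict[OF assms(1), of h A] assms(2) by (simp add: Int_absorb1)

definition dyadic_level :: "('x \<Rightarrow> real) \<Rightarrow> 'x \<Rightarrow> int" where
  "dyadic_level f x = \<lfloor>log 2 (f x)\<rfloor>"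

lemma dyadic_level_bounds:
  assumes "0 < f x"
  shows "2 powr real_of_int (dyadic_level f x) \<le> f x" "f x < 2 powr (real_of_int (dyadic_level f x) + 1)"
proof -
  have eq: "2 powr log 2 (f x) = f x" using assms by simp
  show "2 powr real_of_int (dyadic_level f x) \<le> f x"
    unfolding dyadic_level_def by (subst (2) eq[symmetric], rule powr_mono) auto
  show "f x < 2 powr (real_of_int (dyadic_level f x) + 1)"
    unfolding dyadic_level_def by (subst eq[symmetric], rule powr_less_mono) auto
qed

lemma sum_dyadic_group:
  fixes h :: "'x \<Rightarrow> 'b :: comm_monoid_add"
  assumes "finite X"
  shows "(\<Sum>i\<in>dyadic_level f ` X. \<Sum>x\<in>{x\<in>X. dyadic_level f x = i}. h x) = (\<Sum>x\<in>X. h x)"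
  by (rule sum.image_gen[OF assms, symmetric])

definition block :: "'x set \<Rightarrow> ('x \<Rightarrow> real) \<Rightarrow> 'y set \<Rightarrow> ('y \<Rightarrow> real) \<Rightarrow> ('x \<Rightarrow> 'y \<Rightarrow> complex) \<Rightarrow> int \<Rightarrow> int \<Rightarrow> complex" where
  "block X f Y g k i j = (\<Sum>x\<in>{x\<in>X. dyadic_level f x = i}. \<Sum>y\<in>{y\<in>Y. dyadic_level g y = j}. of_real (f x * g y) * k x y)"

text \<open>Pairs with \<open>f x * g y \<ge> 2 ^ m\<close> are estimated by the supremum of the kernel; for the
  others the blocks remain.\<close>

lemma dyadic_split:
  fixes f :: "'x \<Rightarrow> real" and g :: "'y \<Rightarrow> real" and k :: "'x \<Rightarrow> 'y \<Rightarrow> complex" and m :: int and p :: real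
  assumes fin: "finite X" "finite Y" and f: "\<And>x. x \<in> X \<Longrightarrow> 0 < f x" and g: "\<And>y. y \<in> Y \<Longrightarrow> 0 < g y"
    and F: "(\<Sum>x\<in>X. f x powr p) \<le> 1" and G: "(\<Sum>y\<in>Y. g y powr p) \<le> 1" and p: "1 \<le> p"
    and k: "\<And>x y. x \<in> X \<Longrightarrow> y \<in> Y \<Longrightarrow> cmod (k x y) \<le> B" and B: "0 \<le> B"
  shows "cmod (\<Sum>x\<in>X. \<Sum>y\<in>Y. of_real (f x * g y) * k x y) \<le> B * 2 powr (m * (1 - p)) +
    (\<Sum>i\<in>dyadic_level f ` X. \<Sum>j\<in>dyadic_level g ` Y. if i + j < m then cmod (block X f Y g k i j) else 0)"
proof -
  let ?I = "dyadic_level f ` X" and ?J = "dyadic_level g ` Y"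
  define Xi where "Xi i = {x\<in>X. dyadic_level f x = i}" for i
  define Yj where "Yj j = {y\<in>Y. dyadic_level g y = j}" for j
  define Fi where "Fi i = (\<Sum>x\<in>Xi i. f x powr p)" for i
  define Gj where "Gj j = (\<Sum>y\<in>Yj j. g y powr p)" for j
  have "(\<Sum>x\<in>X. \<Sum>y\<in>Y. of_real (f x * g y) * k x y) = (\<Sum>i\<in>?I. \<Sum>x\<in>Xi i. \<Sum>j\<in>?J. \<Sum>y\<in>Yj j. of_real (f x * g y) * k x y)"
    unfolding Xi_def Yj_def sum_dyadic_group[OF fin(1)] sum_dyadic_group[OF fin(2)] ..
  also have "\<dots> = (\<Sum>i\<in>?I. \<Sum>j\<in>?J. block X f Y g k i j)"
    unfolding block_def Xi_def Yj_def by (intro sum.cong refl sum.swap)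
  finally have "cmod (\<Sum>x\<in>X. \<Sum>y\<in>Y. of_real (f x * g y) * k x y) \<le> (\<Sum>i\<in>?I. \<Sum>j\<in>?J. cmod (block X f Y g k i j))"
    by (simp only:) (intro order_trans[OF norm_sum] sum_mono norm_sum)
  also have "\<dots> \<le> (\<Sum>i\<in>?I. \<Sum>j\<in>?J. B * 2 powr (m * (1 - p)) * (Fi i * Gj j) +
      (if i + j < m then cmod (block X f Y g k i j) else 0))"
  proof (intro sum_mono)
    fix i j
    have nonneg: "0 \<le> B * 2 powr (m * (1 - p)) * (Fi i * Gj j)"
      using B unfolding Fi_def Gj_def by (intro mult_nonneg_nonneg sum_nonneg) auto
    show "cmod (block X f Y g k i j) \<le> B * 2 powr (m * (1 - p)) * (Fi i * Gj j) +
      (if i + j < m then cmod (block X f Y g k i j) else 0)"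
    proof (cases "i + j < m")
      case False
      have *: "cmod (of_real (f x * g y) * k x y) \<le> B * 2 powr (m * (1 - p)) * (f x powr p * g y powr p)"
        if x: "x \<in> Xi i" and y: "y \<in> Yj j" for x y
      proof -
        have fg: "f x > 0" "g y > 0" using f g x y by (auto simp: Xi_def Yj_def)
        have "2 powr real_of_int m \<le> 2 powr real_of_int (i + j)" using False by (intro powr_mono) auto
        also have "\<dots> = 2 powr real_of_int i * 2 powr real_of_int j" by (simp add: powr_add)
        also have "\<dots> \<le> f x * g y"
          using dyadic_level_bounds(1)[of f x] dyadic_level_bounds(1)[of g y] fg x y
          by (intro mult_mono) (auto simp: Xi_def Yj_def)
        finally have "2 powr real_of_int m \<le> f x * g y" .
        then have "(f x * g y) powr (1 - p) \<le> (2 powr real_of_int m) powr (1 - p)"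
          using p by (intro powr_mono2') auto
        then have le: "(f x * g y) powr (1 - p) \<le> 2 powr (m * (1 - p))" by (simp add: powr_powr)
        \<comment> \<open>Since f x * g y \<ge> 2^m and 1 - p \<le> 0, trading the first power for
          the p-th power gains the factor 2^(m (1 - p)).\<close>
        have "f x * g y = (f x * g y) powr (1 - p) * (f x * g y) powr p"
          using fg by (simp add: powr_add[symmetric])
        also have "\<dots> \<le> 2 powr (m * (1 - p)) * (f x powr p * g y powr p)"
          using le fg by (simp add: powr_mult mult_right_mono)
        finally have "f x * g y \<le> 2 powr (m * (1 - p)) * (f x powr p * g y powr p)" .
        moreover have "cmod (of_real (f x * g y) * k x y) = (f x * g y) * cmod (k x y)"
          using fg by (simp add: norm_mult)
        ultimately have "cmod (of_real (f x * g y) * k x y) \<le> (2 powr (m * (1 - p)) * (f x powr p * g y powr p)) * B"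
          using k[of x y] x y fg by (auto simp: Xi_def Yj_def intro!: mult_mono)
        then show ?thesis by (simp add: mult_ac)
      qed
      have "cmod (block X f Y g k i j) \<le> (\<Sum>x\<in>Xi i. \<Sum>y\<in>Yj j. B * 2 powr (m * (1 - p)) * (f x powr p * g y powr p))"
        unfolding block_def Xi_def[symmetric] Yj_def[symmetric]
        by (intro order_trans[OF norm_sum] sum_mono *)
      also have "\<dots> = B * 2 powr (m * (1 - p)) * (Fi i * Gj j)"
        by (simp only: Fi_def Gj_def sum_mult_product)
      finally show ?thesis using False by simp
    qed (use nonneg in simp)
  qed
  also have "\<dots> = B * 2 powr (m * (1 - p)) * ((\<Sum>i\<in>?I. Fi i) * (\<Sum>j\<in>?J. Gj j)) +
      (\<Sum>i\<in>?I. \<Sum>j\<in>?J. if i + j < m then cmod (block X f Y g k i j) else 0)"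
    by (simp only: sum.distrib sum_mult_product)
  also have "(\<Sum>i\<in>?I. Fi i) * (\<Sum>j\<in>?J. Gj j) \<le> 1 * 1"
    unfolding Fi_def Gj_def Xi_def Yj_def sum_dyadic_group[OF fin(1)] sum_dyadic_group[OF fin(2)]
    using F G by (intro mult_mono) (auto intro!: sum_nonneg)
  finally show ?thesis using B by (simp add: mult_left_mono)
qed

lemma dyadic_powr_sum_le:
  fixes f :: "'x \<Rightarrow> real" and p s :: real
  assumes f: "\<And>x. x \<in> X \<Longrightarrow> 0 < f x" and ps: "p \<le> s"
  shows "(\<Sum>x\<in>{x\<in>X. dyadic_level f x = i}. f x powr s) \<le>
    2 powr ((real_of_int i + 1) * (s - p)) * (\<Sum>x\<in>{x\<in>X. dyadic_level f x = i}. f x powr p)"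
  unfolding sum_distrib_left
proof (intro sum_mono)
  fix x assume x: "x \<in> {x\<in>X. dyadic_level f x = i}"
  then have "f x \<le> 2 powr (real_of_int i + 1)" "0 < f x" using dyadic_level_bounds(2)[of f x] f[of x] by auto
  then have "f x powr (s - p) \<le> (2 powr (real_of_int i + 1)) powr (s - p)"
    using ps by (intro powr_mono2) auto
  then have "f x powr (s - p) \<le> 2 powr ((real_of_int i + 1) * (s - p))" by (simp add: powr_powr)
  then have "f x powr (s - p) * f x powr p \<le> 2 powr ((real_of_int i + 1) * (s - p)) * f x powr p"
    by (rule mult_right_mono) simp
  then show "f x powr s \<le> 2 powr ((real_of_int i + 1) * (s - p)) * f x powr p"
    by (simp add: powr_add[symmetric])
qed

lemma sqrt_mult_le_average: "0 \<le> a \<Longrightarrow> 0 \<le> b \<Longrightarrow> sqrt a * sqrt b \<le> (a + b) / 2"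
  for a b :: real
  using arith_geo_mean_sqrt[of a b] by (simp add: real_sqrt_mult)

text \<open>On level i the l2 norm is at most r^(i+1) times the square root of the l^p mass of that
  level. Bounding the product of two square roots by the mean decouples the levels: against one mass
  the other index runs over a geometric series that stops where i + j reaches m, and the masses add
  up to at most 1.\<close>

lemma dyadic_L2_blocks:
  fixes f :: "'x \<Rightarrow> real" and g :: "'y \<Rightarrow> real" and m :: int and p :: real
  assumes fin: "finite X" "finite Y" and f: "\<And>x. x \<in> X \<Longrightarrow> 0 < f x" and g: "\<And>y. y \<in> Y \<Longrightarrow> 0 < g y"
    and F: "(\<Sum>x\<in>X. f x powr p) \<le> 1" and G: "(\<Sum>y\<in>Y. g y powr p) \<le> 1" and p: "p < 2"
  defines "r \<equiv> 2 powr ((2 - p) / 2)"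
  shows "(\<Sum>i\<in>dyadic_level f ` X. \<Sum>j\<in>dyadic_level g ` Y. if i + j < m then
      sqrt (\<Sum>x\<in>{x\<in>X. dyadic_level f x = i}. (f x)\<^sup>2) * sqrt (\<Sum>y\<in>{y\<in>Y. dyadic_level g y = j}. (g y)\<^sup>2) else 0)
    \<le> r\<^sup>2 / (r - 1) * r powr m"
proof -
  let ?I = "dyadic_level f ` X" and ?J = "dyadic_level g ` Y"
  define Fi where "Fi i = (\<Sum>x\<in>{x\<in>X. dyadic_level f x = i}. f x powr p)" for i
  define Gj where "Gj j = (\<Sum>y\<in>{y\<in>Y. dyadic_level g y = j}. g y powr p)" for j
  have nn: "0 \<le> Fi i" "0 \<le> Gj i" for i by (auto simp: Fi_def Gj_def intro: sum_nonneg)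
  have r1: "1 < r" unfolding r_def using p by simp
  have sF: "(\<Sum>i\<in>?I. Fi i) \<le> 1" "(\<Sum>j\<in>?J. Gj j) \<le> 1"
    unfolding Fi_def Gj_def sum_dyadic_group[OF fin(1)] sum_dyadic_group[OF fin(2)] by (fact F G)+
  have rr: "sqrt (2 powr ((real_of_int i + 1) * (2 - p))) = r * r powr i" for i :: int
  proof -
    have "sqrt (2 powr ((real_of_int i + 1) * (2 - p))) = 2 powr ((real_of_int i + 1) * (2 - p) / 2)"
      by (simp add: powr_half_sqrt[symmetric] powr_powr)
    also have "\<dots> = r powr (real_of_int i + 1)" unfolding r_def powr_powr by (simp add: mult.commute)
    finally show ?thesis using r1 by (simp add: powr_add mult.commute)
  qed
  have L2: "sqrt (\<Sum>x\<in>{x\<in>Z. dyadic_level h x = i}. (h x)\<^sup>2) \<le> r * r powr i * sqrt (\<Sum>x\<in>{x\<in>Z. dyadic_level h x = i}. h x powr p)"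
    if "\<And>z. z \<in> Z \<Longrightarrow> 0 < h z" for Z :: "'z set" and h i
  proof -
    have "(\<Sum>x\<in>{x\<in>Z. dyadic_level h x = i}. (h x)\<^sup>2) = (\<Sum>x\<in>{x\<in>Z. dyadic_level h x = i}. h x powr 2)"
      using that by (intro sum.cong) (auto simp: less_imp_le)
    also have "\<dots> \<le> 2 powr ((real_of_int i + 1) * (2 - p)) * (\<Sum>x\<in>{x\<in>Z. dyadic_level h x = i}. h x powr p)"
      using p that by (intro dyadic_powr_sum_le) auto
    finally have "sqrt (\<Sum>x\<in>{x\<in>Z. dyadic_level h x = i}. (h x)\<^sup>2) \<le>
        sqrt (2 powr ((real_of_int i + 1) * (2 - p)) * (\<Sum>x\<in>{x\<in>Z. dyadic_level h x = i}. h x powr p))"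
      by (rule real_sqrt_le_mono)
    then show ?thesis unfolding real_sqrt_mult rr .
  qed
  have "(\<Sum>i\<in>?I. \<Sum>j\<in>?J. if i + j < m then
      sqrt (\<Sum>x\<in>{x\<in>X. dyadic_level f x = i}. (f x)\<^sup>2) * sqrt (\<Sum>y\<in>{y\<in>Y. dyadic_level g y = j}. (g y)\<^sup>2) else 0)
    \<le> (\<Sum>i\<in>?I. \<Sum>j\<in>?J. if i + j < m then r\<^sup>2 * r powr (i + j) * ((Fi i + Gj j) / 2) else 0)"
  proof (intro sum_mono)
    fix i j
    have "sqrt (\<Sum>x\<in>{x\<in>X. dyadic_level f x = i}. (f x)\<^sup>2) * sqrt (\<Sum>y\<in>{y\<in>Y. dyadic_level g y = j}. (g y)\<^sup>2)
      \<le> (r * r powr i * sqrt (Fi i)) * (r * r powr j * sqrt (Gj j))"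
      unfolding Fi_def Gj_def using r1 f g
      by (intro mult_mono L2 mult_nonneg_nonneg) (auto intro!: sum_nonneg)
    also have "\<dots> = r\<^sup>2 * r powr (i + j) * (sqrt (Fi i) * sqrt (Gj j))"
      using r1 by (simp add: powr_add power2_eq_square)
    also have "\<dots> \<le> r\<^sup>2 * r powr (i + j) * ((Fi i + Gj j) / 2)"
      by (intro mult_left_mono sqrt_mult_le_average nn) auto
    finally show "(if i + j < m then
      sqrt (\<Sum>x\<in>{x\<in>X. dyadic_level f x = i}. (f x)\<^sup>2) * sqrt (\<Sum>y\<in>{y\<in>Y. dyadic_level g y = j}. (g y)\<^sup>2) else 0)
      \<le> (if i + j < m then r\<^sup>2 * r powr (i + j) * ((Fi i + Gj j) / 2) else 0)" by simp
  qed
  also have "\<dots> = r\<^sup>2 / 2 * ((\<Sum>i\<in>?I. \<Sum>j\<in>?J. if i + j < m then r powr (i + j) * Fi i else 0) +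
      (\<Sum>i\<in>?I. \<Sum>j\<in>?J. if i + j < m then r powr (i + j) * Gj j else 0))"
    unfolding sum.distrib[symmetric] sum_distrib_left
    by (intro sum.cong refl) (simp add: algebra_simps)
  also have "(\<Sum>i\<in>?I. \<Sum>j\<in>?J. if i + j < m then r powr (i + j) * Gj j else 0) =
      (\<Sum>j\<in>?J. \<Sum>i\<in>?I. if j + i < m then r powr (j + i) * Gj j else 0)"
    by (subst sum.swap) (simp only: add.commute)
  also have "r\<^sup>2 / 2 * ((\<Sum>i\<in>?I. \<Sum>j\<in>?J. if i + j < m then r powr (i + j) * Fi i else 0) +
      (\<Sum>j\<in>?J. \<Sum>i\<in>?I. if j + i < m then r powr (j + i) * Gj j else 0))
    \<le> r\<^sup>2 / 2 * (r powr m / (r - 1) + r powr m / (r - 1))"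
  proof -
    have *: "(\<Sum>i\<in>I. \<Sum>j\<in>J. if i + j < m then r powr (i + j) * H i else 0) \<le> r powr m / (r - 1)"
      if fin: "finite I" "finite J" and H: "\<And>i. 0 \<le> H i" "(\<Sum>i\<in>I. H i) \<le> 1" for I J :: "int set" and H
    proof -
      have "(\<Sum>i\<in>I. \<Sum>j\<in>J. if i + j < m then r powr (i + j) * H i else 0) =
        (\<Sum>i\<in>I. H i * r powr i * (\<Sum>j\<in>{j\<in>J. j < m - i}. r powr j))"
        unfolding sum.inter_filter[OF fin(2)] sum_distrib_left
        using r1 by (intro sum.cong refl) (auto simp: powr_add)
      also have "\<dots> \<le> (\<Sum>i\<in>I. H i * r powr i * (r powr (m - i) / (r - 1)))"
        using H r1 fin by (intro sum_mono mult_left_mono order_trans[OF sum_powr_int_less]) auto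
      also have "\<dots> = (\<Sum>i\<in>I. H i) * (r powr m / (r - 1))"
        unfolding sum_distrib_right using r1 by (intro sum.cong refl) (simp add: powr_diff)
      also have "\<dots> \<le> 1 * (r powr m / (r - 1))" using H r1 by (intro mult_right_mono) auto
      finally show ?thesis by simp
    qed
    show ?thesis using nn sF fin by (intro mult_left_mono add_mono *) auto
  qed
  also have "\<dots> = r\<^sup>2 / (r - 1) * r powr m" by simp
  finally show ?thesis .
qed

text \<open>Homogeneity. If one of the norms vanishes, so does the function, and the right side is
  harmless because C \<ge> 0 follows by inserting zero functions.\<close>

lemma bilinear_scale:
  fixes k :: "'x \<Rightarrow> 'y \<Rightarrow> complex"
  assumes fin: "finite V" "finite W" and p: "0 < p"
    and unit: "\<And>f g. \<lbrakk>\<And>x. x \<in> V \<Longrightarrow> 0 \<le> f x; \<And>y. y \<in> W \<Longrightarrow> 0 \<le> g y;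
      (\<Sum>x\<in>V. f x powr p) \<le> 1; (\<Sum>y\<in>W. g y powr p) \<le> 1\<rbrakk>
      \<Longrightarrow> cmod (\<Sum>x\<in>V. \<Sum>y\<in>W. of_real (f x * g y) * k x y) \<le> C"
    and f: "\<And>x. x \<in> V \<Longrightarrow> 0 \<le> f x" and g: "\<And>y. y \<in> W \<Longrightarrow> 0 \<le> g y"
  shows "cmod (\<Sum>x\<in>V. \<Sum>y\<in>W. of_real (f x * g y) * k x y) \<le>
    C * (\<Sum>x\<in>V. f x powr p) powr (1 / p) * (\<Sum>y\<in>W. g y powr p) powr (1 / p)"
proof -
  define A where "A = (\<Sum>x\<in>V. f x powr p) powr (1 / p)"
  define B where "B = (\<Sum>y\<in>W. g y powr p) powr (1 / p)"
  have zero: "\<forall>z\<in>Z. h z = 0" if "(\<Sum>z\<in>Z. h z powr p) powr (1 / p) = 0" "finite Z" for Z :: "'z set" and h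
  proof -
    have "(\<Sum>z\<in>Z. h z powr p) = 0" using that by simp
    then have "\<forall>z\<in>Z. h z powr p = 0" using that by (subst (asm) sum_nonneg_eq_0_iff) auto
    then show ?thesis by simp
  qed
  have unit': "(\<Sum>z\<in>Z. (h z / D) powr p) \<le> 1"
    if "D = (\<Sum>z\<in>Z. h z powr p) powr (1 / p)" "0 < D" "\<And>z. z \<in> Z \<Longrightarrow> 0 \<le> h z" for Z :: "'z set" and h D
  proof -
    have "(\<Sum>z\<in>Z. (h z / D) powr p) = (\<Sum>z\<in>Z. h z powr p) / D powr p"
      unfolding sum_divide_distrib using that by (intro sum.cong refl) (simp add: powr_divide)
    also have "D powr p = (\<Sum>z\<in>Z. h z powr p)"
      unfolding that(1) powr_powr using p by (simp add: sum_nonneg)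
    finally show ?thesis by (simp add: divide_le_eq_1)
  qed
  show ?thesis
  proof (cases "A = 0 \<or> B = 0")
    case True
    then have "(\<Sum>x\<in>V. \<Sum>y\<in>W. of_real (f x * g y) * k x y) = 0"
      using zero[of f V] zero[of g W] fin by (auto simp: A_def B_def)
    moreover have "0 \<le> C" using unit[of "\<lambda>_. 0" "\<lambda>_. 0"] by simp
    ultimately show ?thesis by simp
  next
    case False
    then have AB: "A > 0" "B > 0" by (auto simp: A_def B_def order.strict_iff_order)
    have "cmod (\<Sum>x\<in>V. \<Sum>y\<in>W. of_real ((f x / A) * (g y / B)) * k x y) \<le> C"
      using AB f g by (intro unit unit'[OF A_def] unit'[OF B_def]) auto
    moreover have "(\<Sum>x\<in>V. \<Sum>y\<in>W. of_real ((f x / A) * (g y / B)) * k x y) =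
        (\<Sum>x\<in>V. \<Sum>y\<in>W. of_real (f x * g y) * k x y) / of_real (A * B)"
      unfolding sum_divide_distrib by (intro sum.cong refl) simp
    ultimately have "cmod (\<Sum>x\<in>V. \<Sum>y\<in>W. of_real (f x * g y) * k x y) / (A * B) \<le> C"
      using AB by (simp add: norm_divide norm_mult)
    then show ?thesis using AB by (simp add: field_simps A_def[symmetric] B_def[symmetric])
  qed
qed

text \<open>With r = 2^((2-p)/2): the 1 comes from the pairs above the threshold, r^2 / (r - 1) from
  the blocks below it, and one further r from rounding the threshold up to an integer.\<close>

definition interp_const :: "real \<Rightarrow> real" where
  "interp_const p = 1 + (2 powr ((2 - p) / 2)) ^ 3 / (2 powr ((2 - p) / 2) - 1)"

text \<open>Up to the constant this is Riesz-Thorin between l1 x l1 with bound B and l2 x l2 with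
  bound \<Lambda>. The two bounds are used on opposite sides of a threshold for f x * g y.\<close>

lemma bilinear_interpolation:
  fixes k :: "'x \<Rightarrow> 'y \<Rightarrow> complex"
  assumes fin: "finite V" "finite W" and p: "1 < p" "p < 2" and pos: "0 < B" "0 < \<Lambda>"
    and k: "\<And>x y. x \<in> V \<Longrightarrow> y \<in> W \<Longrightarrow> cmod (k x y) \<le> B"
    and L2: "\<And>f g :: _ \<Rightarrow> real. cmod (\<Sum>x\<in>V. \<Sum>y\<in>W. of_real (f x * g y) * k x y) \<le>
        \<Lambda> * (sqrt (\<Sum>x\<in>V. (f x)\<^sup>2) * sqrt (\<Sum>y\<in>W. (g y)\<^sup>2))"
    and f: "\<And>x. x \<in> V \<Longrightarrow> 0 \<le> f x" and g: "\<And>y. y \<in> W \<Longrightarrow> 0 \<le> g y"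
  shows "cmod (\<Sum>x\<in>V. \<Sum>y\<in>W. of_real (f x * g y) * k x y) \<le>
    interp_const p * B powr (2 / p - 1) * \<Lambda> powr (2 - 2 / p) *
      (\<Sum>x\<in>V. f x powr p) powr (1 / p) * (\<Sum>y\<in>W. g y powr p) powr (1 / p)"
proof (rule bilinear_scale[OF fin])
  show "0 < p" using p by simp
  fix f :: "'x \<Rightarrow> real" and g :: "'y \<Rightarrow> real"
  assume f: "\<And>x. x \<in> V \<Longrightarrow> 0 \<le> f x" and g: "\<And>y. y \<in> W \<Longrightarrow> 0 \<le> g y"
    and F: "(\<Sum>x\<in>V. f x powr p) \<le> 1" and G: "(\<Sum>y\<in>W. g y powr p) \<le> 1"
  define r where "r = 2 powr ((2 - p) / 2)"
  have r1: "1 < r" unfolding r_def using p by simp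
  define X where "X = {x\<in>V. 0 < f x}"
  define Y where "Y = {y\<in>W. 0 < g y}"
  have finXY: "finite X" "finite Y" using fin by (auto simp: X_def Y_def)
  \<comment> \<open>The threshold 2^\<mu> equalises B * 2^(\<mu> (1 - p)) and \<Lambda> * 2^(\<mu>
    (2 - p) / 2), that is, 2^(\<mu> p / 2) = B / \<Lambda>.\<close>
  define \<mu> where "\<mu> = log 2 ((\<Lambda> / B) powr (- 2 / p))"
  define m where "m = \<lceil>\<mu>\<rceil>"
  have \<mu>: "2 powr (\<mu> * s) = B powr (2 / p * s) * \<Lambda> powr (- 2 / p * s)" for s
  proof -
    have "2 powr \<mu> = (\<Lambda> / B) powr (- 2 / p)" unfolding \<mu>_def using pos by (intro powr_log_cancel) auto
    then have "(2 powr \<mu>) powr s = ((\<Lambda> / B) powr (- 2 / p)) powr s" by simp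
    then have "2 powr (\<mu> * s) = (\<Lambda> / B) powr (- 2 / p * s)" by (simp only: powr_powr)
    then show ?thesis using pos by (simp add: powr_divide powr_minus field_simps)
  qed
  have F': "(\<Sum>x\<in>X. f x powr p) \<le> 1" "(\<Sum>y\<in>Y. g y powr p) \<le> 1"
  proof -
    have "(\<Sum>x\<in>X. f x powr p) \<le> (\<Sum>x\<in>V. f x powr p)"
      by (rule sum_mono2[OF fin(1)]) (auto simp: X_def)
    then show "(\<Sum>x\<in>X. f x powr p) \<le> 1" using F by linarith
    have "(\<Sum>y\<in>Y. g y powr p) \<le> (\<Sum>y\<in>W. g y powr p)"
      by (rule sum_mono2[OF fin(2)]) (auto simp: Y_def)
    then show "(\<Sum>y\<in>Y. g y powr p) \<le> 1" using G by linarith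
  qed
  have "(\<Sum>x\<in>V. \<Sum>y\<in>W. of_real (f x * g y) * k x y) = (\<Sum>x\<in>X. \<Sum>y\<in>W. of_real (f x * g y) * k x y)"
    using f fin unfolding X_def by (intro sum.mono_neutral_right) (auto simp: order.strict_iff_order)
  also have "\<dots> = (\<Sum>x\<in>X. \<Sum>y\<in>Y. of_real (f x * g y) * k x y)"
    using g fin unfolding Y_def by (intro sum.cong refl sum.mono_neutral_right) (auto simp: order.strict_iff_order)
  finally have "cmod (\<Sum>x\<in>V. \<Sum>y\<in>W. of_real (f x * g y) * k x y) = cmod (\<Sum>x\<in>X. \<Sum>y\<in>Y. of_real (f x * g y) * k x y)"
    by simp
  also have "\<dots> \<le> B * 2 powr (m * (1 - p)) +
    (\<Sum>i\<in>dyadic_level f ` X. \<Sum>j\<in>dyadic_level g ` Y. if i + j < m then cmod (block X f Y g k i j) else 0)"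
    by (rule dyadic_split[OF finXY _ _ F']) (use p pos k in \<open>auto simp: X_def Y_def\<close>)
  also have "\<dots> \<le> B * 2 powr (m * (1 - p)) + \<Lambda> * (r\<^sup>2 / (r - 1) * r powr m)"
  proof (intro add_left_mono)
    have blk: "cmod (block X f Y g k i j) \<le> \<Lambda> * (sqrt (\<Sum>x\<in>{x\<in>X. dyadic_level f x = i}. (f x)\<^sup>2) * sqrt (\<Sum>y\<in>{y\<in>Y. dyadic_level g y = j}. (g y)\<^sup>2))"
      for i j
    proof -
      define A where "A = {x\<in>X. dyadic_level f x = i}"
      define D where "D = {y\<in>Y. dyadic_level g y = j}"
      have sub: "A \<subseteq> V" "D \<subseteq> W" by (auto simp: X_def Y_def A_def D_def)
      note res = sum_restrict_if[OF fin(1) sub(1)] sum_restrict_if[OF fin(2) sub(2)]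
      \<comment> \<open>The L2 hypothesis speaks of sums over all of V and W, so a block enters it
        through functions extended by zero.\<close>
      define f' where "f' x = (if x \<in> A then f x else 0)" for x
      define g' where "g' y = (if y \<in> D then g y else 0)" for y
      have "(\<Sum>x\<in>V. \<Sum>y\<in>W. of_real (f' x * g' y) * k x y) =
        (\<Sum>x\<in>V. if x \<in> A then (\<Sum>y\<in>W. if y \<in> D then of_real (f x * g y) * k x y else 0) else 0)"
        unfolding f'_def g'_def by (intro sum.cong refl) (auto intro!: sum.cong)
      also have "\<dots> = block X f Y g k i j"
        unfolding res block_def A_def[symmetric] D_def[symmetric] ..
      finally have "cmod (block X f Y g k i j) \<le> \<Lambda> * (sqrt (\<Sum>x\<in>V. (f' x)\<^sup>2) * sqrt (\<Sum>y\<in>W. (g' y)\<^sup>2))"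
        using L2[of f' g'] by simp
      also have "(\<Sum>x\<in>V. (f' x)\<^sup>2) = (\<Sum>x\<in>V. if x \<in> A then (f x)\<^sup>2 else 0)"
        unfolding f'_def by (intro sum.cong refl) simp
      also have "(\<Sum>y\<in>W. (g' y)\<^sup>2) = (\<Sum>y\<in>W. if y \<in> D then (g y)\<^sup>2 else 0)"
        unfolding g'_def by (intro sum.cong refl) simp
      finally show ?thesis unfolding res unfolding A_def D_def .
    qed
    have "(\<Sum>i\<in>dyadic_level f ` X. \<Sum>j\<in>dyadic_level g ` Y. if i + j < m then cmod (block X f Y g k i j) else 0)
      \<le> (\<Sum>i\<in>dyadic_level f ` X. \<Sum>j\<in>dyadic_level g ` Y. \<Lambda> * (if i + j < m then (sqrt (\<Sum>x\<in>{x\<in>X. dyadic_level f x = i}. (f x)\<^sup>2) * sqrt (\<Sum>y\<in>{y\<in>Y. dyadic_level g y = j}. (g y)\<^sup>2)) else 0))"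
      using blk by (intro sum_mono) auto
    also have "\<dots> \<le> \<Lambda> * (r\<^sup>2 / (r - 1) * r powr m)"
      unfolding sum_distrib_left[symmetric] r_def using pos p
      by (intro mult_left_mono dyadic_L2_blocks finXY F') (auto simp: X_def Y_def)
    finally show "(\<Sum>i\<in>dyadic_level f ` X. \<Sum>j\<in>dyadic_level g ` Y. if i + j < m then cmod (block X f Y g k i j) else 0)
      \<le> \<Lambda> * (r\<^sup>2 / (r - 1) * r powr m)" .
  qed
  \<comment> \<open>From the integer m back to \<mu>: m \<ge> \<mu> helps the first term, and m
    \<le> \<mu> + 1 costs one factor r in the second.\<close>
  also have "\<dots> \<le> B * 2 powr (\<mu> * (1 - p)) + \<Lambda> * (r\<^sup>2 / (r - 1) * (r * r powr \<mu>))"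
  proof (intro add_mono mult_left_mono)
    have "\<mu> \<le> m" "m \<le> \<mu> + 1" unfolding m_def by linarith+
    then show "2 powr (m * (1 - p)) \<le> 2 powr (\<mu> * (1 - p))"
      using p by (intro powr_mono mult_right_mono_neg) auto
    have "r powr m \<le> r powr (\<mu> + 1)" using r1 \<open>m \<le> \<mu> + 1\<close> by (intro powr_mono) auto
    then show "r powr m \<le> r * r powr \<mu>" using r1 by (simp add: powr_add mult.commute)
  qed (use pos r1 in auto)
  also have "B * 2 powr (\<mu> * (1 - p)) = B powr (2 / p - 1) * \<Lambda> powr (2 - 2 / p)"
  proof -
    have "B * 2 powr (\<mu> * (1 - p)) = B powr (1 + 2 / p * (1 - p)) * \<Lambda> powr (- 2 / p * (1 - p))"
      unfolding \<mu> using pos by (simp add: powr_add)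
    also have "1 + 2 / p * (1 - p) = 2 / p - 1" using p by (simp add: field_simps)
    also have "- 2 / p * (1 - p) = 2 - 2 / p" using p by (simp add: field_simps)
    finally show ?thesis .
  qed
  also have "\<Lambda> * (r\<^sup>2 / (r - 1) * (r * r powr \<mu>)) = r ^ 3 / (r - 1) * (B powr (2 / p - 1) * \<Lambda> powr (2 - 2 / p))"
  proof -
    have "r powr \<mu> = 2 powr (\<mu> * ((2 - p) / 2))" unfolding r_def powr_powr by (simp add: mult.commute)
    also have "\<dots> = B powr (2 / p * ((2 - p) / 2)) * \<Lambda> powr (- 2 / p * ((2 - p) / 2))" by (rule \<mu>)
    finally have "\<Lambda> * r powr \<mu> = B powr (2 / p * ((2 - p) / 2)) * (\<Lambda> powr 1 * \<Lambda> powr (- 2 / p * ((2 - p) / 2)))"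
      using pos by (simp only: powr_one less_imp_le mult_ac)
    also have "\<dots> = B powr (2 / p * ((2 - p) / 2)) * \<Lambda> powr (1 + - 2 / p * ((2 - p) / 2))"
      by (simp only: powr_add)
    also have "2 / p * ((2 - p) / 2) = 2 / p - 1" using p by (simp add: field_simps)
    also have "1 + - 2 / p * ((2 - p) / 2) = 2 - 2 / p" using p by (simp add: field_simps)
    finally have "\<Lambda> * r powr \<mu> = B powr (2 / p - 1) * \<Lambda> powr (2 - 2 / p)" .
    then have "r ^ 3 / (r - 1) * (\<Lambda> * r powr \<mu>) = r ^ 3 / (r - 1) * (B powr (2 / p - 1) * \<Lambda> powr (2 - 2 / p))" by simp
    then show ?thesis by (simp add: power2_eq_square power3_eq_cube mult_ac)
  qed
  finally show "cmod (\<Sum>x\<in>V. \<Sum>y\<in>W. of_real (f x * g y) * k x y) \<le>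
      interp_const p * B powr (2 / p - 1) * \<Lambda> powr (2 - 2 / p)"
    unfolding interp_const_def r_def[symmetric] by (simp add: algebra_simps)
qed (use f g in auto)

lemma weighted_Holder:
  fixes w a b :: "'z \<Rightarrow> real"
  assumes fin: "finite Z" and nn: "\<And>z. z \<in> Z \<Longrightarrow> 0 \<le> w z" "\<And>z. z \<in> Z \<Longrightarrow> 0 \<le> a z" "\<And>z. z \<in> Z \<Longrightarrow> 0 \<le> b z"
    and \<theta>: "0 < \<theta>" "\<theta> < 1"
  shows "(\<Sum>z\<in>Z. w z * (a z powr (1 - \<theta>) * b z powr \<theta>)) \<le> (\<Sum>z\<in>Z. w z * a z) powr (1 - \<theta>) * (\<Sum>z\<in>Z. w z * b z) powr \<theta>"
proof -
  define A where "A = (\<Sum>z\<in>Z. w z * a z)"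
  define B where "B = (\<Sum>z\<in>Z. w z * b z)"
  have AB: "0 \<le> A" "0 \<le> B" unfolding A_def B_def using nn by (auto intro!: sum_nonneg)
  show ?thesis
  proof (cases "A = 0 \<or> B = 0")
    case True
    then have "\<forall>z\<in>Z. w z * (a z powr (1 - \<theta>) * b z powr \<theta>) = 0"
    proof
      assume "A = 0"
      then have "\<forall>z\<in>Z. w z * a z = 0" unfolding A_def using nn fin by (subst (asm) sum_nonneg_eq_0_iff) auto
      then show ?thesis by auto
    next
      assume "B = 0"
      then have "\<forall>z\<in>Z. w z * b z = 0" unfolding B_def using nn fin by (subst (asm) sum_nonneg_eq_0_iff) auto
      then show ?thesis by auto
    qed
    then have "(\<Sum>z\<in>Z. w z * (a z powr (1 - \<theta>) * b z powr \<theta>)) = 0" by (rule sum.neutral)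
    then show ?thesis by simp
  next
    case False
    then have pos: "0 < A" "0 < B" using AB by auto
    have "(\<Sum>z\<in>Z. w z * ((a z / A) powr (1 - \<theta>) * (b z / B) powr \<theta>)) \<le> (\<Sum>z\<in>Z. w z * ((1 - \<theta>) * (a z / A) + \<theta> * (b z / B)))"
    proof (intro sum_mono mult_left_mono)
      fix z assume z: "z \<in> Z"
      show "(a z / A) powr (1 - \<theta>) * (b z / B) powr \<theta> \<le> (1 - \<theta>) * (a z / A) + \<theta> * (b z / B)"
      proof (cases "a z = 0 \<or> b z = 0")
        case False
        then show ?thesis using \<theta> nn[OF z] pos by (intro Youngs_inequality_0) (auto simp: order.strict_iff_order)
      next
        case True
        then show ?thesis using \<theta> nn[OF z] pos by auto
      qed
    qed (use nn in auto)
    also have "\<dots> = (1 - \<theta>) * (A / A) + \<theta> * (B / B)"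
      unfolding A_def B_def sum_divide_distrib sum_distrib_left sum.distrib[symmetric]
      by (intro sum.cong refl) (simp add: algebra_simps)
    also have "\<dots> = 1" using pos by simp
    finally have "(\<Sum>z\<in>Z. w z * ((a z / A) powr (1 - \<theta>) * (b z / B) powr \<theta>)) \<le> 1" .
    also have "(\<Sum>z\<in>Z. w z * ((a z / A) powr (1 - \<theta>) * (b z / B) powr \<theta>)) =
        (\<Sum>z\<in>Z. w z * (a z powr (1 - \<theta>) * b z powr \<theta>)) / (A powr (1 - \<theta>) * B powr \<theta>)"
      unfolding sum_divide_distrib using nn pos by (intro sum.cong refl) (simp add: powr_divide)
    finally show ?thesis using pos by (simp add: divide_le_eq A_def[symmetric] B_def[symmetric])
  qed
qed

section \<open>Sizes of spheres and removal of the diagonal\<close>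

lemma (in odd_finite_field) sqnorm_vminus_comm:
  assumes "x \<in> vecs F d" "y \<in> vecs F d"
  shows "sqnorm F d (vminus F d x y) = sqnorm F d (vminus F d y x)"
  unfolding sqnorm_def
proof (intro finsum_cong' refl)
  show "(\<lambda>i. vminus F d y x i [^] (2::nat)) \<in> {..<d} \<rightarrow> carrier F"
    using assms[THEN vminus_in_vecs[rotated]] vminus_in_vecs assms vecs_mem by blast
  fix i assume i: "i \<in> {..<d}"
  have c: "x i \<in> carrier F" "y i \<in> carrier F" using i assms vecs_mem by auto
  have "(x i \<ominus> y i) \<otimes> (x i \<ominus> y i) = (y i \<ominus> x i) \<otimes> (y i \<ominus> x i)" using c by algebra
  then show "vminus F d x y i [^] (2::nat) = vminus F d y x i [^] (2::nat)"
    using i c by (simp add: vminus_def numeral_2_eq_2)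
qed

context field_character
begin

text \<open>The zero frequency is the deviation of the sphere size from q^(d-1), and any factor
  below 1 keeps spheres large. The value 2/3 is what q \<ge> 3 yields in the tightest case d =
  3.\<close>

lemma sphere_mult_zero_le:
  assumes d: "2 \<le> d" and t: "t \<in> carrier F" "t \<noteq> \<zero>"
  shows "cmod (sphere_mult d t \<zero>) \<le> 2 / 3 * q ^ (d - 1)"
proof -
  have q3: "q \<ge> 3" using order_ge_3 by simp
  have s1: "1 \<le> sqrt q" using q3 by simp
  show ?thesis
  proof (cases "even d")
    case True
    have "cmod (sphere_mult d t \<zero>) = sqrt q ^ (d - 2)"
      using norm_sphere_mult_even[of d t \<zero>] kloosterman_zero[OF t] True d by simp
    also have "\<dots> \<le> sqrt q ^ (2 * (d - 2))" using s1 by (intro power_increasing) auto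
    also have "\<dots> = q ^ (d - 2)" using q3 by (simp add: power_mult)
    also have "\<dots> \<le> 2 / 3 * q ^ (d - 1)"
    proof -
      have "d - 1 = Suc (d - 2)" using d by simp
      then have "2 / 3 * q ^ (d - 1) = 2 / 3 * q * q ^ (d - 2)" by simp
      moreover have "1 * q ^ (d - 2) \<le> 2 / 3 * q * q ^ (d - 2)" using q3 by (intro mult_right_mono) auto
      ultimately show ?thesis by simp
    qed
    finally show ?thesis .
  next
    case False
    then have d3: "d \<ge> 3" using d by (cases "d = 2") auto
    have "cmod (sphere_mult d t \<zero>) \<le> 2 * sqrt q ^ (d - 1)"
      using norm_sphere_mult_odd[OF False t] by simp
    also have "\<dots> \<le> 2 * (q ^ (d - 1) / 3)"
    proof -
      have "3 * sqrt q ^ (d - 1) \<le> sqrt q ^ (d - 1) * sqrt q ^ (d - 1)"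
      proof (intro mult_right_mono)
        have "3 \<le> sqrt q ^ 2" using q3 by simp
        also have "\<dots> \<le> sqrt q ^ (d - 1)" using s1 d3 by (intro power_increasing) auto
        finally show "3 \<le> sqrt q ^ (d - 1)" .
      qed (use s1 in auto)
      also have "\<dots> = q ^ (d - 1)" using q3 by (simp add: power_mult_distrib[symmetric])
      finally show ?thesis by simp
    qed
    finally show ?thesis by simp
  qed
qed

text \<open>When the expansion of the indicator is summed over all z, the kernel contributes just
  its multiplier at frequency 0, so the size differs from q^(d-1) by at most two thirds of
  it.\<close>

lemma card_sphere_bounds:
  assumes d: "2 \<le> d" and t: "t \<in> carrier F" "t \<noteq> \<zero>"
  shows "q ^ (d - 1) / 3 \<le> card (sphere F d t)" "card (sphere F d t) \<le> 2 * q ^ (d - 1)"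
proof -
  let ?V = "vecs F d"
  have sub: "sphere F d t \<subseteq> ?V" by (auto simp: Defs.sphere_def)
  have ind: "complex_of_real (indicat_real (sphere F d t) z) = (if z \<in> sphere F d t then 1 else 0)" for z
    by (simp add: indicator_def)
  have "of_nat (card (sphere F d t)) = (\<Sum>z\<in>?V. complex_of_real (indicat_real (sphere F d t) z))"
    unfolding ind sum_restrict_if[OF finite_vectors sub] by simp
  also have "\<dots> = (\<Sum>z\<in>?V. 1 / of_real q + multiplier_kernel d (sphere_mult d t) z)"
    using d t by (intro sum.cong refl sphere_expansion) auto
  also have "\<dots> = of_real (q ^ d) / of_real q + (\<Sum>z\<in>?V. multiplier_kernel d (sphere_mult d t) z)"
    by (simp add: sum.distrib card_vecs)
  also have "(\<Sum>z\<in>?V. multiplier_kernel d (sphere_mult d t) z) = sphere_mult d t \<zero>"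
  proof -
    have Psi_comm: "Psi d \<xi> z = Psi d z \<xi>" if "\<xi> \<in> ?V" "z \<in> ?V" for \<xi> z
      unfolding Psi_def using that[THEN vecs_mem] by (intro prod.cong refl) (simp add: m_comm)
    have "(\<Sum>z\<in>?V. multiplier_kernel d (sphere_mult d t) z) =
        (\<Sum>\<xi>\<in>?V. \<Sum>z\<in>?V. sphere_mult d t (sqnorm F d \<xi>) * Psi d z \<xi>) / of_real (q ^ d)"
      unfolding multiplier_kernel_def sum_divide_distrib[symmetric]
      by (subst sum.swap) (simp add: Psi_comm)
    also have "(\<Sum>\<xi>\<in>?V. \<Sum>z\<in>?V. sphere_mult d t (sqnorm F d \<xi>) * Psi d z \<xi>) =
        (\<Sum>\<xi>\<in>?V. if \<xi> = vzero d then sphere_mult d t (sqnorm F d \<xi>) * of_real (q ^ d) else 0)"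
      unfolding sum_distrib_left[symmetric] by (intro sum.cong refl) (simp add: sum_Psi)
    also have "\<dots> = sphere_mult d t (sqnorm F d (vzero d)) * of_real (q ^ d)"
      using vzero_in_vecs[of d] by simp
    also have "sqnorm F d (vzero d) = \<zero>"
      unfolding sqnorm_def by (rule add.finprod_one_eqI) (simp add: vzero_def numeral_2_eq_2)
    finally show ?thesis using q_gt_0 by simp
  qed
  also have "complex_of_real (q ^ d) / of_real q = of_real (q ^ (d - 1))"
    using d q_gt_0 by (cases d) (simp_all add: field_simps)
  finally have "of_real (card (sphere F d t) - q ^ (d - 1)) = sphere_mult d t \<zero>"
    by (simp add: algebra_simps)
  then have "\<bar>card (sphere F d t) - q ^ (d - 1)\<bar> \<le> 2 / 3 * q ^ (d - 1)"
    using sphere_mult_zero_le[OF assms] by (metis norm_of_real)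
  then have 1: "card (sphere F d t) - q ^ (d - 1) \<le> 2 / 3 * q ^ (d - 1)"
      and 2: "- (card (sphere F d t) - q ^ (d - 1)) \<le> 2 / 3 * q ^ (d - 1)"
    unfolding abs_le_iff by blast+
  have 3: "0 \<le> q ^ (d - 1)" using q_gt_0 by simp
  show "q ^ (d - 1) / 3 \<le> card (sphere F d t)" "card (sphere F d t) \<le> 2 * q ^ (d - 1)"
    using 1 2 3 by linarith+
qed

text \<open>The diagonal is excluded because \<open>sum_multiplier_sqnorm\<close> bounds a kernel
  only away from 0.\<close>

definition offdiag :: "nat \<Rightarrow> ((nat \<Rightarrow> 'a) \<Rightarrow> complex) \<Rightarrow> (nat \<Rightarrow> 'a) \<Rightarrow> (nat \<Rightarrow> 'a) \<Rightarrow> complex" where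
  "offdiag d \<kappa> x y = (if x = y then 0 else \<kappa> (vminus F d x y))"

text \<open>The diagonal carries the value of the kernel at 0. This is the mean of the multiplier
  over all frequencies, hence at most \<Lambda>, so removing the diagonal at most doubles the L2
  bound.\<close>

lemma offdiag_L2:
  fixes f g :: "(nat \<Rightarrow> 'a) \<Rightarrow> real"
  assumes m: "\<And>c. c \<in> carrier F \<Longrightarrow> cmod (m c) \<le> \<Lambda>"
  shows "cmod (\<Sum>x\<in>vecs F d. \<Sum>y\<in>vecs F d. of_real (f x * g y) * offdiag d (multiplier_kernel d m) x y)
    \<le> 2 * \<Lambda> * (sqrt (\<Sum>x\<in>vecs F d. (f x)\<^sup>2) * sqrt (\<Sum>y\<in>vecs F d. (g y)\<^sup>2))"
proof -
  let ?V = "vecs F d" and ?k = "multiplier_kernel d m"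
  have q0: "q ^ d > 0" using q_gt_0 by simp
  have L0: "0 \<le> \<Lambda>" using m[of \<zero>] by (meson norm_ge_zero order_trans zero_closed)
  have k0: "cmod (?k (vzero d)) \<le> \<Lambda>"
  proof -
    have "Psi d \<xi> (vzero d) = 1" if "\<xi> \<in> ?V" for \<xi>
      unfolding Psi_def using vecs_mem[OF that] by (intro prod.neutral) (simp add: vzero_def)
    then have "cmod (\<Sum>\<xi>\<in>?V. m (sqnorm F d \<xi>) * Psi d \<xi> (vzero d)) \<le> of_nat (card ?V) * \<Lambda>"
      using m by (intro sum_norm_bound) simp
    then show ?thesis
      unfolding multiplier_kernel_def using q0
      by (simp add: norm_divide norm_power card_vecs divide_le_eq mult.commute)
  qed
  have "(\<Sum>y\<in>?V. of_real (f x * g y) * offdiag d ?k x y) =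
      (\<Sum>y\<in>?V. of_real (f x * g y) * ?k (vminus F d x y)) - of_real (f x) * of_real (g x) * ?k (vzero d)"
    if x: "x \<in> ?V" for x
  proof -
    have "vminus F d x x = vzero d" using vminus_eq_vzero_iff[OF x x] by simp
    then have "(\<Sum>y\<in>?V. of_real (f x * g y) * offdiag d ?k x y) =
      (\<Sum>y\<in>?V. of_real (f x * g y) * ?k (vminus F d x y) - (if y = x then of_real (f x) * of_real (g x) * ?k (vzero d) else 0))"
      by (intro sum.cong refl) (auto simp: offdiag_def)
    then show ?thesis using x by (simp add: sum_subtractf)
  qed
  then have "(\<Sum>x\<in>?V. \<Sum>y\<in>?V. of_real (f x * g y) * offdiag d ?k x y) =
      (\<Sum>x\<in>?V. \<Sum>y\<in>?V. of_real (f x * g y) * ?k (vminus F d x y)) - (\<Sum>x\<in>?V. of_real (f x) * of_real (g x)) * ?k (vzero d)"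
    by (simp add: sum_subtractf sum_distrib_right)
  then have "cmod (\<Sum>x\<in>?V. \<Sum>y\<in>?V. of_real (f x * g y) * offdiag d ?k x y) \<le>
      cmod (\<Sum>x\<in>?V. \<Sum>y\<in>?V. of_real (f x * g y) * ?k (vminus F d x y)) + cmod ((\<Sum>x\<in>?V. of_real (f x) * of_real (g x)) * ?k (vzero d))"
    by (simp only: norm_triangle_ineq4)
  also have "\<dots> \<le> \<Lambda> * (sqrt (\<Sum>x\<in>?V. (f x)\<^sup>2) * sqrt (\<Sum>y\<in>?V. (g y)\<^sup>2)) + (sqrt (\<Sum>x\<in>?V. (f x)\<^sup>2) * sqrt (\<Sum>y\<in>?V. (g y)\<^sup>2)) * \<Lambda>"
  proof (intro add_mono multiplier_kernel_L2 m)
    have "cmod (\<Sum>x\<in>?V. of_real (f x) * of_real (g x)) \<le> sqrt (\<Sum>x\<in>?V. (f x)\<^sup>2) * sqrt (\<Sum>y\<in>?V. (g y)\<^sup>2)"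
      using cmod_sum_mult_le[of "\<lambda>x. of_real (f x)" "\<lambda>x. of_real (g x)" ?V] by simp
    then show "cmod ((\<Sum>x\<in>?V. of_real (f x) * of_real (g x)) * ?k (vzero d)) \<le> (sqrt (\<Sum>x\<in>?V. (f x)\<^sup>2) * sqrt (\<Sum>y\<in>?V. (g y)\<^sup>2)) * \<Lambda>"
      unfolding norm_mult using k0 by (intro mult_mono) (auto intro!: sum_nonneg mult_nonneg_nonneg)
  qed
  finally show ?thesis by (simp add: mult_ac)
qed

definition sphere_form :: "nat \<Rightarrow> 'a \<Rightarrow> ((nat \<Rightarrow> 'a) \<Rightarrow> real) \<Rightarrow> ((nat \<Rightarrow> 'a) \<Rightarrow> real) \<Rightarrow> real" where
  "sphere_form d t f g = (\<Sum>x\<in>vecs F d. \<Sum>y\<in>vecs F d. indicat_real (sphere F d t) (vminus F d x y) * f x * g y)"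

text \<open>As ||0|| = 0 \<noteq> t, the sphere form has no diagonal, and for x \<noteq> y its
  kernel is 1 / q plus the off-diagonal kernel. For nonnegative functions the diagonal may then be
  added back to the 1 / q part.\<close>

lemma sphere_form_le_of_offdiag:
  fixes f g :: "(nat \<Rightarrow> 'a) \<Rightarrow> real"
  assumes d: "0 < d" and t: "t \<in> carrier F" "t \<noteq> \<zero>"
    and f: "\<And>x. x \<in> vecs F d \<Longrightarrow> 0 \<le> f x" and g: "\<And>x. x \<in> vecs F d \<Longrightarrow> 0 \<le> g x"
  shows "sphere_form d t f g \<le> (\<Sum>x\<in>vecs F d. f x) * (\<Sum>x\<in>vecs F d. g x) / q +
    cmod (\<Sum>x\<in>vecs F d. \<Sum>y\<in>vecs F d. of_real (f x * g y) * offdiag d (multiplier_kernel d (sphere_mult d t)) x y)"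
proof -
  let ?V = "vecs F d" and ?k = "multiplier_kernel d (sphere_mult d t)"
  have "sqnorm F d (vzero d) = \<zero>"
    unfolding sqnorm_def by (rule add.finprod_one_eqI) (simp add: vzero_def numeral_2_eq_2)
  then have z: "vzero d \<notin> sphere F d t" using t by (simp add: Defs.sphere_def)
  have e: "complex_of_real (f x * g y * (if x = y then 0 else 1 / q)) = of_real (f x * g y) * (if x = y then 0 else 1 / of_real q)" for x y
    by simp
  have "complex_of_real (sphere_form d t f g) = (\<Sum>x\<in>?V. \<Sum>y\<in>?V. of_real (f x * g y) * (if x = y then 0 else 1 / of_real q)
     + of_real (f x * g y) * offdiag d ?k x y)"
    unfolding sphere_form_def of_real_sum
  proof (intro sum.cong refl)
    fix x y assume xy: "x \<in> ?V" "y \<in> ?V"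
    show "complex_of_real (indicat_real (sphere F d t) (vminus F d x y) * f x * g y) =
      of_real (f x * g y) * (if x = y then 0 else 1 / of_real q) + of_real (f x * g y) * offdiag d ?k x y"
    proof (cases "x = y")
      case True
      then show ?thesis using z vminus_eq_vzero_iff[OF xy] by (simp add: offdiag_def)
    next
      case False
      then show ?thesis
        using sphere_expansion[OF d t(1) vminus_in_vecs[OF xy]] by (simp add: offdiag_def algebra_simps)
    qed
  qed
  then have "complex_of_real (sphere_form d t f g) =
      of_real (\<Sum>x\<in>?V. \<Sum>y\<in>?V. f x * g y * (if x = y then 0 else 1 / q)) +
      (\<Sum>x\<in>?V. \<Sum>y\<in>?V. of_real (f x * g y) * offdiag d ?k x y)"
    by (simp only: of_real_sum e sum.distrib)
  from arg_cong[where f = Re, OF this] have "sphere_form d t f g = (\<Sum>x\<in>?V. \<Sum>y\<in>?V. f x * g y * (if x = y then 0 else 1 / q)) +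
      Re (\<Sum>x\<in>?V. \<Sum>y\<in>?V. of_real (f x * g y) * offdiag d ?k x y)"
    by (simp only: Re_complex_of_real plus_complex.sel)
  also have "\<dots> \<le> (\<Sum>x\<in>?V. \<Sum>y\<in>?V. 1 / q * (f x * g y)) + cmod (\<Sum>x\<in>?V. \<Sum>y\<in>?V. of_real (f x * g y) * offdiag d ?k x y)"
    using f g q_gt_0 by (intro add_mono sum_mono complex_Re_le_cmod) auto
  finally show ?thesis unfolding sum_mult_product by simp
qed

end

section \<open>Incidences of points and circles\<close>

context odd_finite_field
begin

lemma card_quadratic_roots_le:
  assumes c: "a \<in> carrier F" "b \<in> carrier F" "c \<in> carrier F" and a: "a \<noteq> \<zero>"
  shows "card {z \<in> carrier F. a \<otimes> (z \<otimes> z) \<oplus> b \<otimes> z \<oplus> c = \<zero>} \<le> 2"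
proof (cases "{z \<in> carrier F. a \<otimes> (z \<otimes> z) \<oplus> b \<otimes> z \<oplus> c = \<zero>} = {}")
  case False
  then obtain w where w: "w \<in> carrier F" "a \<otimes> (w \<otimes> w) \<oplus> b \<otimes> w \<oplus> c = \<zero>" by blast
  \<comment> \<open>The second root according to Vieta.\<close>
  define w' where "w' = \<ominus> (inv a \<otimes> b) \<ominus> w"
  have ia: "inv a \<in> carrier F" "inv a \<otimes> a = \<one>" using c a by auto
  have w': "w' \<in> carrier F" using ia c w by (simp add: w'_def)
  have "{z \<in> carrier F. a \<otimes> (z \<otimes> z) \<oplus> b \<otimes> z \<oplus> c = \<zero>} \<subseteq> {w, w'}"
  proof
    fix z assume "z \<in> {z \<in> carrier F. a \<otimes> (z \<otimes> z) \<oplus> b \<otimes> z \<oplus> c = \<zero>}"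
    then have z: "z \<in> carrier F" "a \<otimes> (z \<otimes> z) \<oplus> b \<otimes> z \<oplus> c = \<zero>" by auto
    have "(z \<ominus> w) \<otimes> (a \<otimes> z \<oplus> a \<otimes> w \<oplus> b) =
        (a \<otimes> (z \<otimes> z) \<oplus> b \<otimes> z \<oplus> c) \<ominus> (a \<otimes> (w \<otimes> w) \<oplus> b \<otimes> w \<oplus> c)"
      using z(1) w(1) c by algebra
    also have "\<dots> = \<zero>" using z w by (simp add: minus_eq)
    finally consider "z = w" | "a \<otimes> z \<oplus> a \<otimes> w \<oplus> b = \<zero>"
      using z w c by (auto simp: integral_iff eq_diff0)
    then show "z \<in> {w, w'}"
    proof cases
      case 2
      have "z = inv a \<otimes> (a \<otimes> z \<oplus> a \<otimes> w \<oplus> b) \<ominus> inv a \<otimes> b \<ominus> w"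
      proof -
        have "inv a \<otimes> (a \<otimes> z \<oplus> a \<otimes> w \<oplus> b) = (inv a \<otimes> a) \<otimes> z \<oplus> (inv a \<otimes> a) \<otimes> w \<oplus> inv a \<otimes> b"
          using ia(1) z w c by (simp add: r_distr m_assoc)
        also have "\<dots> = z \<oplus> w \<oplus> inv a \<otimes> b" using ia(2) z w by simp
        finally have e: "inv a \<otimes> (a \<otimes> z \<oplus> a \<otimes> w \<oplus> b) = z \<oplus> w \<oplus> inv a \<otimes> b" .
        define e where "e = inv a \<otimes> b"
        have "e \<in> carrier F" using ia c by (simp add: e_def)
        then have "z \<oplus> w \<oplus> e \<ominus> e \<ominus> w = z" using z(1) w(1) by algebra
        then show ?thesis unfolding e e_def[symmetric] by simp
      qed
      then show ?thesis using 2 ia c w by (simp add: w'_def minus_eq)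
    qed simp
  qed
  then have "card {z \<in> carrier F. a \<otimes> (z \<otimes> z) \<oplus> b \<otimes> z \<oplus> c = \<zero>} \<le> card {w, w'}"
    by (intro card_mono) auto
  also have "\<dots> \<le> 2" using card_length[of "[w, w']"] by simp
  finally show ?thesis .
next
  case True
  then show ?thesis by (simp only: card.empty)
qed

text \<open>The line is the radical axis of two circles of equal radius centred at the origin and at
  (a, b), whence 2 n = a^2 + b^2. Eliminating x gives a quadratic in y with leading coefficient 2 n.
  If n = 0, the direction (a, b) is isotropic and the equation collapses to t a^2 = 0, which is
  impossible.\<close>

lemma card_line_circle_le:
  assumes c: "a \<in> carrier F" "b \<in> carrier F" "n \<in> carrier F" "t \<in> carrier F" and t: "t \<noteq> \<zero>" and a: "a \<noteq> \<zero>"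
    and n: "a \<otimes> a \<oplus> b \<otimes> b = \<guillemotleft>2\<guillemotright> \<otimes> n"
  shows "card {(x, y). x \<in> carrier F \<and> y \<in> carrier F \<and> x \<otimes> x \<oplus> y \<otimes> y = t \<and> a \<otimes> x \<oplus> b \<otimes> y = n} \<le> 2"
    (is "card ?L \<le> _")
proof -
  let ?A = "\<guillemotleft>2\<guillemotright> \<otimes> n" and ?B = "\<ominus> (\<guillemotleft>2\<guillemotright> \<otimes> n \<otimes> b)" and ?C = "n \<otimes> n \<ominus> t \<otimes> (a \<otimes> a)"
  have eq: "?A \<otimes> (y \<otimes> y) \<oplus> ?B \<otimes> y \<oplus> ?C = \<zero>"
    if xy: "x \<in> carrier F" "y \<in> carrier F" "x \<otimes> x \<oplus> y \<otimes> y = t" "a \<otimes> x \<oplus> b \<otimes> y = n" for x y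
  proof -
    have "(a \<otimes> a \<oplus> b \<otimes> b) \<otimes> (y \<otimes> y) \<oplus> \<ominus> (((a \<otimes> x \<oplus> b \<otimes> y) \<oplus> (a \<otimes> x \<oplus> b \<otimes> y)) \<otimes> b) \<otimes> y \<oplus> ((a \<otimes> x \<oplus> b \<otimes> y) \<otimes> (a \<otimes> x \<oplus> b \<otimes> y) \<ominus> (x \<otimes> x \<oplus> y \<otimes> y) \<otimes> (a \<otimes> a)) = \<zero>"
      using xy(1,2) c(1,2) by algebra
    then show ?thesis unfolding n xy(3,4) mult2[OF c(3)] .
  qed
  have inj: "inj_on snd ?L"
  proof (rule inj_onI)
    fix p p' assume "p \<in> ?L" "p' \<in> ?L" "snd p = snd p'"
    then obtain x x' y where p: "p = (x, y)" "p' = (x', y)" and xy: "x \<in> carrier F" "x' \<in> carrier F" "y \<in> carrier F"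
      and e: "a \<otimes> x \<oplus> b \<otimes> y = n" "a \<otimes> x' \<oplus> b \<otimes> y = n" by auto
    have "a \<otimes> x \<oplus> b \<otimes> y = a \<otimes> x' \<oplus> b \<otimes> y" using e by simp
    then have "a \<otimes> x = a \<otimes> x'" using xy c by simp
    then show "p = p'" using p xy c a m_lcancel[of a x x'] by simp
  qed
  show ?thesis
  proof (cases "n = \<zero>")
    case True
    have "?L = {}"
    proof (rule ccontr)
      assume "?L \<noteq> {}"
      then obtain x y where xy: "x \<in> carrier F" "y \<in> carrier F" "x \<otimes> x \<oplus> y \<otimes> y = t" "a \<otimes> x \<oplus> b \<otimes> y = n" by auto
      from eq[OF xy] show False
        using True c a t xy(2) by (simp add: minus_eq integral_iff)
    qed
    then show ?thesis by (simp only: card.empty)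
  next
    case False
    have "card ?L = card (snd ` ?L)" by (rule card_image[OF inj, symmetric])
    also have "\<dots> \<le> card {y \<in> carrier F. ?A \<otimes> (y \<otimes> y) \<oplus> ?B \<otimes> y \<oplus> ?C = \<zero>}"
      using eq finite_carrier by (intro card_mono) auto
    also have "\<dots> \<le> 2"
      by (rule card_quadratic_roots_le) (use c False of_int_2_nonzero in \<open>auto simp: integral_iff\<close>)
    finally show ?thesis .
  qed
qed

lemma sqnorm_2: "x \<in> vecs F 2 \<Longrightarrow> sqnorm F 2 x = x 0 \<otimes> x 0 \<oplus> x 1 \<otimes> x 1"
proof -
  assume x: "x \<in> vecs F 2"
  have "{..<2::nat} = {0, 1}" by auto
  then show ?thesis unfolding sqnorm_def using vecs_mem[OF x, of 0] vecs_mem[OF x, of 1]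
    by (simp add: numeral_2_eq_2)
qed

text \<open>After moving y to the origin, the difference of the two circle equations is a line. The
  coordinates are exchanged if its first coefficient vanishes.\<close>

lemma card_two_circles_le:
  assumes t: "t \<in> carrier F" "t \<noteq> \<zero>" and y: "y \<in> vecs F 2" "y' \<in> vecs F 2" "y \<noteq> y'"
  shows "card {x \<in> vecs F 2. vminus F 2 x y \<in> sphere F 2 t \<and> vminus F 2 x y' \<in> sphere F 2 t} \<le> 2"
    (is "card ?L \<le> _")
proof -
  define a where "a = y' 0 \<ominus> y 0"
  define b where "b = y' 1 \<ominus> y 1"
  have c: "y 0 \<in> carrier F" "y 1 \<in> carrier F" "y' 0 \<in> carrier F" "y' 1 \<in> carrier F"
    using y vecs_mem by auto
  have ab: "a \<in> carrier F" "b \<in> carrier F" using c by (auto simp: a_def b_def)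
  define n where "n = inv \<guillemotleft>2\<guillemotright> \<otimes> (a \<otimes> a \<oplus> b \<otimes> b)"
  have i2: "inv \<guillemotleft>2\<guillemotright> \<in> carrier F" "inv \<guillemotleft>2\<guillemotright> \<otimes> \<guillemotleft>2\<guillemotright> = \<one>" "\<guillemotleft>2\<guillemotright> \<otimes> inv \<guillemotleft>2\<guillemotright> = \<one>"
    using of_int_2_nonzero by auto
  have nc: "n \<in> carrier F" using i2 ab by (simp add: n_def)
  have n: "a \<otimes> a \<oplus> b \<otimes> b = \<guillemotleft>2\<guillemotright> \<otimes> n"
    unfolding n_def using i2 ab by (simp add: m_assoc[symmetric])
  have nz: "a \<noteq> \<zero> \<or> b \<noteq> \<zero>"
  proof (rule ccontr)
    assume "\<not> (a \<noteq> \<zero> \<or> b \<noteq> \<zero>)"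
    then have e: "y 0 = y' 0" "y 1 = y' 1" using c by (auto simp: a_def b_def eq_diff0)
    have "y = y'"
    proof (rule PiE_ext[OF y(1)[unfolded vecs_def] y(2)[unfolded vecs_def]])
      fix i assume "i \<in> {..<2::nat}"
      then have "i = 0 \<or> i = 1" by auto
      then show "y i = y' i" using e by auto
    qed
    then show False using y by simp
  qed
  define \<phi> where "\<phi> x = (x 0 \<ominus> y 0, x 1 \<ominus> y 1)" for x :: "nat \<Rightarrow> 'a"
  have inj: "inj_on \<phi> (vecs F 2)"
  proof (rule inj_onI)
    fix x x' assume x: "x \<in> vecs F 2" "x' \<in> vecs F 2" and e: "\<phi> x = \<phi> x'"
    have xc: "x 0 \<in> carrier F" "x 1 \<in> carrier F" "x' 0 \<in> carrier F" "x' 1 \<in> carrier F" using x vecs_mem by auto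
    have "x 0 \<oplus> \<ominus> y 0 = x' 0 \<oplus> \<ominus> y 0" "x 1 \<oplus> \<ominus> y 1 = x' 1 \<oplus> \<ominus> y 1" using e by (auto simp: \<phi>_def minus_eq)
    then have e: "x 0 = x' 0" "x 1 = x' 1" using xc c by auto
    show "x = x'"
    proof (rule PiE_ext[OF x(1)[unfolded vecs_def] x(2)[unfolded vecs_def]])
      fix i assume "i \<in> {..<2::nat}"
      then have "i = 0 \<or> i = 1" by auto
      then show "x i = x' i" using e by auto
    qed
  qed
  let ?M = "{(u, v). u \<in> carrier F \<and> v \<in> carrier F \<and> u \<otimes> u \<oplus> v \<otimes> v = t \<and> a \<otimes> u \<oplus> b \<otimes> v = n}"
  have finM: "finite ?M" by (rule finite_subset[of _ "carrier F \<times> carrier F"]) (auto simp: finite_carrier)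
  have "\<phi> ` ?L \<subseteq> ?M"
  proof (intro image_subsetI)
    fix x assume "x \<in> ?L"
    then have x: "x \<in> vecs F 2" "sqnorm F 2 (vminus F 2 x y) = t" "sqnorm F 2 (vminus F 2 x y') = t"
      by (auto simp: Defs.sphere_def)
    have xc: "x 0 \<in> carrier F" "x 1 \<in> carrier F" using x vecs_mem by auto
    define u v where "u = x 0 \<ominus> y 0" and "v = x 1 \<ominus> y 1"
    have uv: "u \<in> carrier F" "v \<in> carrier F" using xc c by (auto simp: u_def v_def)
    have s: "u \<otimes> u \<oplus> v \<otimes> v = t"
      using x(2) sqnorm_2[OF vminus_in_vecs[OF x(1) y(1)]] by (simp add: vminus_def u_def v_def)
    have "x 0 \<ominus> y' 0 = u \<ominus> a" "x 1 \<ominus> y' 1 = v \<ominus> b"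
      unfolding u_def v_def a_def b_def using xc c by algebra+
    then have s': "(u \<ominus> a) \<otimes> (u \<ominus> a) \<oplus> (v \<ominus> b) \<otimes> (v \<ominus> b) = t"
      using x(3) sqnorm_2[OF vminus_in_vecs[OF x(1) y(2)]] by (simp add: vminus_def)
    have "(a \<otimes> u \<oplus> b \<otimes> v) \<oplus> (a \<otimes> u \<oplus> b \<otimes> v) = (u \<otimes> u \<oplus> v \<otimes> v) \<ominus> ((u \<ominus> a) \<otimes> (u \<ominus> a) \<oplus> (v \<ominus> b) \<otimes> (v \<ominus> b)) \<oplus> (a \<otimes> a \<oplus> b \<otimes> b)"
      using uv ab by algebra
    also have "\<dots> = \<guillemotleft>2\<guillemotright> \<otimes> n" unfolding s s' n using t nc by (simp add: minus_eq r_neg)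
    finally have "\<guillemotleft>2\<guillemotright> \<otimes> (a \<otimes> u \<oplus> b \<otimes> v) = \<guillemotleft>2\<guillemotright> \<otimes> n"
      using mult2[of "a \<otimes> u \<oplus> b \<otimes> v"] uv ab by simp
    then have "a \<otimes> u \<oplus> b \<otimes> v = n"
      using m_lcancel[of "\<guillemotleft>2\<guillemotright>" "a \<otimes> u \<oplus> b \<otimes> v" n] of_int_2_nonzero uv ab nc by simp
    then show "\<phi> x \<in> ?M" using uv s by (simp add: \<phi>_def u_def v_def)
  qed
  moreover have "card ?L = card (\<phi> ` ?L)"
    by (rule card_image[symmetric], rule inj_on_subset[OF inj]) auto
  ultimately have "card ?L \<le> card ?M" using finM by (simp add: card_mono)
  also have "card ?M \<le> 2"
  proof (cases "a = \<zero>")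
    case False
    then show ?thesis using card_line_circle_le[OF ab nc t(1,2) False n] by simp
  next
    case True
    then have "b \<noteq> \<zero>" using nz by simp
    have "b \<otimes> b \<oplus> a \<otimes> a = \<guillemotleft>2\<guillemotright> \<otimes> n" using n ab by (simp add: a_comm)
    note le = card_line_circle_le[OF ab(2,1) nc t(1,2) \<open>b \<noteq> \<zero>\<close> this]
    have "?M = prod.swap ` {(v, u). v \<in> carrier F \<and> u \<in> carrier F \<and> v \<otimes> v \<oplus> u \<otimes> u = t \<and> b \<otimes> v \<oplus> a \<otimes> u = n}"
      using ab by (force simp: a_comm image_iff)
    then show ?thesis using le by (simp add: card_image)
  qed
  finally show ?thesis .
qed

end

section \<open>Graphs in which two vertices have few common neighbours\<close>

lemma sum_le_card_powr:
  fixes f :: "'x \<Rightarrow> real"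
  assumes fin: "finite V" and f: "\<And>x. x \<in> V \<Longrightarrow> 0 \<le> f x" and p: "1 < p"
  shows "(\<Sum>x\<in>V. f x) \<le> real (card V) powr (1 - 1 / p) * (\<Sum>x\<in>V. f x powr p) powr (1 / p)"
proof -
  have "(\<Sum>x\<in>V. f x) = (\<Sum>x\<in>V. 1 * (1 powr (1 - 1 / p) * (f x powr p) powr (1 / p)))"
    using f p by (intro sum.cong refl) (simp add: powr_powr)
  also have "\<dots> \<le> (\<Sum>x\<in>V. 1 * 1) powr (1 - 1 / p) * (\<Sum>x\<in>V. 1 * f x powr p) powr (1 / p)"
    using p by (intro weighted_Holder[OF fin]) auto
  finally show ?thesis by simp
qed

text \<open>After Cauchy-Schwarz in x, the square of the inner sum runs over pairs y, y'. The
  diagonal is paid for by the degree bound 2 Q, every other pair by its at most two common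
  neighbours; the latter is where the l1 norm of b enters.\<close>

lemma incidence_L2:
  fixes K :: "'x \<Rightarrow> 'x \<Rightarrow> real" and a b :: "'x \<Rightarrow> real"
  assumes fin: "finite A" "finite D" "finite V" and sub: "A \<subseteq> V" "D \<subseteq> V" and Q: "0 \<le> Q"
    and K: "\<And>x y. x \<in> V \<Longrightarrow> y \<in> V \<Longrightarrow> K x y = 0 \<or> K x y = 1"
    and row: "\<And>y. y \<in> V \<Longrightarrow> (\<Sum>x\<in>V. K x y) \<le> 2 * Q"
    and two: "\<And>y y'. y \<in> V \<Longrightarrow> y' \<in> V \<Longrightarrow> y \<noteq> y' \<Longrightarrow> (\<Sum>x\<in>V. K x y * K x y') \<le> 2"
    and b: "\<And>y. y \<in> D \<Longrightarrow> 0 \<le> b y"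
  shows "(\<Sum>x\<in>A. \<Sum>y\<in>D. a x * b y * K x y) \<le>
    sqrt (\<Sum>x\<in>A. (a x)\<^sup>2) * (sqrt (2 * Q) * sqrt (\<Sum>y\<in>D. (b y)\<^sup>2) + sqrt 2 * (\<Sum>y\<in>D. b y))"
proof -
  have sB: "0 \<le> (\<Sum>y\<in>D. b y)" using b by (rule sum_nonneg)
  have "(\<Sum>x\<in>A. \<Sum>y\<in>D. a x * b y * K x y) = (\<Sum>x\<in>A. a x * (\<Sum>y\<in>D. b y * K x y))"
    by (simp add: sum_distrib_left mult_ac)
  also have "\<dots> \<le> (\<Sum>x\<in>A. \<bar>a x\<bar> * \<bar>\<Sum>y\<in>D. b y * K x y\<bar>)"
    by (intro sum_mono) (metis abs_ge_self abs_mult)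
  also have "\<dots> \<le> L2_set a A * L2_set (\<lambda>x. \<Sum>y\<in>D. b y * K x y) A"
    by (rule L2_set_mult_ineq)
  also have "\<dots> \<le> sqrt (\<Sum>x\<in>A. (a x)\<^sup>2) * (sqrt (2 * Q) * sqrt (\<Sum>y\<in>D. (b y)\<^sup>2) + sqrt 2 * (\<Sum>y\<in>D. b y))"
    unfolding L2_set_def
  proof (intro mult_left_mono)
    have "(\<Sum>x\<in>A. (\<Sum>y\<in>D. b y * K x y)\<^sup>2) \<le> (\<Sum>x\<in>V. (\<Sum>y\<in>D. b y * K x y)\<^sup>2)"
      using fin sub by (intro sum_mono2) auto
    also have "\<dots> = (\<Sum>x\<in>V. \<Sum>y\<in>D. \<Sum>y'\<in>D. b y * b y' * (K x y * K x y'))"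
      unfolding power2_eq_square sum_product by (simp add: mult_ac)
    also have "\<dots> = (\<Sum>y\<in>D. \<Sum>y'\<in>D. b y * b y' * (\<Sum>x\<in>V. K x y * K x y'))"
      by (subst sum_swap3) (simp only: sum_distrib_left)
    also have "\<dots> \<le> (\<Sum>y\<in>D. \<Sum>y'\<in>D. (if y' = y then 2 * Q * (b y)\<^sup>2 else 0) + 2 * (b y * b y'))"
    proof (intro sum_mono)
      fix y y' assume y: "y \<in> D" "y' \<in> D"
      then have V: "y \<in> V" "y' \<in> V" using sub by auto
      show "b y * b y' * (\<Sum>x\<in>V. K x y * K x y') \<le> (if y' = y then 2 * Q * (b y)\<^sup>2 else 0) + 2 * (b y * b y')"
      proof (cases "y' = y")
        case True
        have "(\<Sum>x\<in>V. K x y * K x y) = (\<Sum>x\<in>V. K x y)" using K V by (intro sum.cong refl) force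
        then have "b y * b y * (\<Sum>x\<in>V. K x y * K x y) \<le> b y * b y * (2 * Q)"
          using row[OF V(1)] b[OF y(1)] by (intro mult_left_mono) auto
        also have "\<dots> = 2 * Q * (b y)\<^sup>2" by (simp add: power2_eq_square)
        finally have le: "b y * b y * (\<Sum>x\<in>V. K x y * K x y) \<le> 2 * Q * (b y)\<^sup>2" .
        have "0 \<le> 2 * (b y * b y)" using b[OF y(1)] by simp
        from add_increasing2[OF this le] show ?thesis using True by simp
      next
        case False
        then have "b y * b y' * (\<Sum>x\<in>V. K x y * K x y') \<le> b y * b y' * 2"
          using two[OF V] b y by (intro mult_left_mono) auto
        then show ?thesis using False by simp
      qed
    qed
    also have "\<dots> = 2 * Q * (\<Sum>y\<in>D. (b y)\<^sup>2) + 2 * ((\<Sum>y\<in>D. b y) * (\<Sum>y\<in>D. b y))"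
      unfolding sum.distrib sum_mult_product using fin by (simp add: sum_distrib_left)
    also have "\<dots> = (sqrt (2 * Q) * sqrt (\<Sum>y\<in>D. (b y)\<^sup>2))\<^sup>2 + (sqrt 2 * (\<Sum>y\<in>D. b y))\<^sup>2"
      using Q by (simp add: power_mult_distrib sum_nonneg power2_eq_square[of "sum b D"])
    also have "\<dots> \<le> (sqrt (2 * Q) * sqrt (\<Sum>y\<in>D. (b y)\<^sup>2) + sqrt 2 * (\<Sum>y\<in>D. b y))\<^sup>2"
      using Q sB by (simp add: power2_sum sum_nonneg)
    finally show "sqrt (\<Sum>x\<in>A. (\<Sum>y\<in>D. b y * K x y)\<^sup>2) \<le> sqrt (2 * Q) * sqrt (\<Sum>y\<in>D. (b y)\<^sup>2) + sqrt 2 * (\<Sum>y\<in>D. b y)"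
      using Q sB by (intro real_le_lsqrt) (auto intro!: add_nonneg_nonneg mult_nonneg_nonneg sum_nonneg)
  qed (simp add: sum_nonneg)
  finally show ?thesis .
qed

text \<open>The two-path part of the block \<open>(i, j)\<close> of a graph without many common neighbours is
  controlled for \<open>i \<le> j\<close> by the geometric sum over \<open>i\<close>, since only values above \<open>h\<close> occur.\<close>

lemma dyadic_mixed_blocks:
  fixes f g :: "'x \<Rightarrow> real"
  assumes fin: "finite X" "finite Y" and h: "0 < h"
    and f: "\<And>x. x \<in> X \<Longrightarrow> h < f x" and g: "\<And>y. y \<in> Y \<Longrightarrow> h < g y"
    and F: "(\<Sum>x\<in>X. f x powr (3/2)) \<le> 1" and G: "(\<Sum>y\<in>Y. g y powr (3/2)) \<le> 1"
  defines "r \<equiv> 2 powr (1/4)"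
  shows "(\<Sum>j\<in>dyadic_level g ` Y. \<Sum>i\<in>dyadic_level f ` X. if i \<le> j then
      sqrt (\<Sum>x\<in>{x\<in>X. dyadic_level f x = i}. (f x)\<^sup>2) * (\<Sum>y\<in>{y\<in>Y. dyadic_level g y = j}. g y) else 0)
    \<le> r ^ 3 / (r - 1) * h powr (-1/4)"
proof -
  let ?I = "dyadic_level f ` X" and ?J = "dyadic_level g ` Y"
  define Gj where "Gj j = (\<Sum>y\<in>{y\<in>Y. dyadic_level g y = j}. g y powr (3/2))" for j
  have r1: "1 < r" unfolding r_def by simp
  have f0: "\<And>x. x \<in> X \<Longrightarrow> 0 < f x" and g0: "\<And>y. y \<in> Y \<Longrightarrow> 0 < g y" using f g h by force+
  have G0: "0 \<le> Gj j" for j unfolding Gj_def by (intro sum_nonneg) auto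
  have sG: "(\<Sum>j\<in>?J. Gj j) \<le> 1" unfolding Gj_def sum_dyadic_group[OF fin(2)] by (rule G)
  have rp: "r powr s = 2 powr (s / 4)" for s unfolding r_def powr_powr by simp
  have a: "sqrt (\<Sum>x\<in>{x\<in>X. dyadic_level f x = i}. (f x)\<^sup>2) \<le> r * r powr i" for i
  proof -
    have "(\<Sum>x\<in>{x\<in>X. dyadic_level f x = i}. (f x)\<^sup>2) = (\<Sum>x\<in>{x\<in>X. dyadic_level f x = i}. f x powr 2)"
      using f0 by (intro sum.cong refl) (simp add: less_imp_le)
    also have "\<dots> \<le> 2 powr ((real_of_int i + 1) * (2 - 3/2)) * (\<Sum>x\<in>{x\<in>X. dyadic_level f x = i}. f x powr (3/2))"
      using f0 by (intro dyadic_powr_sum_le) auto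
    also have "\<dots> \<le> 2 powr ((real_of_int i + 1) * (2 - 3/2)) * 1"
    proof (intro mult_left_mono)
      have "(\<Sum>x\<in>{x\<in>X. dyadic_level f x = i}. f x powr (3/2)) \<le> (\<Sum>x\<in>X. f x powr (3/2))"
        using fin by (intro sum_mono2) auto
      then show "(\<Sum>x\<in>{x\<in>X. dyadic_level f x = i}. f x powr (3/2)) \<le> 1" using F by linarith
    qed simp
    also have "\<dots> = (r powr (real_of_int i + 1))\<^sup>2"
      unfolding rp power2_eq_square powr_add[symmetric] by simp
    also have "r powr (real_of_int i + 1) = r * r powr i" using r1 by (simp add: powr_add)
    finally show ?thesis using r1 by (intro real_le_lsqrt) (auto intro!: sum_nonneg mult_nonneg_nonneg)
  qed
  \<comment> \<open>The l1 norm of a level is traded for its l^(3/2) mass at the price of the power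
    -1/2, which the lower end of the level controls.\<close>
  have b: "(\<Sum>y\<in>{y\<in>Y. dyadic_level g y = j}. g y) \<le> 2 powr (- real_of_int j / 2) * Gj j" for j
    unfolding Gj_def sum_distrib_left
  proof (intro sum_mono)
    fix y assume y: "y \<in> {y\<in>Y. dyadic_level g y = j}"
    then have "2 powr real_of_int j \<le> g y" "0 < g y" using dyadic_level_bounds(1)[of g y] g0[of y] by auto
    then have "g y powr (-1/2) \<le> (2 powr real_of_int j) powr (-1/2)" by (intro powr_mono2') auto
    then have "g y powr (-1/2) \<le> 2 powr (- real_of_int j / 2)" by (simp add: powr_powr)
    then have "g y powr (-1/2) * g y powr (3/2) \<le> 2 powr (- real_of_int j / 2) * g y powr (3/2)"
      by (rule mult_right_mono) simp
    then show "g y \<le> 2 powr (- real_of_int j / 2) * g y powr (3/2)"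
      using \<open>0 < g y\<close> by (simp add: powr_add[symmetric])
  qed
  \<comment> \<open>Only levels with 2^(j+1) > h occur. This bounds the power 2^(-j/4) that is left
    after 2^(-j/2) has met the sum of 2^(i/4) over i \<le> j.\<close>
  have lev: "2 powr (- real_of_int j / 4) \<le> r * h powr (-1/4)" if j: "j \<in> ?J" for j
  proof -
    obtain y where y: "y \<in> Y" "j = dyadic_level g y" using j by auto
    have "h < 2 powr (real_of_int j + 1)" using dyadic_level_bounds(2)[of g y] g0[OF y(1)] g[OF y(1)] y(2) by simp
    then have "(2 powr (real_of_int j + 1)) powr (-1/4) \<le> h powr (-1/4)"
      using h by (intro powr_mono2') auto
    moreover have "(real_of_int j + 1) * (-1/4) = - real_of_int j / 4 - 1/4" by (simp add: field_simps)
    ultimately have "2 powr (- real_of_int j / 4 - 1/4) \<le> h powr (-1/4)" by (simp only: powr_powr)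
    then have "2 powr (1/4) * 2 powr (- real_of_int j / 4 - 1/4) \<le> r * h powr (-1/4)"
      unfolding r_def by (intro mult_left_mono) auto
    then show ?thesis by (simp add: powr_add[symmetric])
  qed
  have "(\<Sum>j\<in>?J. \<Sum>i\<in>?I. if i \<le> j then
      sqrt (\<Sum>x\<in>{x\<in>X. dyadic_level f x = i}. (f x)\<^sup>2) * (\<Sum>y\<in>{y\<in>Y. dyadic_level g y = j}. g y) else 0)
    \<le> (\<Sum>j\<in>?J. \<Sum>i\<in>?I. if i < j + 1 then (r * r powr i) * (2 powr (- real_of_int j / 2) * Gj j) else 0)"
  proof (intro sum_mono)
    fix i j
    have "sqrt (\<Sum>x\<in>{x\<in>X. dyadic_level f x = i}. (f x)\<^sup>2) * (\<Sum>y\<in>{y\<in>Y. dyadic_level g y = j}. g y)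
      \<le> (r * r powr i) * (2 powr (- real_of_int j / 2) * Gj j)"
      using r1 by (intro mult_mono a b) (auto intro!: sum_nonneg less_imp_le[OF g0])
    then show "(if i \<le> j then sqrt (\<Sum>x\<in>{x\<in>X. dyadic_level f x = i}. (f x)\<^sup>2) * (\<Sum>y\<in>{y\<in>Y. dyadic_level g y = j}. g y) else 0)
      \<le> (if i < j + 1 then (r * r powr i) * (2 powr (- real_of_int j / 2) * Gj j) else 0)" by simp
  qed
  also have "\<dots> = (\<Sum>j\<in>?J. r * (2 powr (- real_of_int j / 2) * Gj j) * (\<Sum>i\<in>{i\<in>?I. i < j + 1}. r powr i))"
  proof (intro sum.cong refl)
    fix j
    show "(\<Sum>i\<in>?I. if i < j + 1 then (r * r powr i) * (2 powr (- real_of_int j / 2) * Gj j) else 0) =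
      r * (2 powr (- real_of_int j / 2) * Gj j) * (\<Sum>i\<in>{i\<in>?I. i < j + 1}. r powr i)"
      unfolding sum.inter_filter[OF finite_imageI[OF fin(1)]] sum_distrib_left
      by (intro sum.cong refl) simp
  qed
  also have "\<dots> \<le> (\<Sum>j\<in>?J. r * (2 powr (- real_of_int j / 2) * Gj j) * (r powr (j + 1) / (r - 1)))"
    using r1 G0 fin by (intro sum_mono mult_left_mono order_trans[OF sum_powr_int_less]) auto
  also have "\<dots> = (\<Sum>j\<in>?J. (r\<^sup>2 / (r - 1)) * (2 powr (- real_of_int j / 4) * Gj j))"
  proof (intro sum.cong refl)
    fix j :: int
    have "2 powr (- real_of_int j / 2) * r powr (j + 1) = r * 2 powr (- real_of_int j / 4)"
    proof -
      have "2 powr (- real_of_int j / 2) * r powr (j + 1) = 2 powr (- real_of_int j / 2 + (real_of_int j + 1) / 4)"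
        unfolding rp powr_add by simp
      also have "- real_of_int j / 2 + (real_of_int j + 1) / 4 = 1 / 4 + - real_of_int j / 4" by (simp add: field_simps)
      finally show ?thesis by (simp only: r_def powr_add)
    qed
    then have "r * Gj j / (r - 1) * (2 powr (- real_of_int j / 2) * r powr (j + 1)) = r * Gj j / (r - 1) * (r * 2 powr (- real_of_int j / 4))"
      by simp
    then show "r * (2 powr (- real_of_int j / 2) * Gj j) * (r powr (j + 1) / (r - 1)) = (r\<^sup>2 / (r - 1)) * (2 powr (- real_of_int j / 4) * Gj j)"
      by (simp add: power2_eq_square mult_ac)
  qed
  also have "\<dots> \<le> (\<Sum>j\<in>?J. (r\<^sup>2 / (r - 1)) * ((r * h powr (-1/4)) * Gj j))"
    using r1 G0 lev by (intro sum_mono mult_left_mono mult_right_mono) auto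
  also have "\<dots> = r ^ 3 / (r - 1) * h powr (-1/4) * (\<Sum>j\<in>?J. Gj j)"
    unfolding sum_distrib_left by (intro sum.cong refl) (simp add: power2_eq_square power3_eq_cube)
  also have "\<dots> \<le> r ^ 3 / (r - 1) * h powr (-1/4) * 1"
    using r1 sG by (intro mult_left_mono) auto
  finally show ?thesis by simp
qed

text \<open>The 5 collects 2 + 2 from the two parts with small values and 1 from the pairs with
  large product. The second summand is the l2 term, with sqrt 2 rounded up to 2; the third is the
  two mixed sums over i \<le> j and j \<le> i, rounded likewise.\<close>

definition incidence_const :: real where
  "incidence_const = (let r = 2 powr (1/4) in 5 + 2 * (r ^ 3 / (r - 1)) + 4 * (r ^ 3 / (r - 1)))"

text \<open>Values of at most h are handled by the degree bound alone. Above h the mixed l2-l1 term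
  of \<open>incidence_L2\<close> becomes summable over the levels, and the remaining terms are
  treated as in the interpolation.\<close>

lemma incidence_strong_type:
  fixes K :: "'x \<Rightarrow> 'x \<Rightarrow> real"
  assumes fin: "finite V" and card: "real (card V) \<le> Q\<^sup>2" and Q: "1 \<le> Q"
    and K: "\<And>x y. x \<in> V \<Longrightarrow> y \<in> V \<Longrightarrow> K x y = 0 \<or> K x y = 1"
    and sym: "\<And>x y. x \<in> V \<Longrightarrow> y \<in> V \<Longrightarrow> K x y = K y x"
    and row: "\<And>y. y \<in> V \<Longrightarrow> (\<Sum>x\<in>V. K x y) \<le> 2 * Q"
    and two: "\<And>y y'. y \<in> V \<Longrightarrow> y' \<in> V \<Longrightarrow> y \<noteq> y' \<Longrightarrow> (\<Sum>x\<in>V. K x y * K x y') \<le> 2"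
    and f: "\<And>x. x \<in> V \<Longrightarrow> 0 \<le> f x" and g: "\<And>x. x \<in> V \<Longrightarrow> 0 \<le> g x"
  shows "cmod (\<Sum>x\<in>V. \<Sum>y\<in>V. of_real (f x * g y) * of_real (K x y)) \<le> incidence_const * Q powr (1/3) *
    (\<Sum>x\<in>V. f x powr (3/2)) powr (1 / (3/2)) * (\<Sum>x\<in>V. g x powr (3/2)) powr (1 / (3/2))"
proof (rule bilinear_scale[OF fin fin])
  fix f g :: "'x \<Rightarrow> real"
  assume f: "\<And>x. x \<in> V \<Longrightarrow> 0 \<le> f x" and g: "\<And>y. y \<in> V \<Longrightarrow> 0 \<le> g y"
    and F: "(\<Sum>x\<in>V. f x powr (3/2)) \<le> 1" and G: "(\<Sum>y\<in>V. g y powr (3/2)) \<le> 1"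
  \<comment> \<open>The height of a constant function with unit l^(3/2) norm on Q^2 points.\<close>
  define h where "h = Q powr (-4/3)"
  define r where "r = (2::real) powr (1/4)"
  \<comment> \<open>2^m is about Q^(-2/3), which balances 2^(-m/2) from the large products against
    sqrt Q * 2^(m/4) from the l2 term; both are then of size Q^(1/3).\<close>
  define m where "m = \<lceil>- (2/3) * log 2 Q\<rceil>"
  define X where "X = {x\<in>V. h < f x}"
  define Y where "Y = {y\<in>V. h < g y}"
  have h0: "0 < h" using Q by (simp add: h_def)
  have r1: "1 < r" unfolding r_def by simp
  have fX: "finite X" "finite Y" "X \<subseteq> V" "Y \<subseteq> V" using fin by (auto simp: X_def Y_def)
  have K0: "0 \<le> K x y" if "x \<in> V" "y \<in> V" for x y using K[OF that] by auto
  have l1: "(\<Sum>x\<in>V. e x) \<le> Q powr (2/3)"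
    if e: "\<And>x. x \<in> V \<Longrightarrow> 0 \<le> e x" "(\<Sum>x\<in>V. e x powr (3/2)) \<le> 1" for e
  proof -
    have "(\<Sum>x\<in>V. e x) \<le> real (card V) powr (1 - 1 / (3/2)) * (\<Sum>x\<in>V. e x powr (3/2)) powr (1 / (3/2))"
      using e by (intro sum_le_card_powr fin) auto
    also have "\<dots> \<le> (Q\<^sup>2) powr (1/3) * 1"
    proof (intro mult_mono)
      show "real (card V) powr (1 - 1 / (3/2)) \<le> (Q\<^sup>2) powr (1/3)" using card by (simp add: powr_mono2)
      show "(\<Sum>x\<in>V. e x powr (3/2)) powr (1 / (3/2)) \<le> 1" using powr_mono2[of "1 / (3/2)" "\<Sum>x\<in>V. e x powr (3/2)" 1] e by (simp add: sum_nonneg)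
    qed auto
    also have "\<dots> = Q powr (2/3)"
    proof -
      have "(Q powr 2) powr (1/3) = Q powr (2/3)" unfolding powr_powr by simp
      then show ?thesis using Q by simp
    qed
    finally show ?thesis .
  qed
  have hQ: "h * (2 * Q) * Q powr (2/3) = 2 * Q powr (1/3)"
  proof -
    have "h * Q * Q powr (2/3) = Q powr (-4/3) * Q powr 1 * Q powr (2/3)" using Q by (simp add: h_def)
    also have "\<dots> = Q powr (1/3)" by (simp only: powr_add[symmetric]) simp
    finally show ?thesis by simp
  qed
  have small: "(\<Sum>x\<in>{x\<in>V. \<not> h < a x}. \<Sum>y\<in>V. a x * b y * K x y) \<le> 2 * Q powr (1/3)"
    if a: "\<And>x. x \<in> V \<Longrightarrow> 0 \<le> a x" and b: "\<And>x. x \<in> V \<Longrightarrow> 0 \<le> b x" "(\<Sum>x\<in>V. b x powr (3/2)) \<le> 1" for a b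
  proof -
    have "(\<Sum>x\<in>{x\<in>V. \<not> h < a x}. \<Sum>y\<in>V. a x * b y * K x y) \<le> (\<Sum>x\<in>{x\<in>V. \<not> h < a x}. \<Sum>y\<in>V. h * b y * K x y)"
      using b K0 by (intro sum_mono mult_right_mono) auto
    also have "\<dots> \<le> (\<Sum>x\<in>V. \<Sum>y\<in>V. h * b y * K x y)"
      using fin h0 b K0 by (intro sum_mono2) (auto intro!: sum_nonneg)
    also have "\<dots> = (\<Sum>y\<in>V. h * b y * (\<Sum>x\<in>V. K x y))"
      by (subst sum.swap) (simp only: sum_distrib_left)
    also have "\<dots> \<le> (\<Sum>y\<in>V. h * b y * (2 * Q))"
      using h0 b row by (intro sum_mono mult_left_mono) auto
    also have "\<dots> = h * (2 * Q) * (\<Sum>y\<in>V. b y)" unfolding sum_distrib_left by (intro sum.cong refl) simp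
    also have "\<dots> \<le> h * (2 * Q) * Q powr (2/3)" using h0 Q l1[of b] b by (intro mult_left_mono) auto
    finally show ?thesis unfolding hQ .
  qed
  have F': "(\<Sum>x\<in>X. f x powr (3/2)) \<le> 1" "(\<Sum>y\<in>Y. g y powr (3/2)) \<le> 1"
  proof -
    have "(\<Sum>x\<in>X. f x powr (3/2)) \<le> (\<Sum>x\<in>V. f x powr (3/2))" using fX fin by (intro sum_mono2) auto
    then show "(\<Sum>x\<in>X. f x powr (3/2)) \<le> 1" using F by linarith
    have "(\<Sum>y\<in>Y. g y powr (3/2)) \<le> (\<Sum>y\<in>V. g y powr (3/2))" using fX fin by (intro sum_mono2) auto
    then show "(\<Sum>y\<in>Y. g y powr (3/2)) \<le> 1" using G by linarith
  qed
  have pos: "\<And>x. x \<in> X \<Longrightarrow> 0 < f x" "\<And>y. y \<in> Y \<Longrightarrow> 0 < g y" using h0 by (auto simp: X_def Y_def)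
  let ?I = "dyadic_level f ` X" and ?J = "dyadic_level g ` Y"
  define Xi where "Xi i = {x\<in>X. dyadic_level f x = i}" for i
  define Yj where "Yj j = {y\<in>Y. dyadic_level g y = j}" for j
  have fXi: "finite (Xi i)" "finite (Yj j)" "Xi i \<subseteq> V" "Yj j \<subseteq> V" for i j
    using fX by (auto simp: Xi_def Yj_def)
  define k where "k x y = complex_of_real (K x y)" for x y
  define n2f where "n2f i = sqrt (\<Sum>x\<in>Xi i. (f x)\<^sup>2)" for i
  define n2g where "n2g j = sqrt (\<Sum>y\<in>Yj j. (g y)\<^sup>2)" for j
  define n1f where "n1f i = (\<Sum>x\<in>Xi i. f x)" for i
  define n1g where "n1g j = (\<Sum>y\<in>Yj j. g y)" for j
  have nn: "0 \<le> n2f i" "0 \<le> n2g i" "0 \<le> n1f i" "0 \<le> n1g i" for i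
    unfolding n2f_def n2g_def n1f_def n1g_def Xi_def Yj_def by (auto intro!: sum_nonneg less_imp_le[OF pos(1)] less_imp_le[OF pos(2)])
  have fXi0: "\<And>x. x \<in> Xi i \<Longrightarrow> 0 \<le> f x" and gYj0: "\<And>y. y \<in> Yj j \<Longrightarrow> 0 \<le> g y" for i j
    using f g fXi(3)[of i] fXi(4)[of j] by blast+
  \<comment> \<open>Cauchy-Schwarz may be applied in either variable. The choice puts the l1 norm on
    the higher of the two levels, the situation of \<open>dyadic_mixed_blocks\<close>.\<close>
  have blk: "cmod (block X f Y g k i j) \<le> sqrt (2 * Q) * (n2f i * n2g j) +
      sqrt 2 * ((if i \<le> j then n2f i * n1g j else 0) + (if j \<le> i then n2g j * n1f i else 0))" for i j
  proof -
    define S where "S = (\<Sum>x\<in>Xi i. \<Sum>y\<in>Yj j. f x * g y * K x y)"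
    have "block X f Y g k i j = of_real S"
      unfolding block_def k_def S_def Xi_def Yj_def by simp
    moreover have "0 \<le> S" unfolding S_def
    proof (intro sum_nonneg mult_nonneg_nonneg)
      fix x y assume xy: "x \<in> Xi i" "y \<in> Yj j"
      show "0 \<le> f x" "0 \<le> g y" "0 \<le> K x y" using xy f g K0 fXi(3)[of i] fXi(4)[of j] by blast+
    qed
    ultimately have "cmod (block X f Y g k i j) = S" by simp
    moreover have S1: "S \<le> n2f i * (sqrt (2 * Q) * n2g j + sqrt 2 * n1g j)"
      unfolding S_def n2f_def n2g_def n1g_def
      by (rule incidence_L2[OF fXi(1,2) fin fXi(3,4)]) (use Q K row two gYj0 in auto)
    moreover have S2: "S \<le> n2g j * (sqrt (2 * Q) * n2f i + sqrt 2 * n1f i)"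
    proof -
      have "S = (\<Sum>y\<in>Yj j. \<Sum>x\<in>Xi i. g y * f x * K y x)"
        unfolding S_def
      proof (subst sum.swap, intro sum.cong refl)
        fix y x assume "y \<in> Yj j" "x \<in> Xi i"
        then have "K x y = K y x" using sym fXi(3)[of i] fXi(4)[of j] by blast
        then show "f x * g y * K x y = g y * f x * K y x" by simp
      qed
      then show ?thesis
        unfolding n2f_def n2g_def n1f_def
        by (simp only:) (rule incidence_L2[OF fXi(2,1) fin fXi(4,3)], use Q K row two fXi0 in auto)
    qed
    moreover have "S \<le> sqrt (2 * Q) * (n2f i * n2g j) +
      sqrt 2 * ((if i \<le> j then n2f i * n1g j else 0) + (if j \<le> i then n2g j * n1f i else 0))"
    proof (cases "i \<le> j")
      case True
      have "S \<le> sqrt (2 * Q) * (n2f i * n2g j) + sqrt 2 * (n2f i * n1g j)"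
        using S1 by (simp add: algebra_simps)
      also have "\<dots> \<le> sqrt (2 * Q) * (n2f i * n2g j) +
          sqrt 2 * ((if i \<le> j then n2f i * n1g j else 0) + (if j \<le> i then n2g j * n1f i else 0))"
        using True nn by (intro add_left_mono mult_left_mono) auto
      finally show ?thesis .
    next
      case False
      have "S \<le> sqrt (2 * Q) * (n2f i * n2g j) + sqrt 2 * (n2g j * n1f i)"
        using S2 by (simp add: algebra_simps)
      then show ?thesis using False by simp
    qed
    ultimately show ?thesis by simp
  qed
  have "(\<Sum>x\<in>V. \<Sum>y\<in>V. f x * g y * K x y) \<le> 4 * Q powr (1/3) + (\<Sum>x\<in>X. \<Sum>y\<in>Y. f x * g y * K x y)"
  proof -
    have "(\<Sum>x\<in>V. \<Sum>y\<in>V. f x * g y * K x y) =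
        (\<Sum>x\<in>X. \<Sum>y\<in>V. f x * g y * K x y) + (\<Sum>x\<in>{x\<in>V. \<not> h < f x}. \<Sum>y\<in>V. f x * g y * K x y)"
      unfolding X_def by (subst sum.union_disjoint[symmetric]) (use fin in \<open>auto intro!: sum.cong\<close>)
    moreover have "(\<Sum>x\<in>X. \<Sum>y\<in>V. f x * g y * K x y) = (\<Sum>x\<in>X. \<Sum>y\<in>Y. f x * g y * K x y) + (\<Sum>x\<in>X. \<Sum>y\<in>{y\<in>V. \<not> h < g y}. f x * g y * K x y)"
      unfolding Y_def sum.distrib[symmetric]
      by (intro sum.cong refl, subst sum.union_disjoint[symmetric]) (use fin in \<open>auto intro!: sum.cong\<close>)
    moreover have "(\<Sum>x\<in>X. \<Sum>y\<in>{y\<in>V. \<not> h < g y}. f x * g y * K x y) \<le> 2 * Q powr (1/3)"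
    proof -
      have "(\<Sum>x\<in>X. \<Sum>y\<in>{y\<in>V. \<not> h < g y}. f x * g y * K x y) \<le> (\<Sum>x\<in>V. \<Sum>y\<in>{y\<in>V. \<not> h < g y}. f x * g y * K x y)"
        using fX fin f g K0 by (intro sum_mono2) (auto intro!: sum_nonneg)
      also have "\<dots> = (\<Sum>y\<in>{y\<in>V. \<not> h < g y}. \<Sum>x\<in>V. g y * f x * K y x)"
        by (subst sum.swap, intro sum.cong refl) (use sym in \<open>auto simp: mult_ac\<close>)
      also have "\<dots> \<le> 2 * Q powr (1/3)" by (rule small) (use f g F in auto)
      finally show ?thesis .
    qed
    moreover have "(\<Sum>x\<in>{x\<in>V. \<not> h < f x}. \<Sum>y\<in>V. f x * g y * K x y) \<le> 2 * Q powr (1/3)"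
      by (rule small) (use f g G in auto)
    ultimately show ?thesis by linarith
  qed
  also have "(\<Sum>x\<in>X. \<Sum>y\<in>Y. f x * g y * K x y) \<le> cmod (\<Sum>x\<in>X. \<Sum>y\<in>Y. of_real (f x * g y) * k x y)"
  proof -
    have "(\<Sum>x\<in>X. \<Sum>y\<in>Y. of_real (f x * g y) * k x y) = of_real (\<Sum>x\<in>X. \<Sum>y\<in>Y. f x * g y * K x y)"
      unfolding k_def by simp
    then show ?thesis by (simp only: norm_of_real abs_ge_self)
  qed
  also have "\<dots> \<le> 1 * 2 powr (m * (1 - 3/2)) + (\<Sum>i\<in>?I. \<Sum>j\<in>?J. if i + j < m then cmod (block X f Y g k i j) else 0)"
  proof (rule dyadic_split[OF fX(1,2) pos F'])
    fix x y assume "x \<in> X" "y \<in> Y"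
    then have "x \<in> V" "y \<in> V" using fX by auto
    then show "cmod (k x y) \<le> 1" using K[of x y] by (auto simp: k_def)
  qed auto
  also have "\<dots> \<le> Q powr (1/3) + (2 * (r ^ 3 / (r - 1)) * Q powr (1/3) + 4 * (r ^ 3 / (r - 1)) * Q powr (1/3))"
  proof (intro add_mono)
    have L: "2 powr log 2 Q = Q" using Q by simp
    have m: "- (2/3) * log 2 Q \<le> m" "m \<le> - (2/3) * log 2 Q + 1" unfolding m_def by linarith+
    have "1 * 2 powr (m * (1 - 3/2)) \<le> 2 powr (log 2 Q * (1/3))"
      using m(1) by (simp add: powr_mono)
    also have "\<dots> = Q powr (1/3)" unfolding powr_powr[symmetric] L ..
    finally show "1 * 2 powr (m * (1 - 3/2)) \<le> Q powr (1/3)" .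
    have rm: "r powr m \<le> r * Q powr (-1/6)"
    proof -
      have "r powr m = 2 powr (1/4 * m)" unfolding r_def powr_powr ..
      also have "\<dots> \<le> 2 powr (log 2 Q * (-1/6) + 1/4)" using m(2) by (intro powr_mono) auto
      also have "\<dots> = Q powr (-1/6) * r" unfolding powr_add powr_powr[symmetric] L r_def ..
      finally show ?thesis by (simp add: mult.commute)
    qed
    have h14: "h powr (-1/4) = Q powr (1/3)" unfolding h_def powr_powr by simp
    have "(\<Sum>i\<in>?I. \<Sum>j\<in>?J. if i + j < m then cmod (block X f Y g k i j) else 0) \<le>
      (\<Sum>i\<in>?I. \<Sum>j\<in>?J. sqrt (2 * Q) * (if i + j < m then n2f i * n2g j else 0) +
      sqrt 2 * ((if i \<le> j then n2f i * n1g j else 0) + (if j \<le> i then n2g j * n1f i else 0)))"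
    proof (intro sum_mono)
      fix i j
      have "0 \<le> sqrt 2 * ((if i \<le> j then n2f i * n1g j else 0) + (if j \<le> i then n2g j * n1f i else 0))"
        using nn by auto
      then show "(if i + j < m then cmod (block X f Y g k i j) else 0) \<le> sqrt (2 * Q) * (if i + j < m then n2f i * n2g j else 0) +
        sqrt 2 * ((if i \<le> j then n2f i * n1g j else 0) + (if j \<le> i then n2g j * n1f i else 0))"
        using blk[of i j] by auto
    qed
    also have "\<dots> = sqrt (2 * Q) * (\<Sum>i\<in>?I. \<Sum>j\<in>?J. if i + j < m then n2f i * n2g j else 0) +
      sqrt 2 * ((\<Sum>j\<in>?J. \<Sum>i\<in>?I. if i \<le> j then n2f i * n1g j else 0) + (\<Sum>i\<in>?I. \<Sum>j\<in>?J. if j \<le> i then n2g j * n1f i else 0))"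
      by (subst (2) sum.swap) (simp only: sum.distrib sum_distrib_left[symmetric])
    also have "\<dots> \<le> sqrt (2 * Q) * (r\<^sup>2 / (r - 1) * r powr m) + sqrt 2 * (r ^ 3 / (r - 1) * h powr (-1/4) + r ^ 3 / (r - 1) * h powr (-1/4))"
    proof (intro add_mono mult_left_mono)
      have "2 powr ((2 - 3/2) / 2) = r" unfolding r_def by simp
      with dyadic_L2_blocks[OF fX(1,2) pos F', of m]
      show "(\<Sum>i\<in>?I. \<Sum>j\<in>?J. if i + j < m then n2f i * n2g j else 0) \<le> r\<^sup>2 / (r - 1) * r powr m"
        unfolding n2f_def n2g_def Xi_def Yj_def by simp
      show "(\<Sum>j\<in>?J. \<Sum>i\<in>?I. if i \<le> j then n2f i * n1g j else 0) \<le> r ^ 3 / (r - 1) * h powr (-1/4)"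
        unfolding n2f_def n1g_def Xi_def Yj_def r_def
        by (rule dyadic_mixed_blocks[OF fX(1,2) h0 _ _ F']) (auto simp: X_def Y_def)
      show "(\<Sum>i\<in>?I. \<Sum>j\<in>?J. if j \<le> i then n2g j * n1f i else 0) \<le> r ^ 3 / (r - 1) * h powr (-1/4)"
        unfolding n2g_def n1f_def Xi_def Yj_def r_def
        by (rule dyadic_mixed_blocks[OF fX(2,1) h0 _ _ F'(2,1)]) (auto simp: X_def Y_def)
    qed (use Q in auto)
    also have "\<dots> \<le> 2 * (r ^ 3 / (r - 1)) * Q powr (1/3) + 4 * (r ^ 3 / (r - 1)) * Q powr (1/3)"
    proof (intro add_mono)
      have s2: "sqrt 2 \<le> 2" by (rule real_le_lsqrt) auto
      have "sqrt (2 * Q) * (r\<^sup>2 / (r - 1) * r powr m) \<le> (2 * Q powr (1/2)) * (r\<^sup>2 / (r - 1) * (r * Q powr (-1/6)))"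
        using rm r1 Q s2 by (intro mult_mono mult_left_mono) (auto simp: real_sqrt_mult powr_half_sqrt)
      also have "\<dots> = 2 * (r ^ 3 / (r - 1)) * (Q powr (1/2) * Q powr (-1/6))"
        by (simp add: power2_eq_square power3_eq_cube)
      also have "Q powr (1/2) * Q powr (-1/6) = Q powr (1/3)" by (simp only: powr_add[symmetric]) simp
      finally show "sqrt (2 * Q) * (r\<^sup>2 / (r - 1) * r powr m) \<le> 2 * (r ^ 3 / (r - 1)) * Q powr (1/3)" .
      have "sqrt 2 * (2 * (r ^ 3 / (r - 1) * Q powr (1/3))) \<le> 2 * (2 * (r ^ 3 / (r - 1) * Q powr (1/3)))"
        using s2 r1 by (intro mult_right_mono) auto
      then show "sqrt 2 * (r ^ 3 / (r - 1) * h powr (-1/4) + r ^ 3 / (r - 1) * h powr (-1/4)) \<le> 4 * (r ^ 3 / (r - 1)) * Q powr (1/3)"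
        unfolding h14 by (simp add: mult_ac)
    qed
    finally show "(\<Sum>i\<in>?I. \<Sum>j\<in>?J. if i + j < m then cmod (block X f Y g k i j) else 0) \<le> 2 * (r ^ 3 / (r - 1)) * Q powr (1/3) + 4 * (r ^ 3 / (r - 1)) * Q powr (1/3)" .
  qed
  finally have le: "(\<Sum>x\<in>V. \<Sum>y\<in>V. f x * g y * K x y) \<le> incidence_const * Q powr (1/3)"
    unfolding incidence_const_def Let_def r_def[symmetric] by (simp add: algebra_simps)
  have "(\<Sum>x\<in>V. \<Sum>y\<in>V. of_real (f x * g y) * of_real (K x y)) = complex_of_real (\<Sum>x\<in>V. \<Sum>y\<in>V. f x * g y * K x y)"
    by simp
  moreover have "0 \<le> (\<Sum>x\<in>V. \<Sum>y\<in>V. f x * g y * K x y)" using f g K0 by (intro sum_nonneg mult_nonneg_nonneg)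
  ultimately show "cmod (\<Sum>x\<in>V. \<Sum>y\<in>V. of_real (f x * g y) * of_real (K x y)) \<le> incidence_const * Q powr (1/3)"
    using le by (simp only: norm_of_real abs_of_nonneg)
qed (use f g in auto)

section \<open>The critical vertex\<close>

text \<open>Its reciprocal d / (d + 1) is the common coordinate of the point where the two boundary
  lines of the region meet.\<close>

definition crit_exp :: "nat \<Rightarrow> real" where "crit_exp d = (real d + 1) / real d"

lemma crit_exp:
  assumes "2 \<le> d"
  shows "1 < crit_exp d" "crit_exp d < 2" "1 / crit_exp d = d / (d + 1)" "1 - 1 / crit_exp d = 1 / (d + 1)"
    "2 / crit_exp d - 1 = (real d - 1) / (d + 1)" "2 - 2 / crit_exp d = 2 / (d + 1)"
  using assms by (simp_all add: crit_exp_def field_simps)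

text \<open>The ratio of the interpolated bounds for consecutive Kloosterman pieces: the supremum
  halves and the L2 norm doubles, with weights (d - 1) / (d + 1) and 2 / (d + 1). It is below 1
  exactly for d > 3.\<close>

definition level_ratio :: "nat \<Rightarrow> real" where
  "level_ratio d = 2 powr (- (real d - 3) / (d + 1))"

text \<open>In the last two cases the 1 pays for the mean term. The 4 is the constant of the L2
  bound for odd d, and 10 = 5 * 2 combines the constants of supremum and L2 bound of a piece for
  even d; all of them occur with exponents at most 1.\<close>

definition vertex_const :: "nat \<Rightarrow> real" where
  "vertex_const d = (if d = 2 then incidence_const
     else if odd d then 1 + interp_const (crit_exp d) * 4
     else 1 + interp_const (crit_exp d) * 10 / (1 - level_ratio d))"

lemma interp_const_pos: "p < 2 \<Longrightarrow> 0 < interp_const p"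
  unfolding interp_const_def
  using ge_one_powr_ge_zero[of 2 "(2 - p) / 2"] by (intro add_pos_nonneg divide_nonneg_nonneg) auto

lemma powr_le_base: "1 \<le> c \<Longrightarrow> e \<le> 1 \<Longrightarrow> c powr e \<le> c" for c e :: real
  using powr_mono[of e 1 c] by simp

lemma sum_power_le:
  fixes \<rho> :: real
  assumes "0 \<le> \<rho>" "\<rho> < 1" "finite J"
  shows "(\<Sum>j\<in>J. \<rho> ^ j) \<le> 1 / (1 - \<rho>)"
proof -
  have "(\<Sum>j\<in>J. \<rho> ^ j) \<le> (\<Sum>j. \<rho> ^ j)"
    using assms by (intro sum_le_suminf summable_geometric) auto
  then show ?thesis using assms by (simp add: suminf_geometric)
qed

context field_character
begin

lemma q_power_root: "(sqrt q ^ (d - 1)) powr (2 / (real d + 1)) = q powr ((real d - 1) / (real d + 1))" if "1 \<le> d"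
proof -
  have "sqrt q ^ (d - 1) = (q powr (1/2)) powr (real (d - 1))"
    using q_gt_0 by (simp add: powr_half_sqrt powr_realpow)
  also have "\<dots> = q powr ((real d - 1) / 2)" unfolding powr_powr using that by (simp add: of_nat_diff)
  finally have "(sqrt q ^ (d - 1)) powr (2 / (real d + 1)) = q powr ((real d - 1) / 2 * (2 / (real d + 1)))"
    by (simp only: powr_powr)
  also have "(real d - 1) / 2 * (2 / (real d + 1)) = (real d - 1) / (real d + 1)"
  proof -
    have "a / 2 * (2 / b) = a / b" for a b :: real by simp
    then show ?thesis .
  qed
  finally show ?thesis .
qed

text \<open>Hoelder costs q^(d / (d + 1)) for each factor, and the product divided by q is exactly
  the power of q allowed at the vertex.\<close>

lemma mean_term_le:
  fixes f g :: "(nat \<Rightarrow> 'a) \<Rightarrow> real"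
  assumes d: "2 \<le> d" and f: "\<And>x. x \<in> vecs F d \<Longrightarrow> 0 \<le> f x" and g: "\<And>x. x \<in> vecs F d \<Longrightarrow> 0 \<le> g x"
  defines "p \<equiv> crit_exp d"
  shows "(\<Sum>x\<in>vecs F d. f x) * (\<Sum>x\<in>vecs F d. g x) / q \<le> q powr ((real d - 1) / (real d + 1)) *
    ((\<Sum>x\<in>vecs F d. f x powr p) powr (1 / p) * (\<Sum>x\<in>vecs F d. g x powr p) powr (1 / p))"
proof -
  define a where "a = q powr (d / (real d + 1))"
  have card: "real (card (vecs F d)) powr (1 - 1 / p) = a"
    unfolding p_def crit_exp(4)[OF d] card_vecs a_def using q_gt_0 by (simp add: powr_powr flip: powr_realpow)
  have l1: "(\<Sum>x\<in>vecs F d. e x) \<le> a * (\<Sum>x\<in>vecs F d. e x powr p) powr (1 / p)"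
    if "\<And>x. x \<in> vecs F d \<Longrightarrow> 0 \<le> e x" for e
    unfolding card[symmetric] using that crit_exp(1)[OF d] by (intro sum_le_card_powr) (auto simp: p_def)
  have "(\<Sum>x\<in>vecs F d. f x) * (\<Sum>x\<in>vecs F d. g x) \<le>
      (a * (\<Sum>x\<in>vecs F d. f x powr p) powr (1 / p)) * (a * (\<Sum>x\<in>vecs F d. g x powr p) powr (1 / p))"
    using f g by (intro mult_mono l1) (auto intro!: sum_nonneg simp: a_def)
  then have "(\<Sum>x\<in>vecs F d. f x) * (\<Sum>x\<in>vecs F d. g x) / q \<le>
      (a * (\<Sum>x\<in>vecs F d. f x powr p) powr (1 / p)) * (a * (\<Sum>x\<in>vecs F d. g x powr p) powr (1 / p)) / q"
    using q_gt_0 by (intro divide_right_mono) auto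
  also have "\<dots> = (a * a / q) * ((\<Sum>x\<in>vecs F d. f x powr p) powr (1 / p) * (\<Sum>x\<in>vecs F d. g x powr p) powr (1 / p))"
    by simp
  also have "a * a / q = q powr ((real d - 1) / (real d + 1))"
  proof -
    have "a * a / q = q powr (d / (real d + 1) + d / (real d + 1) - 1)"
      unfolding a_def powr_diff powr_add using q_gt_0 by simp
    also have "d / (real d + 1) + d / (real d + 1) - 1 = (real d - 1) / (real d + 1)"
    proof -
      have "(D - 1) / D + (D - 1) / D - 1 = (D - 2) / D" if "D \<noteq> 0" for D :: real
        using that by (simp add: diff_divide_distrib)
      from this[of "real d + 1"] show ?thesis by simp
    qed
    finally show ?thesis .
  qed
  finally show ?thesis .
qed

text \<open>Off the diagonal the kernel is S_t - 1 / q and has supremum at most 1. Its L2 constant 4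
  q^((d-1)/2) has one factor 2 from the Salie sum and one from removing the diagonal.\<close>

lemma sphere_form_odd:
  fixes f g :: "(nat \<Rightarrow> 'a) \<Rightarrow> real"
  assumes d: "2 \<le> d" "odd d" and t: "t \<in> carrier F" "t \<noteq> \<zero>"
    and f: "\<And>x. x \<in> vecs F d \<Longrightarrow> 0 \<le> f x" and g: "\<And>x. x \<in> vecs F d \<Longrightarrow> 0 \<le> g x"
  defines "p \<equiv> crit_exp d"
  shows "cmod (\<Sum>x\<in>vecs F d. \<Sum>y\<in>vecs F d. of_real (f x * g y) * offdiag d (multiplier_kernel d (sphere_mult d t)) x y)
    \<le> interp_const p * 4 * (q powr ((real d - 1) / (real d + 1)) *
      ((\<Sum>x\<in>vecs F d. f x powr p) powr (1 / p) * (\<Sum>x\<in>vecs F d. g x powr p) powr (1 / p)))"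
proof -
  let ?k = "multiplier_kernel d (sphere_mult d t)" and ?V = "vecs F d"
  define N where "N = (\<Sum>x\<in>?V. f x powr p) powr (1 / p) * (\<Sum>x\<in>?V. g x powr p) powr (1 / p)"
  have N0: "0 \<le> N" unfolding N_def by simp
  define \<Lambda> where "\<Lambda> = 4 * sqrt q ^ (d - 1)"
  have \<Lambda>0: "0 < \<Lambda>" using q_gt_0 by (simp add: \<Lambda>_def)
  have "cmod (\<Sum>x\<in>?V. \<Sum>y\<in>?V. of_real (f x * g y) * offdiag d ?k x y) \<le>
     interp_const p * 1 powr (2 / p - 1) * \<Lambda> powr (2 - 2 / p) *
      (\<Sum>x\<in>?V. f x powr p) powr (1 / p) * (\<Sum>y\<in>?V. g y powr p) powr (1 / p)"
  proof (rule bilinear_interpolation)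
    show "cmod (offdiag d ?k x y) \<le> 1" if xy: "x \<in> ?V" "y \<in> ?V" for x y
    proof (cases "x = y")
      case False
      have "?k (vminus F d x y) = of_real (indicat_real (sphere F d t) (vminus F d x y) - 1 / q)"
        using sphere_expansion[of d t "vminus F d x y"] d t vminus_in_vecs[OF xy] by (simp add: algebra_simps)
      then have "offdiag d ?k x y = of_real (indicat_real (sphere F d t) (vminus F d x y) - 1 / q)"
        using False by (simp add: offdiag_def)
      moreover have "\<bar>indicat_real (sphere F d t) (vminus F d x y) - 1 / q\<bar> \<le> 1"
        using order_ge_3 by (simp add: indicator_def field_simps)
      ultimately show ?thesis by (simp only: norm_of_real)
    qed (simp add: offdiag_def)
    show "cmod (\<Sum>x\<in>?V. \<Sum>y\<in>?V. of_real (f x * g y) * offdiag d ?k x y) \<le>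
        \<Lambda> * (sqrt (\<Sum>x\<in>?V. (f x)\<^sup>2) * sqrt (\<Sum>y\<in>?V. (g y)\<^sup>2))" for f g :: "_ \<Rightarrow> real"
      using offdiag_L2[of "sphere_mult d t" "2 * sqrt q ^ (d - 1)" f g d] norm_sphere_mult_odd[OF d(2) t]
      by (simp add: \<Lambda>_def)
  qed (use crit_exp(1,2)[OF d(1)] \<Lambda>0 f g in \<open>auto simp: p_def\<close>)
  also have "\<dots> = interp_const p * \<Lambda> powr (2 - 2 / p) * N" by (simp add: N_def)
  also have "\<dots> \<le> interp_const p * (4 * q powr ((real d - 1) / (real d + 1))) * N"
  proof (intro mult_right_mono mult_left_mono N0)
    have "\<Lambda> powr (2 - 2 / p) = 4 powr (2 / (real d + 1)) * q powr ((real d - 1) / (real d + 1))"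
      unfolding p_def crit_exp(6)[OF d(1)] \<Lambda>_def using d q_gt_0 q_power_root[of d] by (simp add: powr_mult)
    also have "\<dots> \<le> 4 * q powr ((real d - 1) / (real d + 1))"
      using d by (intro mult_right_mono powr_le_base) auto
    finally show "\<Lambda> powr (2 - 2 / p) \<le> 4 * q powr ((real d - 1) / (real d + 1))" .
  qed (use interp_const_pos[of p] crit_exp(2)[OF d(1)] in \<open>auto simp: p_def less_imp_le\<close>)
  finally show ?thesis by (simp add: N_def mult_ac)
qed

section \<open>Dyadic pieces of the multiplier in even dimension\<close>

definition kloosterman_level :: "'a \<Rightarrow> 'a \<Rightarrow> nat" where
  "kloosterman_level t c = (LEAST n. cmod (kloosterman t c) \<le> 2 ^ n * sqrt q)"

lemma kloosterman_level_upper: "cmod (kloosterman t c) \<le> 2 ^ kloosterman_level t c * sqrt q"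
proof -
  obtain n where "cmod (kloosterman t c) / sqrt q < 2 ^ n" using real_arch_pow[of 2 "cmod (kloosterman t c) / sqrt q"] by auto
  then have "cmod (kloosterman t c) \<le> 2 ^ n * sqrt q" using q_gt_0 by (simp add: divide_less_eq less_imp_le)
  then show ?thesis unfolding kloosterman_level_def by (rule LeastI)
qed

lemma kloosterman_level_lower:
  assumes "kloosterman_level t c = Suc n"
  shows "2 ^ n * sqrt q < cmod (kloosterman t c)"
  using not_less_Least[of n "\<lambda>n. cmod (kloosterman t c) \<le> 2 ^ n * sqrt q"] assms
  by (auto simp: kloosterman_level_def)

text \<open>Level 0 holds all sums up to sqrt q and is estimated trivially. For j = n + 1 each sum
  exceeds 2^n * sqrt q, so its square is at most its fourth power divided by 4^n q. The fourth
  moment then gives 24 q^2 / 4^j, and 24 \<le> 25 accounts for the 5.\<close>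

lemma sum_kloosterman_level:
  assumes t: "t \<in> carrier F" "t \<noteq> \<zero>"
  shows "(\<Sum>c\<in>{c\<in>carrier F. kloosterman_level t c = j}. (cmod (kloosterman t c))\<^sup>2) \<le> (5 / 2 ^ j * q)\<^sup>2"
proof (cases j)
  case 0
  have "(\<Sum>c\<in>{c\<in>carrier F. kloosterman_level t c = j}. (cmod (kloosterman t c))\<^sup>2) \<le>
      (\<Sum>c\<in>{c\<in>carrier F. kloosterman_level t c = j}. q)"
  proof (intro sum_mono)
    fix c assume "c \<in> {c\<in>carrier F. kloosterman_level t c = j}"
    then have "cmod (kloosterman t c) \<le> sqrt q" using kloosterman_level_upper[of t c] 0 by simp
    then have "(cmod (kloosterman t c))\<^sup>2 \<le> (sqrt q)\<^sup>2" by (intro power_mono) auto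
    then show "(cmod (kloosterman t c))\<^sup>2 \<le> q" by simp
  qed
  also have "\<dots> \<le> q * q"
  proof -
    have "card {c\<in>carrier F. kloosterman_level t c = j} \<le> order F"
      unfolding Coset.order_def using finite_carrier by (intro card_mono) auto
    then show ?thesis by (simp add: mult_right_mono)
  qed
  also have "\<dots> \<le> (5 * q)\<^sup>2" by (simp add: monoid_mult_class.power2_eq_square)
  finally show ?thesis using 0 by simp
next
  case (Suc n)
  let ?C = "{c\<in>carrier F. kloosterman_level t c = j}"
  have "(4 ^ n * q) * (\<Sum>c\<in>?C. (cmod (kloosterman t c))\<^sup>2) \<le> (\<Sum>c\<in>?C. cmod (kloosterman t c) ^ 4)"
    unfolding sum_distrib_left
  proof (intro sum_mono)
    fix c assume "c \<in> ?C"
    then have "2 ^ n * sqrt q \<le> cmod (kloosterman t c)" using kloosterman_level_lower[of t c n] Suc by simp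
    then have "(2 ^ n * sqrt q)\<^sup>2 \<le> (cmod (kloosterman t c))\<^sup>2" by (intro power_mono) (use q_gt_0 in auto)
    moreover have "(2 ^ n * sqrt q)\<^sup>2 = 4 ^ n * q"
    proof -
      have "((2::real) ^ n)\<^sup>2 = 4 ^ n" unfolding power_mult[symmetric] mult.commute[of n] by (simp add: power_mult)
      then show ?thesis using q_gt_0 by (simp add: power_mult_distrib)
    qed
    ultimately have "4 ^ n * q * (cmod (kloosterman t c))\<^sup>2 \<le> (cmod (kloosterman t c))\<^sup>2 * (cmod (kloosterman t c))\<^sup>2"
      by (intro mult_right_mono) auto
    then show "4 ^ n * q * (cmod (kloosterman t c))\<^sup>2 \<le> cmod (kloosterman t c) ^ 4"
      by (simp add: monoid_mult_class.power2_eq_square power4_eq_xxxx mult_ac)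
  qed
  also have "\<dots> \<le> (\<Sum>c\<in>carrier F. cmod (kloosterman t c) ^ 4)"
    using finite_carrier by (intro sum_mono2) auto
  also have "\<dots> \<le> 6 * q ^ 3" by (rule kloosterman_fourth_moment[OF t])
  also have "\<dots> \<le> (4 ^ n * q) * (25 * q\<^sup>2 / 4 ^ Suc n)"
    using q_gt_0 by (simp add: monoid_mult_class.power2_eq_square power3_eq_cube)
  finally have "(\<Sum>c\<in>?C. (cmod (kloosterman t c))\<^sup>2) \<le> 25 * q\<^sup>2 / 4 ^ Suc n"
    using q_gt_0 by (simp only: mult_le_cancel_left_pos zero_less_mult_iff zero_less_power zero_less_numeral simp_thms)
  also have "\<dots> = (5 / 2 ^ j * q)\<^sup>2"
  proof -
    have "((2::real) ^ Suc n)\<^sup>2 = 4 ^ Suc n" unfolding power_mult[symmetric] mult.commute[of "Suc n"] by (simp add: power_mult)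
    then show ?thesis unfolding Suc power_mult_distrib power_divide by simp
  qed
  finally show ?thesis .
qed

text \<open>Each level of the multiplier is interpolated by itself: the supremum of its kernel comes
  from the l2 norm over the level, hence from the fourth moment, and its L2 norm from the size of
  the Kloosterman sums on the level.\<close>

lemma sphere_form_even:
  fixes f g :: "(nat \<Rightarrow> 'a) \<Rightarrow> real"
  assumes d: "4 \<le> d" "even d" and t: "t \<in> carrier F" "t \<noteq> \<zero>"
    and f: "\<And>x. x \<in> vecs F d \<Longrightarrow> 0 \<le> f x" and g: "\<And>x. x \<in> vecs F d \<Longrightarrow> 0 \<le> g x"
  defines "p \<equiv> crit_exp d"
  shows "cmod (\<Sum>x\<in>vecs F d. \<Sum>y\<in>vecs F d. of_real (f x * g y) * offdiag d (multiplier_kernel d (sphere_mult d t)) x y)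
    \<le> interp_const p * 10 / (1 - level_ratio d) * (q powr ((real d - 1) / (real d + 1)) *
      ((\<Sum>x\<in>vecs F d. f x powr p) powr (1 / p) * (\<Sum>x\<in>vecs F d. g x powr p) powr (1 / p)))"
proof -
  let ?V = "vecs F d" and ?lev = "kloosterman_level t"
  define N where "N = (\<Sum>x\<in>?V. f x powr p) powr (1 / p) * (\<Sum>x\<in>?V. g x powr p) powr (1 / p)"
  have N0: "0 \<le> N" unfolding N_def by simp
  have d2: "2 \<le> d" using d by simp
  have ip: "0 < interp_const p" using interp_const_pos crit_exp(2)[OF d2] by (simp add: p_def)
  define J where "J = ?lev ` carrier F"
  have fJ: "finite J" using finite_carrier by (simp add: J_def)
  define mj where "mj j c = (if ?lev c = j then sphere_mult d t c else 0)" for j c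
  have split: "sphere_mult d t c = (\<Sum>j\<in>J. mj j c)" if "c \<in> carrier F" for c
    unfolding mj_def using fJ that by (simp add: J_def)
  have "offdiag d (multiplier_kernel d (sphere_mult d t)) x y = (\<Sum>j\<in>J. offdiag d (multiplier_kernel d (mj j)) x y)" for x y
  proof -
    have "(\<Sum>\<xi>\<in>?V. sphere_mult d t (sqnorm F d \<xi>) * Psi d \<xi> z) = (\<Sum>j\<in>J. \<Sum>\<xi>\<in>?V. mj j (sqnorm F d \<xi>) * Psi d \<xi> z)" for z
      by (subst sum.swap, intro sum.cong refl) (simp only: split sqnorm_closed sum_distrib_right)
    then show ?thesis by (simp add: offdiag_def multiplier_kernel_def sum_divide_distrib)
  qed
  then have "(\<Sum>x\<in>?V. \<Sum>y\<in>?V. of_real (f x * g y) * offdiag d (multiplier_kernel d (sphere_mult d t)) x y) =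
    (\<Sum>x\<in>?V. \<Sum>y\<in>?V. \<Sum>j\<in>J. of_real (f x * g y) * offdiag d (multiplier_kernel d (mj j)) x y)"
    by (simp only: sum_distrib_left)
  also have "\<dots> = (\<Sum>j\<in>J. \<Sum>x\<in>?V. \<Sum>y\<in>?V. of_real (f x * g y) * offdiag d (multiplier_kernel d (mj j)) x y)"
    by (rule sum_swap3[symmetric])
  finally have "cmod (\<Sum>x\<in>?V. \<Sum>y\<in>?V. of_real (f x * g y) * offdiag d (multiplier_kernel d (sphere_mult d t)) x y) \<le>
    (\<Sum>j\<in>J. cmod (\<Sum>x\<in>?V. \<Sum>y\<in>?V. of_real (f x * g y) * offdiag d (multiplier_kernel d (mj j)) x y))"
    by (simp only: norm_sum)
  also have "\<dots> \<le> (\<Sum>j\<in>J. interp_const p * (10 * q powr ((real d - 1) / (real d + 1))) * N * level_ratio d ^ j)"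
  proof (intro sum_mono)
    fix j
    \<comment> \<open>B is the outcome of \<open>sum_kloosterman_level\<close> inserted into
      \<open>sum_multiplier_sqnorm\<close>; the leading 2 in \<Lambda> is the price of removing the
      diagonal.\<close>
    define B where "B = 5 / (2::real) ^ j"
    define \<Lambda> where "\<Lambda> = 2 * 2 ^ j * sqrt q ^ (d - 1)"
    have pos: "0 < B" "0 < \<Lambda>" using q_gt_0 by (auto simp: B_def \<Lambda>_def)
    have "cmod (\<Sum>x\<in>?V. \<Sum>y\<in>?V. of_real (f x * g y) * offdiag d (multiplier_kernel d (mj j)) x y) \<le>
       interp_const p * B powr (2 / p - 1) * \<Lambda> powr (2 - 2 / p) *
        (\<Sum>x\<in>?V. f x powr p) powr (1 / p) * (\<Sum>y\<in>?V. g y powr p) powr (1 / p)"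
    proof (rule bilinear_interpolation)
      show "cmod (offdiag d (multiplier_kernel d (mj j)) x y) \<le> B" if xy: "x \<in> ?V" "y \<in> ?V" for x y
      proof (cases "x = y")
        case False
        then have nz: "vminus F d x y \<noteq> vzero d" using vminus_eq_vzero_iff[OF xy] by simp
        have "(\<Sum>c\<in>carrier F. (cmod (mj j c))\<^sup>2) = (\<Sum>c\<in>{c\<in>carrier F. ?lev c = j}. (sqrt q ^ (d - 2) * cmod (kloosterman t c))\<^sup>2)"
          unfolding sum.inter_filter[OF finite_carrier] mj_def
          using d d2 by (intro sum.cong refl) (simp add: norm_sphere_mult_even)
        also have "\<dots> = (sqrt q ^ (d - 2))\<^sup>2 * (\<Sum>c\<in>{c\<in>carrier F. ?lev c = j}. (cmod (kloosterman t c))\<^sup>2)"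
          by (simp only: power_mult_distrib sum_distrib_left)
        also have "\<dots> \<le> (sqrt q ^ (d - 2))\<^sup>2 * (5 / 2 ^ j * q)\<^sup>2"
          by (intro mult_left_mono sum_kloosterman_level t) simp
        also have "\<dots> = (B * sqrt q ^ d)\<^sup>2"
        proof -
          have "d = (d - 2) + 2" using d2 by simp
          then have "sqrt q ^ d = sqrt q ^ (d - 2) * sqrt q ^ 2" by (metis power_add)
          then have "sqrt q ^ d = sqrt q ^ (d - 2) * q" using q_gt_0 by simp
          then show ?thesis by (simp add: B_def power_mult_distrib power_divide)
        qed
        finally have "sqrt (\<Sum>c\<in>carrier F. (cmod (mj j c))\<^sup>2) \<le> B * sqrt q ^ d"
          using pos q_gt_0 by (intro real_le_lsqrt) (auto intro: sum_nonneg)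
        then have "sqrt (\<Sum>c\<in>carrier F. (cmod (mj j c))\<^sup>2) / sqrt (q ^ d) \<le> B * sqrt q ^ d / sqrt (q ^ d)"
          using q_gt_0 by (intro divide_right_mono) auto
        also have "\<dots> = B" using q_gt_0 by (simp add: real_sqrt_power)
        finally show ?thesis
          using sum_multiplier_sqnorm[OF vminus_in_vecs[OF xy] nz, of "mj j"] False by (simp add: offdiag_def)
      qed (use pos in \<open>simp add: offdiag_def\<close>)
      have mjb: "cmod (mj j c) \<le> 2 ^ j * sqrt q ^ (d - 1)" if "c \<in> carrier F" for c
      proof (cases "?lev c = j")
        case True
        have "cmod (mj j c) = sqrt q ^ (d - 2) * cmod (kloosterman t c)"
          using True d d2 by (simp add: mj_def norm_sphere_mult_even)
        also have "\<dots> \<le> sqrt q ^ (d - 2) * (2 ^ j * sqrt q)"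
          using kloosterman_level_upper[of t c] True by (intro mult_left_mono) auto
        also have "\<dots> = 2 ^ j * sqrt q ^ Suc (d - 2)" by simp
        also have "Suc (d - 2) = d - 1" using d2 by simp
        finally show ?thesis .
      qed (use q_gt_0 in \<open>simp add: mj_def\<close>)
      show "cmod (\<Sum>x\<in>?V. \<Sum>y\<in>?V. of_real (f x * g y) * offdiag d (multiplier_kernel d (mj j)) x y) \<le>
          \<Lambda> * (sqrt (\<Sum>x\<in>?V. (f x)\<^sup>2) * sqrt (\<Sum>y\<in>?V. (g y)\<^sup>2))" for f g :: "_ \<Rightarrow> real"
        using offdiag_L2[of "mj j" "2 ^ j * sqrt q ^ (d - 1)" f g d] mjb by (simp add: \<Lambda>_def mult_ac)
    qed (use crit_exp(1,2)[OF d2] pos f g in \<open>auto simp: p_def\<close>)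
    also have "\<dots> = interp_const p * (B powr (2 / p - 1) * \<Lambda> powr (2 - 2 / p)) * N" by (simp add: N_def)
    also have "B powr (2 / p - 1) * \<Lambda> powr (2 - 2 / p) \<le> 10 * q powr ((real d - 1) / (real d + 1)) * level_ratio d ^ j"
    proof -
      define e e' where "e = (real d - 1) / (real d + 1)" and "e' = 2 / (real d + 1)"
      have ee: "2 / p - 1 = e" "2 - 2 / p = e'" using crit_exp(5,6)[OF d2] by (simp_all add: p_def e_def e'_def add.commute)
      have e1: "e \<le> 1" "e' \<le> 1" using d2 by (auto simp: e_def e'_def)
      have j2: "(2::real) ^ j = 2 powr real j" by (simp add: powr_realpow)
      have "B powr e = 5 powr e * 2 powr (- real j * e)"
        unfolding B_def j2 by (simp add: powr_divide powr_powr powr_minus_divide)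
      moreover have "\<Lambda> powr e' = 2 powr e' * 2 powr (real j * e') * q powr e"
      proof -
        have "\<Lambda> powr e' = 2 powr e' * (2 powr real j) powr e' * (sqrt q ^ (d - 1)) powr e'"
          unfolding \<Lambda>_def j2 using q_gt_0 by (simp add: powr_mult)
        also have "(sqrt q ^ (d - 1)) powr e' = q powr e"
          using q_power_root[of d] d2 unfolding e_def e'_def by simp
        finally show ?thesis by (simp only: powr_powr)
      qed
      ultimately have "B powr e * \<Lambda> powr e' = 5 powr e * 2 powr e' * (q powr e * 2 powr (- real j * e + real j * e'))"
        unfolding powr_add by (simp add: mult_ac)
      also have "- real j * e + real j * e' = (- (real d - 3) / (real d + 1)) * real j"
      proof -
        have "e' - e = (2 - (real d - 1)) / (real d + 1)"
          unfolding e_def e'_def by (rule diff_divide_distrib[symmetric])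
        also have "2 - (real d - 1) = - (real d - 3)" by simp
        finally have "- (real d - 3) / (real d + 1) = e' - e" ..
        then show ?thesis by (simp only:) (simp add: algebra_simps)
      qed
      also have "2 powr ((- (real d - 3) / (real d + 1)) * real j) = level_ratio d ^ j"
        unfolding level_ratio_def powr_powr[symmetric] by (simp add: powr_realpow add.commute)
      also have "5 powr e * 2 powr e' * (q powr e * level_ratio d ^ j) \<le> 5 * 2 * (q powr e * level_ratio d ^ j)"
        using e1 by (intro mult_right_mono mult_mono powr_le_base) (auto simp: level_ratio_def)
      finally show ?thesis unfolding ee by (simp add: e_def)
    qed
    finally show "cmod (\<Sum>x\<in>?V. \<Sum>y\<in>?V. of_real (f x * g y) * offdiag d (multiplier_kernel d (mj j)) x y) \<le>
      interp_const p * (10 * q powr ((real d - 1) / (real d + 1))) * N * level_ratio d ^ j"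
      using ip N0 by (simp add: mult_left_mono mult_right_mono mult_ac)
  qed
  also have "\<dots> = interp_const p * (10 * q powr ((real d - 1) / (real d + 1))) * N * (\<Sum>j\<in>J. level_ratio d ^ j)"
    by (simp only: sum_distrib_left)
  also have "\<dots> \<le> interp_const p * (10 * q powr ((real d - 1) / (real d + 1))) * N * (1 / (1 - level_ratio d))"
  proof (intro mult_left_mono sum_power_le fJ)
    have "level_ratio d < 2 powr 0" unfolding level_ratio_def using d by (intro powr_less_mono divide_neg_pos) auto
    then show "level_ratio d < 1" by simp
  qed (use ip N0 in \<open>auto simp: level_ratio_def\<close>)
  finally show ?thesis by (simp add: N_def mult_ac)
qed

section \<open>The plane, and the bound at the vertex in all dimensions\<close>

lemma finite_sphere: "finite (sphere F d t)"
  by (rule finite_subset[OF _ finite_vectors[of d]]) (auto simp: Defs.sphere_def)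

lemma sum_sphere_translate_le:
  assumes y: "y \<in> vecs F d"
  shows "(\<Sum>x\<in>vecs F d. indicat_real (sphere F d t) (vminus F d x y)) \<le> card (sphere F d t)"
proof -
  let ?V = "vecs F d" and ?S = "sphere F d t"
  have "(\<Sum>x\<in>?V. indicat_real ?S (vminus F d x y)) = (\<Sum>x\<in>?V. if vminus F d x y \<in> ?S then 1 else 0)"
    by (intro sum.cong refl) (simp add: indicator_def)
  also have "\<dots> = card {x \<in> ?V. vminus F d x y \<in> ?S}" using sum_if_const[OF finite_vectors, of _ "1::real"] by simp
  also have "card {x \<in> ?V. vminus F d x y \<in> ?S} \<le> card ?S"
  proof (rule card_inj_on_le[of "\<lambda>x. vminus F d x y"])
    show "inj_on (\<lambda>x. vminus F d x y) {x \<in> ?V. vminus F d x y \<in> ?S}"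
    proof (rule inj_onI)
      fix x x' assume x: "x \<in> {x \<in> ?V. vminus F d x y \<in> ?S}" "x' \<in> {x \<in> ?V. vminus F d x y \<in> ?S}"
        and e: "vminus F d x y = vminus F d x' y"
      have xV: "x \<in> ?V" "x' \<in> ?V" using x by auto
      show "x = x'"
      proof (rule PiE_ext[OF xV[unfolded vecs_def]])
        fix i assume i: "i \<in> {..<d}"
        have "x i \<ominus> y i = x' i \<ominus> y i" using fun_cong[OF e, of i] i by (simp add: vminus_def)
        then show "x i = x' i" using i vecs_mem[OF xV(1)] vecs_mem[OF xV(2)] vecs_mem[OF y] by (simp add: minus_eq)
      qed
    qed
  qed (auto simp: finite_sphere)
  finally show ?thesis by simp
qed

text \<open>Two points are adjacent when their difference lies on the circle. This graph has q^2
  vertices of degree at most 2 q, and by \<open>card_two_circles_le\<close> two of them have at most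
  two common neighbours.\<close>

lemma sphere_form_plane:
  fixes f g :: "(nat \<Rightarrow> 'a) \<Rightarrow> real"
  assumes t: "t \<in> carrier F" "t \<noteq> \<zero>"
    and f: "\<And>x. x \<in> vecs F 2 \<Longrightarrow> 0 \<le> f x" and g: "\<And>x. x \<in> vecs F 2 \<Longrightarrow> 0 \<le> g x"
  shows "sphere_form 2 t f g \<le> incidence_const * q powr (1/3) *
    (\<Sum>x\<in>vecs F 2. f x powr (3/2)) powr (1 / (3/2)) * (\<Sum>x\<in>vecs F 2. g x powr (3/2)) powr (1 / (3/2))"
proof -
  let ?V = "vecs F 2" and ?S = "sphere F 2 t"
  define K where "K x y = indicat_real ?S (vminus F 2 x y)" for x y
  have K01: "K x y = 0 \<or> K x y = 1" for x y by (auto simp: K_def indicator_def)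
  have eq: "(\<Sum>x\<in>?V. \<Sum>y\<in>?V. of_real (f x * g y) * of_real (K x y)) = complex_of_real (sphere_form 2 t f g)"
    unfolding sphere_form_def K_def by (simp add: mult_ac)
  have "cmod (\<Sum>x\<in>?V. \<Sum>y\<in>?V. of_real (f x * g y) * of_real (K x y)) \<le> incidence_const * q powr (1/3) *
    (\<Sum>x\<in>?V. f x powr (3/2)) powr (1 / (3/2)) * (\<Sum>x\<in>?V. g x powr (3/2)) powr (1 / (3/2))"
  proof (rule incidence_strong_type[OF finite_vectors _ _ K01])
    show "real (card ?V) \<le> q\<^sup>2" by (simp add: card_vecs)
    show "1 \<le> q" using order_gt_1 by simp
    show "K x y = K y x" if "x \<in> ?V" "y \<in> ?V" for x y
      using sqnorm_vminus_comm[OF that] vminus_in_vecs that by (simp add: K_def indicator_def Defs.sphere_def)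
    show "(\<Sum>x\<in>?V. K x y) \<le> 2 * q" if y: "y \<in> ?V" for y
      using sum_sphere_translate_le[OF y, of t] card_sphere_bounds(2)[OF _ t, of 2] by (simp add: K_def)
    show "(\<Sum>x\<in>?V. K x y * K x y') \<le> 2" if y: "y \<in> ?V" "y' \<in> ?V" "y \<noteq> y'" for y y'
    proof -
      have "(\<Sum>x\<in>?V. K x y * K x y') = (\<Sum>x\<in>?V. if vminus F 2 x y \<in> ?S \<and> vminus F 2 x y' \<in> ?S then 1 else 0)"
        by (intro sum.cong refl) (simp add: K_def indicator_def)
      also have "\<dots> = card {x \<in> ?V. vminus F 2 x y \<in> ?S \<and> vminus F 2 x y' \<in> ?S}"
        using sum_if_const[OF finite_vectors, of _ "1::real"] by simp
      also have "\<dots> \<le> 2" using card_two_circles_le[OF t y] by simp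
      finally show ?thesis .
    qed
  qed (use f g in auto)
  then show ?thesis unfolding eq by simp
qed

lemma vertex_bound:
  fixes f g :: "(nat \<Rightarrow> 'a) \<Rightarrow> real"
  assumes d: "2 \<le> d" and t: "t \<in> carrier F" "t \<noteq> \<zero>"
    and f: "\<And>x. x \<in> vecs F d \<Longrightarrow> 0 \<le> f x" and g: "\<And>x. x \<in> vecs F d \<Longrightarrow> 0 \<le> g x"
  defines "p \<equiv> crit_exp d"
  shows "sphere_form d t f g \<le> vertex_const d * (q powr ((real d - 1) / (real d + 1)) *
      ((\<Sum>x\<in>vecs F d. f x powr p) powr (1 / p) * (\<Sum>x\<in>vecs F d. g x powr p) powr (1 / p)))"
proof (cases "d = 2")
  case True
  have p: "p = 3/2" by (simp add: p_def crit_exp_def True)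
  show ?thesis
    using sphere_form_plane[OF t, of f g] f g unfolding p True by (simp add: vertex_const_def mult_ac)
next
  case False
  define M where "M = q powr ((real d - 1) / (real d + 1)) *
      ((\<Sum>x\<in>vecs F d. f x powr p) powr (1 / p) * (\<Sum>x\<in>vecs F d. g x powr p) powr (1 / p))"
  have mean: "(\<Sum>x\<in>vecs F d. f x) * (\<Sum>x\<in>vecs F d. g x) / q \<le> M"
    unfolding M_def p_def by (rule mean_term_le[OF d f g])
  have form: "sphere_form d t f g \<le> (\<Sum>x\<in>vecs F d. f x) * (\<Sum>x\<in>vecs F d. g x) / q +
    cmod (\<Sum>x\<in>vecs F d. \<Sum>y\<in>vecs F d. of_real (f x * g y) * offdiag d (multiplier_kernel d (sphere_mult d t)) x y)"
    using d by (intro sphere_form_le_of_offdiag t f g) auto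
  have "sphere_form d t f g \<le> vertex_const d * M"
  proof (cases "odd d")
    case True
    have "cmod (\<Sum>x\<in>vecs F d. \<Sum>y\<in>vecs F d. of_real (f x * g y) * offdiag d (multiplier_kernel d (sphere_mult d t)) x y)
        \<le> interp_const p * 4 * M"
      unfolding M_def p_def by (rule sphere_form_odd[OF d True t f g])
    moreover have "vertex_const d * M = M + interp_const p * 4 * M"
      using False True by (simp add: vertex_const_def p_def distrib_right)
    ultimately show ?thesis using form mean by linarith
  next
    case even: False
    have d4: "4 \<le> d" using d False even by presburger
    have "cmod (\<Sum>x\<in>vecs F d. \<Sum>y\<in>vecs F d. of_real (f x * g y) * offdiag d (multiplier_kernel d (sphere_mult d t)) x y)
        \<le> interp_const p * 10 / (1 - level_ratio d) * M"
      unfolding M_def p_def using even by (intro sphere_form_even[OF d4 _ t f g]) auto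
    moreover have "vertex_const d * M = M + interp_const p * 10 / (1 - level_ratio d) * M"
      using False even by (simp add: vertex_const_def p_def distrib_right)
    ultimately show ?thesis using form mean by linarith
  qed
  then show ?thesis by (simp only: M_def)
qed

end

section \<open>The region of exponents\<close>

definition inv_exp :: "ereal \<Rightarrow> real" where
  "inv_exp p = (if p = \<infinity> then 0 else 1 / real_of_ereal p)"

lemma inv_exp:
  assumes "1 \<le> p"
  shows "0 \<le> inv_exp p" "inv_exp p \<le> 1" "ereal c / p = ereal (c * inv_exp p)"
proof -
  consider "p = \<infinity>" | r where "p = ereal r" "1 \<le> r" using assms by (cases p) auto
  then show "0 \<le> inv_exp p" "inv_exp p \<le> 1" "ereal c / p = ereal (c * inv_exp p)"
    by (cases; simp add: inv_exp_def)+
qed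

text \<open>The exponents enter only through their reciprocals \<open>\<alpha> = 1 / p \<in> [0, 1]\<close>, the
  value 0 standing for \<open>p = \<infinity>\<close>.\<close>

definition nrm :: "('a, 'm) ring_scheme \<Rightarrow> nat \<Rightarrow> real \<Rightarrow> ((nat \<Rightarrow> 'a) \<Rightarrow> real) \<Rightarrow> real" where
  "nrm F d \<alpha> f = (if \<alpha> = 0 then Max ((\<lambda>x. \<bar>f x\<bar>) ` vecs F d)
     else ((\<Sum>x\<in>vecs F d. \<bar>f x\<bar> powr (1 / \<alpha>)) / real (order F) ^ d) powr \<alpha>)"

lemma Lp_norm_eq_nrm:
  assumes "1 \<le> p"
  shows "Lp_norm F d p f = nrm F d (inv_exp p) f"
proof -
  consider "p = \<infinity>" | r where "p = ereal r" "1 \<le> r" using assms by (cases p) auto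
  then show ?thesis by cases (simp_all add: nrm_def Lp_norm_def inv_exp_def)
qed

context odd_finite_field
begin

lemma vecs_nonempty: "vecs F d \<noteq> {}"
  using vzero_in_vecs by blast

lemma abs_le_nrm_0: "x \<in> vecs F d \<Longrightarrow> \<bar>f x\<bar> \<le> nrm F d 0 f"
  by (simp add: nrm_def)

lemma nrm_nonneg: "0 \<le> nrm F d \<alpha> f"
proof (cases "\<alpha> = 0")
  case True
  then show ?thesis using abs_le_nrm_0[OF vzero_in_vecs, of f d] by (metis abs_ge_zero order_trans)
qed (simp add: nrm_def)

lemma q_pow_pos: "0 < q ^ d"
  using order_gt_1 by simp

text \<open>These are norms for a probability measure, so they grow with the exponent 1 /
  \<alpha>.\<close>

lemma nrm_antimono:
  assumes "0 \<le> \<alpha>" "\<alpha> \<le> \<beta>"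
  shows "nrm F d \<beta> f \<le> nrm F d \<alpha> f"
proof -
  let ?V = "vecs F d"
  consider "\<alpha> = \<beta>" | "\<alpha> = 0" "0 < \<beta>" | "0 < \<alpha>" "\<alpha> < \<beta>" using assms by linarith
  then show ?thesis
  proof cases
    case 2
    define M where "M = nrm F d 0 f"
    have M: "0 \<le> M" unfolding M_def by (rule nrm_nonneg)
    have "(\<Sum>x\<in>?V. \<bar>f x\<bar> powr (1 / \<beta>)) \<le> (\<Sum>x\<in>?V. M powr (1 / \<beta>))"
      using 2 abs_le_nrm_0 unfolding M_def by (intro sum_mono powr_mono2) auto
    then have "(\<Sum>x\<in>?V. \<bar>f x\<bar> powr (1 / \<beta>)) / q ^ d \<le> M powr (1 / \<beta>)"
      using q_pow_pos by (simp add: card_vecs divide_le_eq mult.commute)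
    then have "((\<Sum>x\<in>?V. \<bar>f x\<bar> powr (1 / \<beta>)) / q ^ d) powr \<beta> \<le> (M powr (1 / \<beta>)) powr \<beta>"
      using 2 by (intro powr_mono2) (auto intro!: divide_nonneg_nonneg sum_nonneg)
    also have "\<dots> = M" using 2 M by (simp add: powr_powr)
    finally show ?thesis using 2 by (simp add: nrm_def M_def)
  next
    case 3
    define \<theta> where "\<theta> = \<alpha> / \<beta>"
    have \<theta>: "0 < \<theta>" "\<theta> < 1" using 3 by (auto simp: \<theta>_def)
    define S where "S = (\<Sum>x\<in>?V. \<bar>f x\<bar> powr (1 / \<alpha>)) / q ^ d"
    have "(\<Sum>x\<in>?V. \<bar>f x\<bar> powr (1 / \<beta>)) / q ^ d =
        (\<Sum>x\<in>?V. 1 / q ^ d * (1 powr (1 - \<theta>) * (\<bar>f x\<bar> powr (1 / \<alpha>)) powr \<theta>))"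
      unfolding sum_divide_distrib using 3 by (intro sum.cong refl) (simp add: powr_powr \<theta>_def)
    also have "\<dots> \<le> (\<Sum>x\<in>?V. 1 / q ^ d * 1) powr (1 - \<theta>) * (\<Sum>x\<in>?V. 1 / q ^ d * \<bar>f x\<bar> powr (1 / \<alpha>)) powr \<theta>"
      using \<theta> q_pow_pos by (intro weighted_Holder) auto
    also have "\<dots> = S powr \<theta>"
      using order_gt_1 by (simp add: S_def card_vecs sum_divide_distrib)
    finally have "((\<Sum>x\<in>?V. \<bar>f x\<bar> powr (1 / \<beta>)) / q ^ d) powr \<beta> \<le> (S powr \<theta>) powr \<beta>"
      using 3 by (intro powr_mono2) (auto intro!: divide_nonneg_nonneg sum_nonneg)
    also have "\<dots> = S powr \<alpha>" using 3 by (simp add: powr_powr \<theta>_def)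
    finally show ?thesis using 3 by (simp add: nrm_def S_def)
  qed simp
qed

end

context field_character
begin

lemma sphere_form_comm: "sphere_form d t f g = sphere_form d t g f"
proof -
  have "sphere_form d t f g = (\<Sum>y\<in>vecs F d. \<Sum>x\<in>vecs F d. indicat_real (sphere F d t) (vminus F d x y) * f x * g y)"
    unfolding sphere_form_def by (rule sum.swap)
  also have "\<dots> = sphere_form d t g f"
    unfolding sphere_form_def
  proof (intro sum.cong refl)
    fix x y assume xy: "x \<in> vecs F d" "y \<in> vecs F d"
    then have "vminus F d y x \<in> sphere F d t \<longleftrightarrow> vminus F d x y \<in> sphere F d t"
      using sqnorm_vminus_comm[OF xy] vminus_in_vecs by (simp add: Defs.sphere_def)
    then show "indicat_real (sphere F d t) (vminus F d y x) * f y * g x = indicat_real (sphere F d t) (vminus F d x y) * g x * f y"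
      by (simp add: indicator_def)
  qed
  finally show ?thesis .
qed

section \<open>The normalised operator inside the region of exponents\<close>

definition K2 :: "nat \<Rightarrow> 'a \<Rightarrow> ((nat \<Rightarrow> 'a) \<Rightarrow> real) \<Rightarrow> ((nat \<Rightarrow> 'a) \<Rightarrow> real) \<Rightarrow> real" where
  "K2 d t f g = sphere_form d t f g / (q ^ d * card (sphere F d t))"

lemma K2_op_K2: "K2_op F d t f g = K2 d t f g"
  by (simp add: K2_op_def K2_def sphere_form_def)

lemma card_sphere_pos: "2 \<le> d \<Longrightarrow> t \<in> carrier F \<Longrightarrow> t \<noteq> \<zero> \<Longrightarrow> 0 < real (card (sphere F d t))"
  by (rule less_le_trans[OF _ card_sphere_bounds(1)]) (use q_gt_0 in auto)

text \<open>The powers of q coming from the two norms, the volume q^d, the sphere size and the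
  vertex bound cancel exactly. The 3 stems from the lower bound for the sphere size.\<close>

lemma K2_vertex:
  assumes d: "2 \<le> d" and t: "t \<in> carrier F" "t \<noteq> \<zero>"
    and f: "\<And>x. x \<in> vecs F d \<Longrightarrow> 0 \<le> f x" and g: "\<And>x. x \<in> vecs F d \<Longrightarrow> 0 \<le> g x" and C: "0 \<le> vertex_const d"
  defines "a \<equiv> real d / (real d + 1)"
  shows "K2 d t f g \<le> 3 * vertex_const d * (nrm F d a f * nrm F d a g)"
proof -
  define p where "p = crit_exp d"
  have ap: "1 / a = p" "1 / p = a" "a \<noteq> 0" using d by (auto simp: a_def p_def crit_exp_def)
  define A where "A = (\<Sum>x\<in>vecs F d. f x powr p) powr a"
  define B where "B = (\<Sum>x\<in>vecs F d. g x powr p) powr a"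
  have AB: "0 \<le> A" "0 \<le> B" by (auto simp: A_def B_def)
  have N: "(q ^ d) powr a = q powr (real d * a)" using q_gt_0 by (simp add: powr_powr flip: powr_realpow)
  have nrm: "nrm F d a h = (\<Sum>x\<in>vecs F d. h x powr p) powr a / q powr (real d * a)"
    if "\<And>x. x \<in> vecs F d \<Longrightarrow> 0 \<le> h x" for h
    unfolding N[symmetric] using ap that q_pow_pos[of d] by (simp add: nrm_def powr_divide sum_nonneg)
  have S: "q ^ (d - 1) / 3 \<le> card (sphere F d t)" by (rule card_sphere_bounds(1)[OF d t])
  define e where "e = (real d - 1) / (real d + 1)"
  have "K2 d t f g \<le> vertex_const d * (q powr e * (A * B)) / (q ^ d * card (sphere F d t))"
    unfolding K2_def A_def B_def e_def using vertex_bound[OF d t f g] ap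
    by (intro divide_right_mono) (auto simp: p_def)
  also have "\<dots> \<le> vertex_const d * (q powr e * (A * B)) / (q ^ d * (q ^ (d - 1) / 3))"
    using S C AB q_gt_0 card_sphere_pos[OF d t] by (intro divide_left_mono mult_left_mono mult_pos_pos) auto
  also have "\<dots> = 3 * vertex_const d * ((A * B) * (q powr e / (q ^ d * q ^ (d - 1))))" by simp
  also have "q powr e / (q ^ d * q ^ (d - 1)) = 1 / (q powr (real d * a) * q powr (real d * a))"
  proof -
    have "q ^ d * q ^ (d - 1) = q powr (real d) * q powr (real d - 1)"
      using d q_gt_0 by (simp add: powr_realpow[symmetric] of_nat_diff)
    then have "q powr e / (q ^ d * q ^ (d - 1)) = q powr (e - (real d + (real d - 1)))"
      by (simp only: powr_diff powr_add)
    also have "e - (real d + (real d - 1)) = - (real d * a + real d * a)"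
    proof -
      have "(D - 2) / D - ((D - 1) + ((D - 1) - 1)) = - ((D - 1) * ((D - 1) / D) + (D - 1) * ((D - 1) / D))"
        if "D \<noteq> 0" for D :: real
        using that by (simp add: field_simps)
      from this[of "real d + 1"] show ?thesis by (simp add: e_def a_def)
    qed
    finally show ?thesis by (simp only: powr_minus powr_add inverse_eq_divide)
  qed
  finally have "K2 d t f g \<le> 3 * vertex_const d * ((A * B) * (1 / (q powr (real d * a) * q powr (real d * a))))" .
  moreover have "nrm F d a f = A / q powr (real d * a)" unfolding A_def by (rule nrm) (rule f)
  moreover have "nrm F d a g = B / q powr (real d * a)" unfolding B_def by (rule nrm) (rule g)
  ultimately show ?thesis by simp
qed

text \<open>The edge of the region from the vertex (a, a) with a = d / (d + 1) to the point (0, 1).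
  The kernel is nonnegative and serves as a measure on pairs: f g is written as (1 * G)^(1-\<theta>)
  * (f' * H)^\<theta>, and Hoelder splits this into the trivial bound for 1, G and the vertex bound
  for f', H.\<close>

lemma K2_Holder_case:
  assumes d: "2 \<le> d" and t: "t \<in> carrier F" "t \<noteq> \<zero>"
    and f: "\<And>x. x \<in> vecs F d \<Longrightarrow> 0 \<le> f x" and g: "\<And>x. x \<in> vecs F d \<Longrightarrow> 0 \<le> g x" and C: "0 \<le> vertex_const d"
    and \<beta>: "real d / (real d + 1) < \<beta>" "\<beta> \<le> 1"
  shows "K2 d t f g \<le> max 1 (3 * vertex_const d) * (nrm F d (real d * (1 - \<beta>)) f * nrm F d \<beta> g)"
proof -
  let ?V = "vecs F d" and ?S = "sphere F d t"
  let ?N = "q ^ d" and ?c = "real (card (sphere F d t))"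
  have b0: "0 < \<beta>" using \<beta> d by (meson divide_nonneg_nonneg le_less_trans of_nat_0_le_iff add_nonneg_nonneg zero_le_one)
  have c0: "0 < ?c" by (rule card_sphere_pos[OF d t])
  have one: "K2 d t (\<lambda>_. 1) h \<le> (\<Sum>y\<in>?V. h y) / ?N" if h: "\<And>x. x \<in> ?V \<Longrightarrow> 0 \<le> h x" for h
  proof -
    have "sphere_form d t (\<lambda>_. 1) h = (\<Sum>y\<in>?V. h y * (\<Sum>x\<in>?V. indicat_real ?S (vminus F d x y)))"
      unfolding sphere_form_def by (subst sum.swap) (simp add: sum_distrib_left mult.commute)
    also have "\<dots> \<le> (\<Sum>y\<in>?V. h y * ?c)" using h by (intro sum_mono mult_left_mono sum_sphere_translate_le) auto
    also have "\<dots> = (\<Sum>y\<in>?V. h y) * ?c" by (simp add: sum_distrib_right)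
    finally have "K2 d t (\<lambda>_. 1) h \<le> (\<Sum>y\<in>?V. h y) * ?c / (?N * ?c)"
      unfolding K2_def using c0 q_pow_pos by (intro divide_right_mono) auto
    then show ?thesis using c0 by simp
  qed
  show ?thesis
  proof (cases "\<beta> = 1")
    \<comment> \<open>This is the endpoint \<theta> = 0, where f is replaced by its maximum.\<close>
    case True
    define M where "M = nrm F d 0 f"
    have "sphere_form d t f g \<le> (\<Sum>x\<in>?V. \<Sum>y\<in>?V. M * (indicat_real ?S (vminus F d x y) * 1 * g y))"
      unfolding sphere_form_def
    proof (intro sum_mono)
      fix x y assume xy: "x \<in> ?V" "y \<in> ?V"
      have "f x \<le> M" using abs_le_nrm_0[OF xy(1), of f] by (simp add: M_def)
      then have "f x * (indicat_real ?S (vminus F d x y) * g y) \<le> M * (indicat_real ?S (vminus F d x y) * g y)"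
        using g xy by (intro mult_right_mono) auto
      then show "indicat_real ?S (vminus F d x y) * f x * g y \<le> M * (indicat_real ?S (vminus F d x y) * 1 * g y)"
        by (simp add: mult_ac)
    qed
    also have "\<dots> = M * sphere_form d t (\<lambda>_. 1) g"
      unfolding sphere_form_def by (simp only: sum_distrib_left)
    finally have "K2 d t f g \<le> M * K2 d t (\<lambda>_. 1) g"
      unfolding K2_def using c0 q_pow_pos[of d] by (simp add: divide_right_mono)
    also have "\<dots> \<le> M * ((\<Sum>y\<in>?V. g y) / ?N)"
      using one[of g] g nrm_nonneg by (intro mult_left_mono) (auto simp: M_def)
    also have "(\<Sum>y\<in>?V. g y) / ?N = nrm F d 1 g"
      using g q_pow_pos[of d] by (simp add: nrm_def sum_nonneg)
    finally have "K2 d t f g \<le> 1 * (nrm F d (real d * (1 - \<beta>)) f * nrm F d \<beta> g)" using True by (simp add: M_def)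
    also have "\<dots> \<le> max 1 (3 * vertex_const d) * (nrm F d (real d * (1 - \<beta>)) f * nrm F d \<beta> g)"
      by (intro mult_right_mono mult_nonneg_nonneg nrm_nonneg) auto
    finally show ?thesis .
  next
    case False
    define a where "a = real d / (real d + 1)"
    \<comment> \<open>Solves (d (1 - \<beta>), \<beta>) = (1 - \<theta>) (0, 1) + \<theta> (a, a):
      the coordinates say \<theta> a = d (1 - \<beta>) and \<theta> (1 - a) = 1 - \<beta>.\<close>
    define \<theta> where "\<theta> = (1 - \<beta>) * (real d + 1)"
    have a: "0 < a" "1 - a = 1 / (real d + 1)" using d by (auto simp: a_def field_simps)
    have \<theta>0: "0 < \<theta>" using False \<beta> by (simp add: \<theta>_def)
    have \<theta>a: "\<theta> * a = real d * (1 - \<beta>)" unfolding \<theta>_def a_def by simp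
    have \<theta>b: "\<theta> * (1 - a) = 1 - \<beta>" 
    proof -
      have "x * D * (1 / D) = x" if "D \<noteq> 0" for x D :: real using that by simp
      from this[of "real d + 1" "1 - \<beta>"] show ?thesis unfolding a(2) \<theta>_def by simp
    qed
    have \<theta>1: "\<theta> < 1"
    proof -
      have "1 - \<beta> < 1 - a" unfolding a_def by (intro diff_strict_left_mono \<beta>)
      then have "\<theta> * (1 - a) < 1 * (1 - a)" unfolding \<theta>b by (simp only: mult_1)
      moreover have "0 < 1 - a" unfolding a(2) by simp
      ultimately show ?thesis by (simp only: mult_less_cancel_right_pos)
    qed
    \<comment> \<open>The powers are chosen so that the norms of G, f' and H at the endpoints are
      powers of the norms of f and g at the intermediate exponents.\<close>
    define G where "G y = g y powr (1 / \<beta>)" for y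
    define f' where "f' x = f x powr (1 / \<theta>)" for x
    define H where "H y = g y powr (a / \<beta>)" for y
    define w where "w x y = indicat_real ?S (vminus F d x y) / (?N * ?c)" for x y
    have w0: "0 \<le> w x y" for x y using c0 q_pow_pos[of d] by (simp add: w_def)
    have K2w: "K2 d t u v = (\<Sum>z\<in>?V \<times> ?V. w (fst z) (snd z) * (u (fst z) * v (snd z)))" for u v
      unfolding K2_def sphere_form_def w_def sum_divide_distrib sum.cartesian_product
      by (intro sum.cong refl) (simp add: split_def)
    have "K2 d t f g = (\<Sum>z\<in>?V \<times> ?V. w (fst z) (snd z) * ((1 * G (snd z)) powr (1 - \<theta>) * (f' (fst z) * H (snd z)) powr \<theta>))"
      unfolding K2w
    proof (rule sum.cong[OF refl])
      fix z assume "z \<in> ?V \<times> ?V"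
      then have z: "0 \<le> f (fst z)" "0 \<le> g (snd z)" using f g by auto
      have "(f' (fst z) * H (snd z)) powr \<theta> = f (fst z) * g (snd z) powr (a / \<beta> * \<theta>)"
        using z \<theta>0 by (simp add: f'_def H_def powr_mult powr_powr)
      moreover have "(1 * G (snd z)) powr (1 - \<theta>) = g (snd z) powr (1 / \<beta> * (1 - \<theta>))"
        by (simp add: G_def powr_powr)
      moreover have "g (snd z) powr (1 / \<beta> * (1 - \<theta>)) * g (snd z) powr (a / \<beta> * \<theta>) = g (snd z)"
      proof -
        have "1 / \<beta> * (1 - \<theta>) + a / \<beta> * \<theta> = (1 - \<theta> * (1 - a)) / \<beta>" by (simp add: algebra_simps diff_divide_distrib add_divide_distrib)
        also have "\<dots> = 1" unfolding \<theta>b using b0 by simp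
        finally show ?thesis using z by (simp only: powr_add[symmetric]) simp
      qed
      ultimately have "f (fst z) * g (snd z) = (1 * G (snd z)) powr (1 - \<theta>) * (f' (fst z) * H (snd z)) powr \<theta>"
        by (simp add: mult_ac)
      then show "w (fst z) (snd z) * (f (fst z) * g (snd z)) =
          w (fst z) (snd z) * ((1 * G (snd z)) powr (1 - \<theta>) * (f' (fst z) * H (snd z)) powr \<theta>)" by simp
    qed
    also have "\<dots> \<le> (\<Sum>z\<in>?V \<times> ?V. w (fst z) (snd z) * (1 * G (snd z))) powr (1 - \<theta>) *
        (\<Sum>z\<in>?V \<times> ?V. w (fst z) (snd z) * (f' (fst z) * H (snd z))) powr \<theta>"
      using \<theta>0 \<theta>1 w0 by (intro weighted_Holder) (auto simp: G_def f'_def H_def)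
    also have "\<dots> = K2 d t (\<lambda>_. 1) G powr (1 - \<theta>) * K2 d t f' H powr \<theta>"
      unfolding K2w ..
    also have "\<dots> \<le> ((\<Sum>y\<in>?V. G y) / ?N) powr (1 - \<theta>) * (max 1 (3 * vertex_const d) * (nrm F d a f' * nrm F d a H)) powr \<theta>"
    proof (intro mult_mono powr_mono2)
      show "K2 d t (\<lambda>_. 1) G \<le> (\<Sum>y\<in>?V. G y) / ?N" by (rule one) (simp add: G_def)
      have "K2 d t f' H \<le> 3 * vertex_const d * (nrm F d a f' * nrm F d a H)"
        unfolding a_def by (intro K2_vertex d t C) (auto simp: f'_def H_def)
      also have "\<dots> \<le> max 1 (3 * vertex_const d) * (nrm F d a f' * nrm F d a H)"
        by (intro mult_right_mono mult_nonneg_nonneg nrm_nonneg) auto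
      finally show "K2 d t f' H \<le> max 1 (3 * vertex_const d) * (nrm F d a f' * nrm F d a H)" .
      show "0 \<le> K2 d t (\<lambda>_. 1) G" "0 \<le> K2 d t f' H"
        unfolding K2w using w0 by (auto intro!: sum_nonneg mult_nonneg_nonneg simp: G_def f'_def H_def)
    qed (use \<theta>0 \<theta>1 in auto)
    also have "\<dots> = (max 1 (3 * vertex_const d)) powr \<theta> * (nrm F d (\<theta> * a) f * nrm F d \<beta> g)"
    proof -
      define T where "T = (\<Sum>y\<in>?V. g y powr (1 / \<beta>)) / ?N"
      define R where "R = (\<Sum>x\<in>?V. f x powr (1 / (\<theta> * a))) / ?N"
      have TR: "0 \<le> T" "0 \<le> R" by (auto simp: T_def R_def intro!: divide_nonneg_nonneg sum_nonneg)
      have "nrm F d a f' = R powr a" using a by (simp add: nrm_def f'_def powr_powr R_def)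
      moreover have "nrm F d a H = T powr a" using a by (simp add: nrm_def H_def powr_powr T_def)
      moreover have "nrm F d (\<theta> * a) f = R powr (\<theta> * a)" using a \<theta>0 f by (simp add: nrm_def R_def)
      moreover have "nrm F d \<beta> g = T powr \<beta>" using b0 g by (simp add: nrm_def T_def)
      moreover have "T powr (1 - \<theta>) * T powr (a * \<theta>) = T powr \<beta>"
      proof -
        have "1 - \<theta> + a * \<theta> = 1 - \<theta> * (1 - a)" by (simp add: algebra_simps)
        also have "\<dots> = \<beta>" unfolding \<theta>b by simp
        finally show ?thesis by (simp only: powr_add[symmetric])
      qed
      moreover have "(\<Sum>y\<in>?V. G y) / ?N = T" by (simp add: G_def T_def)
      ultimately show ?thesis
        using TR by (simp add: powr_mult powr_powr mult_ac)
    qed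
    also have "\<dots> \<le> max 1 (3 * vertex_const d) * (nrm F d (\<theta> * a) f * nrm F d \<beta> g)"
      using \<theta>1 by (intro mult_right_mono mult_nonneg_nonneg nrm_nonneg powr_le_base) auto
    finally show ?thesis unfolding \<theta>a .
  qed
qed

text \<open>Raising \<alpha> or \<beta> lowers the normalised norms. For \<alpha> \<le> \<beta>
  \<le> d / (d + 1) both are raised to the vertex; for larger \<beta> only \<alpha> is raised, to
  the value d (1 - \<beta>) on the edge.\<close>

lemma K2_region_ordered:
  assumes d: "2 \<le> d" and t: "t \<in> carrier F" "t \<noteq> \<zero>"
    and f: "\<And>x. x \<in> vecs F d \<Longrightarrow> 0 \<le> f x" and g: "\<And>x. x \<in> vecs F d \<Longrightarrow> 0 \<le> g x" and C: "0 \<le> vertex_const d"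
    and ab: "0 \<le> \<alpha>" "\<alpha> \<le> \<beta>" "\<beta> \<le> 1" "\<alpha> + real d * \<beta> \<le> real d"
  shows "K2 d t f g \<le> max 1 (3 * vertex_const d) * (nrm F d \<alpha> f * nrm F d \<beta> g)"
proof (cases "\<beta> \<le> real d / (real d + 1)")
  case True
  have "K2 d t f g \<le> 3 * vertex_const d * (nrm F d (real d / (real d + 1)) f * nrm F d (real d / (real d + 1)) g)"
    by (rule K2_vertex[OF d t f g C])
  also have "\<dots> \<le> max 1 (3 * vertex_const d) * (nrm F d \<alpha> f * nrm F d \<beta> g)"
    using True ab C by (intro mult_mono nrm_antimono mult_nonneg_nonneg nrm_nonneg) auto
  finally show ?thesis .
next
  case False
  have "K2 d t f g \<le> max 1 (3 * vertex_const d) * (nrm F d (real d * (1 - \<beta>)) f * nrm F d \<beta> g)"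
    using False ab by (intro K2_Holder_case d t f g C) auto
  also have "\<dots> \<le> max 1 (3 * vertex_const d) * (nrm F d \<alpha> f * nrm F d \<beta> g)"
    using ab by (intro mult_left_mono mult_right_mono nrm_antimono nrm_nonneg) (auto simp: algebra_simps)
  finally show ?thesis .
qed

lemma K2_region:
  assumes d: "2 \<le> d" and t: "t \<in> carrier F" "t \<noteq> \<zero>"
    and f: "\<And>x. x \<in> vecs F d \<Longrightarrow> 0 \<le> f x" and g: "\<And>x. x \<in> vecs F d \<Longrightarrow> 0 \<le> g x" and C: "0 \<le> vertex_const d"
    and ab: "0 \<le> \<alpha>" "\<alpha> \<le> 1" "0 \<le> \<beta>" "\<beta> \<le> 1" "\<alpha> + real d * \<beta> \<le> real d" "real d * \<alpha> + \<beta> \<le> real d"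
  shows "K2 d t f g \<le> max 1 (3 * vertex_const d) * (nrm F d \<alpha> f * nrm F d \<beta> g)"
proof (cases "\<alpha> \<le> \<beta>")
  case True
  then show ?thesis using ab by (intro K2_region_ordered d t f g C) auto
next
  case False
  have "K2 d t g f \<le> max 1 (3 * vertex_const d) * (nrm F d \<beta> g * nrm F d \<alpha> f)"
    using ab False by (intro K2_region_ordered d t f g C) auto
  then show ?thesis unfolding K2_def sphere_form_comm[of d t g f] by (simp add: mult.commute)
qed

section \<open>Test functions for the necessity\<close>

lemma K2_test_functions:
  assumes d: "2 \<le> d" and t: "t \<in> carrier F" "t \<noteq> \<zero>" and ab: "0 \<le> \<alpha>" "\<alpha> \<le> 1" "0 \<le> \<beta>"
  defines "f \<equiv> indicat_real (sphere F d t)" and "g \<equiv> indicat_real {vzero d}"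
  shows "K2 d t f g = 1 / q ^ d" "nrm F d \<alpha> f \<le> 2 * q powr (- \<alpha>)" "nrm F d \<beta> g \<le> q powr (- (real d * \<beta>))"
proof -
  let ?V = "vecs F d" and ?S = "sphere F d t"
  have c0: "0 < real (card ?S)" by (rule card_sphere_pos[OF d t])
  have SV: "?S \<subseteq> ?V" by (auto simp: Defs.sphere_def)
  have sumS: "(\<Sum>x\<in>?V. f x) = card ?S"
    using sum_restrict_if[OF finite_vectors SV, of "\<lambda>_. 1 :: real"] by (simp add: f_def indicator_def of_bool_def)
  have "sphere_form d t f g = (\<Sum>x\<in>?V. f x)"
    unfolding sphere_form_def
  proof (intro sum.cong refl)
    fix x assume x: "x \<in> ?V"
    have v: "vminus F d x (vzero d) = x"
    proof (rule PiE_ext[OF vminus_in_vecs[OF x vzero_in_vecs, unfolded vecs_def] x[unfolded vecs_def]])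
      fix i assume "i \<in> {..<d}"
      then show "vminus F d x (vzero d) i = x i" using vecs_mem[OF x] by (simp add: vminus_def vzero_def minus_eq)
    qed
    have "(\<Sum>y\<in>?V. indicat_real ?S (vminus F d x y) * f x * g y) =
        (\<Sum>y\<in>?V. if y = vzero d then indicat_real ?S (vminus F d x y) * f x else 0)"
      by (intro sum.cong refl) (simp add: g_def)
    also have "\<dots> = f x" using vzero_in_vecs[of d] by (simp add: v f_def indicator_def)
    finally show "(\<Sum>y\<in>?V. indicat_real ?S (vminus F d x y) * f x * g y) = f x" .
  qed
  then show "K2 d t f g = 1 / q ^ d" unfolding K2_def sumS using c0 by simp
  show "nrm F d \<alpha> f \<le> 2 * q powr (- \<alpha>)"
  proof (cases "\<alpha> = 0")
    case True
    have "Max ((\<lambda>x. \<bar>f x\<bar>) ` ?V) \<le> 1"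
      using vecs_nonempty[of d] by (intro Max.boundedI) (auto simp: f_def indicator_def)
    then show ?thesis using True q_gt_0 by (simp add: nrm_def)
  next
    case False
    have "nrm F d \<alpha> f = (card ?S / q ^ d) powr \<alpha>"
    proof -
      have "(\<Sum>x\<in>?V. \<bar>f x\<bar> powr (1 / \<alpha>)) = (\<Sum>x\<in>?V. f x)"
        by (intro sum.cong refl) (simp add: f_def indicator_def)
      then show ?thesis using False by (simp add: nrm_def sumS)
    qed
    also have "\<dots> \<le> (2 / q) powr \<alpha>"
    proof (intro powr_mono2)
      have "card ?S / q ^ d \<le> 2 * q ^ (d - 1) / q ^ d"
        using card_sphere_bounds(2)[OF d t] q_gt_0 by (intro divide_right_mono) auto
      also have "\<dots> = 2 / q" using d q_gt_0 by (cases d) (simp_all add: field_simps)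
      finally show "card ?S / q ^ d \<le> 2 / q" .
    qed (use ab q_gt_0 in auto)
    also have "\<dots> = 2 powr \<alpha> * q powr (- \<alpha>)" using q_gt_0 by (simp add: powr_divide powr_minus_divide)
    also have "\<dots> \<le> 2 * q powr (- \<alpha>)" using ab by (intro mult_right_mono powr_le_base) auto
    finally show ?thesis .
  qed
  show "nrm F d \<beta> g \<le> q powr (- (real d * \<beta>))"
  proof (cases "\<beta> = 0")
    case True
    have "Max ((\<lambda>x. \<bar>g x\<bar>) ` ?V) \<le> 1"
      using vecs_nonempty[of d] by (intro Max.boundedI) (auto simp: g_def indicator_def)
    then show ?thesis using True q_gt_0 by (simp add: nrm_def)
  next
    case False
    have "(\<Sum>x\<in>?V. \<bar>g x\<bar> powr (1 / \<beta>)) = (\<Sum>x\<in>?V. if x = vzero d then 1 else 0)"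
      by (intro sum.cong refl) (simp add: g_def)
    then have "nrm F d \<beta> g = (1 / q ^ d) powr \<beta>" using False vzero_in_vecs[of d] by (simp add: nrm_def)
    also have "1 / q ^ d = q powr (- real d)" using q_gt_0 by (simp add: powr_minus_divide powr_realpow)
    also have "(q powr (- real d)) powr \<beta> = q powr (- (real d * \<beta>))" by (simp add: powr_powr)
    finally show ?thesis by simp
  qed
qed

text \<open>The test functions give q^(-d) \<le> 2 C q^(-\<alpha>) q^(-d \<beta>). Along fields of
  growing order a fixed C permits this only if the exponent on the left of the conclusion is
  nonpositive.\<close>

lemma necessary_inequality:
  assumes d: "2 \<le> d" and t: "t \<in> carrier F" "t \<noteq> \<zero>" and ab: "0 \<le> \<alpha>" "\<alpha> \<le> 1" "0 \<le> \<beta>" and C: "0 \<le> C"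
    and bound: "\<And>f g. \<lbrakk>\<And>x. 0 \<le> f x; \<And>x. 0 \<le> g x\<rbrakk> \<Longrightarrow> K2 d t f g \<le> C * (nrm F d \<alpha> f * nrm F d \<beta> g)"
  shows "q powr (\<alpha> + real d * \<beta> - real d) \<le> 2 * C"
proof -
  note T = K2_test_functions[OF d t ab]
  have "1 / q ^ d \<le> C * (nrm F d \<alpha> (indicat_real (sphere F d t)) * nrm F d \<beta> (indicat_real {vzero d}))"
    unfolding T(1)[symmetric] by (rule bound) (simp_all)
  also have "\<dots> \<le> C * ((2 * q powr (- \<alpha>)) * q powr (- (real d * \<beta>)))"
    using C by (intro mult_left_mono mult_mono T nrm_nonneg) auto
  also have "\<dots> = 2 * C * (q powr (- \<alpha>) * q powr (- (real d * \<beta>)))" by simp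
  also have "q powr (- \<alpha>) * q powr (- (real d * \<beta>)) = q powr (- (\<alpha> + real d * \<beta>))"
    unfolding powr_add[symmetric] by simp
  finally have *: "q powr (- real d) \<le> 2 * C * q powr (- (\<alpha> + real d * \<beta>))"
    using q_gt_0 by (simp add: powr_minus_divide powr_realpow)
  have "q powr (\<alpha> + real d * \<beta> - real d) = q powr (\<alpha> + real d * \<beta>) * q powr (- real d)"
    unfolding powr_add[symmetric] by simp
  also have "\<dots> \<le> q powr (\<alpha> + real d * \<beta>) * (2 * C * q powr (- (\<alpha> + real d * \<beta>)))"
    using * by (intro mult_left_mono) auto
  also have "\<dots> = 2 * C * q powr ((\<alpha> + real d * \<beta>) + - (\<alpha> + real d * \<beta>))"
    unfolding powr_add by simp
  finally show ?thesis using q_gt_0 by simp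
qed

end

section \<open>Prime fields in which 3 is a square\<close>

lemma vertex_const_nonneg: "2 \<le> d \<Longrightarrow> 0 \<le> vertex_const d"
proof -
  assume d: "2 \<le> d"
  have "0 < interp_const (crit_exp d)" using interp_const_pos crit_exp(2)[OF d] by blast
  moreover have "level_ratio d \<le> 1" if "d \<noteq> 2"
  proof -
    have "level_ratio d \<le> 2 powr 0"
      unfolding level_ratio_def using d that by (intro powr_mono divide_nonpos_nonneg) auto
    then show ?thesis by simp
  qed
  moreover have "0 \<le> incidence_const"
  proof -
    have "0 \<le> (2::real) powr (1/4) - 1" using ge_one_powr_ge_zero[of 2 "1/4"] by simp
    then show ?thesis unfolding incidence_const_def Let_def
      by (intro add_nonneg_nonneg mult_nonneg_nonneg divide_nonneg_nonneg) simp_all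
  qed
  ultimately show ?thesis
    unfolding vertex_const_def by (auto intro!: add_nonneg_nonneg divide_nonneg_nonneg)
qed

text \<open>The sum of all elements is invariant under the bijection x -> x + 1, which adds 1 once
  for each element.\<close>

lemma (in field) of_int_card_carrier:
  assumes fin: "finite (carrier R)"
  shows "\<guillemotleft>int (card (carrier R))\<guillemotright> = \<zero>"
proof -
  have const: "(\<Oplus>x\<in>A. \<one>) = \<guillemotleft>int (card A)\<guillemotright>" if "finite A" for A :: "'a set"
    using that
  proof (induction A rule: finite_induct)
    case (insert x A)
    have "(\<Oplus>y\<in>insert x A. \<one>) = \<one> \<oplus> (\<Oplus>y\<in>A. \<one>)" using insert by (intro finsum_insert) auto
    also have "\<dots> = \<guillemotleft>1 + int (card A)\<guillemotright>" unfolding insert.IH of_int_add by simp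
    finally show ?case using insert by (simp del: of_int_add)
  qed simp
  let ?S = "\<Oplus>x\<in>carrier R. x"
  have S: "?S \<in> carrier R" by (intro finsum_closed) auto
  have img: "(\<lambda>x. x \<oplus> \<one>) ` carrier R = carrier R"
  proof
    show "carrier R \<subseteq> (\<lambda>x. x \<oplus> \<one>) ` carrier R"
    proof
      fix x assume "x \<in> carrier R"
      then have "x = (x \<ominus> \<one>) \<oplus> \<one>" "x \<ominus> \<one> \<in> carrier R" by (auto simp: minus_eq a_assoc l_neg)
      then show "x \<in> (\<lambda>x. x \<oplus> \<one>) ` carrier R" by blast
    qed
  qed auto
  have "?S = (\<Oplus>x\<in>carrier R. x \<oplus> \<one>)"
    using finsum_reindex[of "\<lambda>x. x" "\<lambda>x. x \<oplus> \<one>" "carrier R"] unfolding img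
    by (auto simp: inj_on_def)
  also have "\<dots> = ?S \<oplus> \<guillemotleft>int (card (carrier R))\<guillemotright>"
    unfolding const[OF fin, symmetric] by (intro finsum_addf) auto
  finally show ?thesis using S add.r_cancel_one'[of "\<guillemotleft>int (card (carrier R))\<guillemotright>" ?S] by (simp add: eq_commute)
qed

text \<open>From p^k * 1 = 0 it follows that p * 1 = 0, as a field has no nilpotents; p being odd
  then rules out 2 = 0.\<close>

lemma admissible_field_character:
  fixes F :: "('a, 'm) ring_scheme"
  assumes "admissible_field d F"
  shows "\<exists>\<psi>. field_character F \<psi>"
proof -
  interpret field F using assms by (simp add: admissible_field_def)
  obtain p k where p: "prime (p::nat)" "odd p" "0 < k" "order F = p ^ k"
    using assms by (auto simp: admissible_field_def)
  have card: "card (carrier F) = p ^ k" using p(4) by (simp add: Coset.order_def)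
  have fin: "finite (carrier F)"
    using p(1) prime_gt_0_nat by (intro card_ge_0_finite) (simp add: card)
  have p0: "\<guillemotleft>int p\<guillemotright>\<^bsub>F\<^esub> = \<zero>\<^bsub>F\<^esub>"
  proof -
    have "\<guillemotleft>int p\<guillemotright>\<^bsub>F\<^esub> [^]\<^bsub>F\<^esub> k = \<zero>\<^bsub>F\<^esub>"
      using of_int_card_carrier[OF fin] unfolding card of_nat_power of_int_power .
    then show ?thesis by (simp add: nat_pow_eq_0_iff)
  qed
  obtain m where m: "p = 2 * m + 1" using p(2) by (metis oddE)
  have two: "\<one>\<^bsub>F\<^esub> \<oplus>\<^bsub>F\<^esub> \<one>\<^bsub>F\<^esub> \<noteq> \<zero>\<^bsub>F\<^esub>"
  proof
    assume "\<one>\<^bsub>F\<^esub> \<oplus>\<^bsub>F\<^esub> \<one>\<^bsub>F\<^esub> = \<zero>\<^bsub>F\<^esub>"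
    then have "\<guillemotleft>2\<guillemotright>\<^bsub>F\<^esub> = \<zero>\<^bsub>F\<^esub>" by (simp add: of_int_2)
    moreover have "int p = 2 * int m + 1" using m by simp
    ultimately have "\<guillemotleft>int p\<guillemotright>\<^bsub>F\<^esub> = \<one>\<^bsub>F\<^esub>" by (simp only: of_int_add of_int_mult) simp
    then show False using p0 by simp
  qed
  interpret odd_finite_field F using fin two by unfold_locales
  obtain \<psi> :: "'a \<Rightarrow> complex" where \<psi>: "\<forall>a\<in>carrier F. \<forall>b\<in>carrier F. \<psi> (a \<oplus>\<^bsub>F\<^esub> b) = \<psi> a * \<psi> b"
    "\<forall>a\<in>carrier F. cmod (\<psi> a) = 1" "\<exists>a\<in>carrier F. \<psi> a \<noteq> 1"
    using exists_nontrivial_character[OF fin p(1) p0] by blast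
  have "field_character F \<psi>" by unfold_locales (use \<psi> in auto)
  then show ?thesis by (intro exI[of _ \<psi>])
qed

text \<open>The carrier consists of natural numbers because the uniform constant is quantified over
  \<open>nat ring\<close>.\<close>

definition zmod :: "nat \<Rightarrow> nat ring" where
  "zmod p = \<lparr>carrier = {..<p}, mult = (\<lambda>x y. x * y mod p), one = 1, zero = 0, add = (\<lambda>x y. (x + y) mod p)\<rparr>"

lemma field_zmod:
  assumes p: "prime p"
  shows "field (zmod p)"
proof -
  have p1: "p > 1" using p prime_gt_1_nat by blast
  have "cring (zmod p)"
  proof (rule cringI)
    show "abelian_group (zmod p)"
    proof (rule abelian_groupI)
      fix x assume x: "x \<in> carrier (zmod p)"
      show "\<exists>y\<in>carrier (zmod p). y \<oplus>\<^bsub>zmod p\<^esub> x = \<zero>\<^bsub>zmod p\<^esub>"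
        using x p1 by (intro bexI[of _ "(p - x) mod p"]) (auto simp: zmod_def mod_add_left_eq)
    qed (use p1 in \<open>auto simp: zmod_def mod_add_left_eq mod_add_right_eq add_ac\<close>)
    show "comm_monoid (zmod p)"
      by (rule comm_monoidI) (use p1 in \<open>auto simp: zmod_def mod_mult_left_eq mod_mult_right_eq mult_ac\<close>)
    show "(x \<oplus>\<^bsub>zmod p\<^esub> y) \<otimes>\<^bsub>zmod p\<^esub> z = x \<otimes>\<^bsub>zmod p\<^esub> z \<oplus>\<^bsub>zmod p\<^esub> y \<otimes>\<^bsub>zmod p\<^esub> z" for x y z
      by (simp add: zmod_def mod_mult_left_eq mod_add_eq distrib_right)
  qed
  then interpret cring "zmod p" .
  show ?thesis
  proof (rule cring_fieldI2)
    show "\<zero>\<^bsub>zmod p\<^esub> \<noteq> \<one>\<^bsub>zmod p\<^esub>" by (simp add: zmod_def)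
    fix a assume "a \<in> carrier (zmod p)" "a \<noteq> \<zero>\<^bsub>zmod p\<^esub>"
    then have a: "a < p" "a \<noteq> 0" by (auto simp: zmod_def)
    have "coprime a p" using p a by (metis coprime_commute nat_dvd_not_less not_gr_zero prime_imp_coprime)
    then obtain x y where "a * x = p * y + 1" using bezout_nat[OF a(2), of p] by auto
    then have "a * x mod p = (1 + p * y) mod p" by simp
    also have "\<dots> = 1" using p1 by (simp only: mod_mult_self2 mod_less)
    finally have "a * (x mod p) mod p = 1" by (simp only: mod_mult_right_eq)
    then show "\<exists>b\<in>carrier (zmod p). a \<otimes>\<^bsub>zmod p\<^esub> b = \<one>\<^bsub>zmod p\<^esub>"
      using p1 by (intro bexI[of _ "x mod p"]) (auto simp: zmod_def)
  qed
qed

text \<open>A prime factor \<open>p\<close> of \<open>3 (m!)^2 - 1\<close> exceeds \<open>m\<close>, and \<open>(3 m!)^2 \<equiv> 3\<close> modulo \<open>p\<close>.\<close>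

lemma exists_prime_3_square:
  fixes m :: nat
  assumes "3 \<le> m"
  shows "\<exists>p x. prime p \<and> m < p \<and> (x * x) mod p = 3"
proof -
  define y :: nat where "y = fact m"
  have y1: "1 \<le> y" by (simp add: y_def)
  have "1 * 1 \<le> y * y" using y1 by (intro mult_mono) auto
  moreover have "3 * z - 1 \<noteq> 1" "9 * z = 3 * (3 * z - 1) + 3" "3 * z = (3 * z - 1) + 1" if "1 \<le> z" for z :: nat
    using that by arith+
  ultimately have n: "3 * (y * y) - 1 \<noteq> 1" "9 * (y * y) = 3 * (3 * (y * y) - 1) + 3"
    "3 * (y * y) = (3 * (y * y) - 1) + 1" by simp_all
  obtain p where p: "prime p" "p dvd 3 * (y * y) - 1" using prime_factor_nat[OF n(1)] by blast
  have "m < p"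
  proof (rule ccontr)
    assume "\<not> m < p"
    then have "p dvd y" unfolding y_def using p(1) by (simp add: prime_dvd_fact_iff)
    then have "p dvd 3 * (y * y)" by simp
    moreover note n(3)
    ultimately have "p dvd 1" using p(2) by (metis dvd_add_right_iff)
    then show False using p(1) by simp
  qed
  moreover have "(3 * y) * (3 * y) mod p = 3"
  proof -
    obtain c where c: "3 * (y * y) - 1 = p * c" using p(2) by (elim dvdE)
    have "(3 * y) * (3 * y) = 3 * (3 * (y * y) - 1) + 3" unfolding n(2)[symmetric] by simp
    also have "\<dots> = 3 + p * (3 * c)" unfolding c by simp
    finally have "(3 * y) * (3 * y) mod p = 3 mod p" by (metis mod_mult_self2)
    \<comment> \<open>p > m \<ge> 3, so 3 is already reduced modulo p.\<close>
    then show ?thesis using \<open>m < p\<close> assms by simp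
  qed
  ultimately show ?thesis using p(1) by blast
qed

lemma exists_large_admissible_field: "\<exists>F :: nat ring. admissible_field d F \<and> m < order F"
proof -
  \<comment> \<open>p > 3 makes p odd and keeps 1 + 1 + 1 = 3 nonzero.\<close>
  obtain p x where p: "prime p" "max 3 m < p" and x: "(x * x) mod p = 3"
    using exists_prime_3_square[of "max 3 m"] by auto
  interpret field "zmod p" by (rule field_zmod[OF p(1)])
  have ord: "order (zmod p) = p" by (simp add: Coset.order_def zmod_def)
  have "odd p" using p by (intro prime_odd_nat) auto
  moreover have "\<one>\<^bsub>zmod p\<^esub> \<oplus>\<^bsub>zmod p\<^esub> \<one>\<^bsub>zmod p\<^esub> \<oplus>\<^bsub>zmod p\<^esub> \<one>\<^bsub>zmod p\<^esub> = 3"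
    using p(2) by (simp add: zmod_def)
  moreover have "(x mod p) [^]\<^bsub>zmod p\<^esub> (2::nat) = 3"
  proof -
    have "(x mod p) \<otimes>\<^bsub>zmod p\<^esub> (x mod p) = 3" using x by (simp add: zmod_def mod_mult_eq)
    moreover have "x mod p \<in> carrier (zmod p)" using p(2) by (simp add: zmod_def)
    ultimately show ?thesis by (simp add: numeral_2_eq_2)
  qed
  moreover have "x mod p \<in> carrier (zmod p)" "\<zero>\<^bsub>zmod p\<^esub> = 0" using p(2) by (auto simp: zmod_def)
  moreover have "\<exists>q k. prime (q::nat) \<and> odd q \<and> 0 < k \<and> order (zmod p) = q ^ k"
    using p(1) \<open>odd p\<close> by (intro exI[of _ p] exI[of _ 1]) (simp add: ord)
  ultimately have "admissible_field d (zmod p)"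
    unfolding admissible_field_def Let_def using field_axioms by auto
  then show ?thesis using p(2) ord by auto
qed

lemma powr_unbounded:
  fixes e C :: real
  assumes "\<And>m :: nat. \<exists>n > m. real n powr e \<le> C"
  shows "e \<le> 0"
proof (rule ccontr)
  assume "\<not> e \<le> 0"
  then have e: "0 < e" by simp
  obtain n where n: "nat \<lceil>(\<bar>C\<bar> + 1) powr (1 / e)\<rceil> < n" "real n powr e \<le> C" using assms by blast
  have "(\<bar>C\<bar> + 1) powr (1 / e) \<le> real n" using n(1) by linarith
  then have "((\<bar>C\<bar> + 1) powr (1 / e)) powr e \<le> real n powr e" using e by (intro powr_mono2) auto
  then have "\<bar>C\<bar> + 1 \<le> real n powr e" using e by (simp add: powr_powr)
  then show False using n(2) by linarith
qed

section \<open>The two implications\<close>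

lemma uniformly_bounded_necessary:
  assumes d: "2 \<le> d" and p: "1 \<le> p1" "1 \<le> p2" and K: "K2_uniformly_bounded d p1 p2"
  shows "inv_exp p1 + real d * inv_exp p2 \<le> real d" "real d * inv_exp p1 + inv_exp p2 \<le> real d"
proof -
  obtain C where C: "1 \<le> C" "\<And>F :: nat ring. \<And>t. admissible_field d F \<Longrightarrow> t \<in> carrier F - {\<zero>\<^bsub>F\<^esub>} \<Longrightarrow> K2_const F d t p1 p2 \<le> C"
    using K by (auto simp: K2_uniformly_bounded_def)
  let ?\<alpha> = "inv_exp p1" and ?\<beta> = "inv_exp p2"
  have both: "real (order F) powr (?\<alpha> + real d * ?\<beta> - real d) \<le> 2 * C \<and>
      real (order F) powr (?\<beta> + real d * ?\<alpha> - real d) \<le> 2 * C" if F: "admissible_field d F" for F :: "nat ring"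
  proof -
    obtain \<psi> where "field_character F \<psi>" using admissible_field_character[OF F] by blast
    then interpret field_character F \<psi> .
    \<comment> \<open>The test is carried out on the sphere with t = 1; exchanging f and g turns it
      into the second inequality.\<close>
    have bound: "K2 d \<one>\<^bsub>F\<^esub> f g \<le> C * (nrm F d ?\<alpha> f * nrm F d ?\<beta> g)"
      if fg: "\<And>x. 0 \<le> f x" "\<And>x. 0 \<le> g x" for f g
    proof -
      have "K2_bound F d \<one>\<^bsub>F\<^esub> p1 p2 (K2_const F d \<one>\<^bsub>F\<^esub> p1 p2)"
        by (rule K2_bound_K2_const[OF finite_carrier vecs_nonempty p])
      then have "K2 d \<one>\<^bsub>F\<^esub> f g \<le> K2_const F d \<one>\<^bsub>F\<^esub> p1 p2 * Lp_norm F d p1 f * Lp_norm F d p2 g"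
        using fg unfolding K2_bound_def K2_op_K2 by blast
      also have "\<dots> = K2_const F d \<one>\<^bsub>F\<^esub> p1 p2 * (nrm F d ?\<alpha> f * nrm F d ?\<beta> g)"
        by (simp add: Lp_norm_eq_nrm p)
      also have "\<dots> \<le> C * (nrm F d ?\<alpha> f * nrm F d ?\<beta> g)"
        using C(2)[OF F, of "\<one>\<^bsub>F\<^esub>"] by (intro mult_right_mono mult_nonneg_nonneg nrm_nonneg) auto
      finally show ?thesis .
    qed
    have bound': "K2 d \<one>\<^bsub>F\<^esub> f g \<le> C * (nrm F d ?\<beta> f * nrm F d ?\<alpha> g)"
      if fg: "\<And>x. 0 \<le> f x" "\<And>x. 0 \<le> g x" for f g
      using bound[of g f, OF fg(2,1)] sphere_form_comm[of d "\<one>\<^bsub>F\<^esub>" f g] by (simp add: K2_def mult.commute)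
    have C0: "0 \<le> C" using C by simp
    show ?thesis
      using necessary_inequality[OF d one_closed one_not_zero inv_exp(1,2)[OF p(1)] inv_exp(1)[OF p(2)] C0 bound]
        necessary_inequality[OF d one_closed one_not_zero inv_exp(1,2)[OF p(2)] inv_exp(1)[OF p(1)] C0 bound']
      by blast
  qed
  have "?\<alpha> + real d * ?\<beta> - real d \<le> 0"
    by (rule powr_unbounded[of _ "2 * C"]) (use both exists_large_admissible_field[of d] in blast)
  moreover have "?\<beta> + real d * ?\<alpha> - real d \<le> 0"
    by (rule powr_unbounded[of _ "2 * C"]) (use both exists_large_admissible_field[of d] in blast)
  ultimately show "?\<alpha> + real d * ?\<beta> \<le> real d" "real d * ?\<alpha> + ?\<beta> \<le> real d" by linarith+
qed

lemma uniformly_bounded_sufficient: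
  assumes d: "2 \<le> d" and p: "1 \<le> p1" "1 \<le> p2"
    and r: "inv_exp p1 + real d * inv_exp p2 \<le> real d" "real d * inv_exp p1 + inv_exp p2 \<le> real d"
  shows "K2_uniformly_bounded d p1 p2"
  unfolding K2_uniformly_bounded_def
proof (intro exI[of _ "max 1 (3 * vertex_const d)"] conjI allI impI ballI)
  fix F :: "nat ring" and t
  assume F: "admissible_field d F" and t: "t \<in> carrier F - {\<zero>\<^bsub>F\<^esub>}"
  obtain \<psi> where "field_character F \<psi>" using admissible_field_character[OF F] by blast
  then interpret field_character F \<psi> .
  show "K2_const F d t p1 p2 \<le> max 1 (3 * vertex_const d)"
  proof (rule K2_const_le[OF finite_carrier vecs_nonempty p])
    show "K2_bound F d t p1 p2 (max 1 (3 * vertex_const d))"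
      unfolding K2_bound_def
    proof (intro allI impI, elim conjE)
      fix f g :: "(nat \<Rightarrow> nat) \<Rightarrow> real"
      assume fg: "\<forall>x\<in>vecs F d. 0 \<le> f x" "\<forall>x\<in>vecs F d. 0 \<le> g x"
      have "K2 d t f g \<le> max 1 (3 * vertex_const d) * (nrm F d (inv_exp p1) f * nrm F d (inv_exp p2) g)"
        by (rule K2_region[OF d]) (use t fg inv_exp(1,2) p r vertex_const_nonneg[OF d] in auto)
      then show "K2_op F d t f g \<le> max 1 (3 * vertex_const d) * Lp_norm F d p1 f * Lp_norm F d p2 g"
        by (simp add: K2_op_K2 Lp_norm_eq_nrm p mult.assoc)
    qed
  qed
qed simp

theorem theorem3p5:
  fixes d :: nat and p1 p2 :: ereal
  assumes "2 \<le> d" and "1 \<le> p1" and "1 \<le> p2"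
  shows "K2_uniformly_bounded d p1 p2 \<longleftrightarrow>
           1 / p1 + ereal (real d) / p2 \<le> ereal (real d) \<and>
           ereal (real d) / p1 + 1 / p2 \<le> ereal (real d)"
proof -
  have "1 / p = ereal (inv_exp p)" if "1 \<le> p" for p
    using inv_exp(3)[OF that, of 1] by (simp add: one_ereal_def)
  then have "(1 / p1 + ereal (real d) / p2 \<le> ereal (real d) \<and> ereal (real d) / p1 + 1 / p2 \<le> ereal (real d)) \<longleftrightarrow>
      (inv_exp p1 + real d * inv_exp p2 \<le> real d \<and> real d * inv_exp p1 + inv_exp p2 \<le> real d)"
    using assms by (simp add: inv_exp(3))
  then show ?thesis
    using uniformly_bounded_necessary[OF assms] uniformly_bounded_sufficient[OF assms] by blast
qed

end
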